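(* Assume $n\geq t\geq 2$ are integers, let $\mathbb{K}$ be a field and $R=\mathbb{K}[x_1,\ldots,x_n]$. Let $I_t(L_n)\subset R$ be the $t$-path ideal of the line graph $L_n$. Then, for all $s\geq 1$, $$\mathrm{reg}\, R/I_t(L_n)^s=\Gamma(n,t)+t(s-1).$$
   Context: The line graph $L_n$ is the graph with vertex set $\{x_1,\ldots,x_n\}$ and edge set $\{\{x_j,x_{j+1}\}\mid j=1,\ldots,n-1\}$. Its $t$-path ideal is the squarefree monomial ideal $I_t(L_n)=(u_1,\ldots,u_{n-t+1})\subset R$, where $u_i=x_ix_{i+1}\cdots x_{i+t-1}$ for $i=1,\ldots,n-t+1$. Here $\mathrm{reg}$ denotes the Castelnuovo-Mumford regularity of a finitely generated graded $R$-module, $\mathrm{reg}\,M=\max\{j-i\mid \beta_{i,j}(M)\neq 0\}$. The function $\Gamma$ on $\mathbb{Z}_{\geq 0}\times\mathbb{Z}_{\geq 0}$ is defined as follows: write $n=p(t+1)+d$ with integers $p\geq 0$ and $0\leq d\leq t$; then $\Gamma(n,t)=p(t-1)$ if $0\leq d<t$, and $\Gamma(n,t)=(p+1)(t-1)$ if $d=t$. *)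

theory Defs
  imports
    "HOL-Library.Poly_Mapping"
    "HOL-Algebra.QuotRing"
    "HOL-Algebra.Ideal_Product"
    "HOL-Algebra.Module"
begin

section \<open>The standard graded polynomial ring\<close>

text \<open>Exponent vectors are finitely supported maps from variable indices to exponents; the
  polynomials in \<open>x\<^sub>1, \<dots>, x\<^sub>n\<close> are those all of whose monomials involve only the indices
  \<open>1, \<dots>, n\<close>.\<close>

type_synonym 'k mpoly = "(nat \<Rightarrow>\<^sub>0 nat) \<Rightarrow>\<^sub>0 'k"

definition poly_ring :: "nat \<Rightarrow> 'k::field mpoly ring" where
  "poly_ring n =
    \<lparr>carrier = {p. \<forall>m\<in>Poly_Mapping.keys p. Poly_Mapping.keys m \<subseteq> {1..n}},
     mult = (*), one = 1, zero = 0, add = (+)\<rparr>"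

definition var :: "nat \<Rightarrow> 'k::field mpoly" where
  "var i = Poly_Mapping.single (Poly_Mapping.single i 1) 1"

definition monom_deg :: "(nat \<Rightarrow>\<^sub>0 nat) \<Rightarrow> nat" where
  "monom_deg m = (\<Sum>i\<in>Poly_Mapping.keys m. Poly_Mapping.lookup m i)"

text \<open>The component \<open>R\<^sub>j\<close>; it is \<open>{0}\<close> for \<open>j < 0\<close>.\<close>

definition homog :: "nat \<Rightarrow> int \<Rightarrow> 'k::field mpoly set" where
  "homog n j = {p \<in> carrier (poly_ring n). \<forall>m\<in>Poly_Mapping.keys p. int (monom_deg m) = j}"

definition irrelevant_ideal :: "nat \<Rightarrow> 'k::field mpoly set" where
  "irrelevant_ideal n = genideal (poly_ring n) (var ` {1..n})"


section \<open>Graded modules and minimal graded free resolutions\<close>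

text \<open>\<open>hcomp M j\<close> is the homogeneous component \<open>M\<^sub>j\<close>. The fields \<open>mult\<close> and \<open>one\<close>, which module
  records inherit from rings, play no role.\<close>

record ('a, 'b) graded_module = "('a, 'b) module" +
  hcomp :: "int \<Rightarrow> 'b set"

text \<open>Cosets of homogeneous polynomials form the components; \<open>r (I + a) = (I + r) (I + a)\<close>.\<close>

definition quot_module ::
    "nat \<Rightarrow> 'k::field mpoly set \<Rightarrow> ('k mpoly, 'k mpoly set) graded_module" where
  "quot_module n I =
    \<lparr>carrier = carrier (poly_ring n Quot I),
     mult = mult (poly_ring n Quot I), one = one (poly_ring n Quot I),
     zero = zero (poly_ring n Quot I), add = add (poly_ring n Quot I),
     smult = (\<lambda>r X. (I +>\<^bsub>poly_ring n\<^esub> r) \<otimes>\<^bsub>poly_ring n Quot I\<^esub> X),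
     hcomp = (\<lambda>j. {I +>\<^bsub>poly_ring n\<^esub> p | p. p \<in> homog n j})\<rparr>"

text \<open>For \<open>ds = [d\<^sub>1, \<dots>, d\<^sub>r]\<close> this is \<open>R(-d\<^sub>1) \<oplus> \<cdots> \<oplus> R(-d\<^sub>r)\<close>, where \<open>R(-d)\<^sub>j = R\<^bsub>j - d\<^esub>\<close>.
  Its elements are coordinate functions that vanish from index \<open>r\<close> on.\<close>

definition free_module ::
    "nat \<Rightarrow> int list \<Rightarrow> ('k::field mpoly, nat \<Rightarrow> 'k mpoly) graded_module" where
  "free_module n ds =
    (let F = {v. (\<forall>k<length ds. v k \<in> carrier (poly_ring n)) \<and> (\<forall>k\<ge>length ds. v k = 0)} in
    \<lparr>carrier = F,
     mult = (\<lambda>v w k. v k * w k), one = (\<lambda>k. if k < length ds then 1 else 0),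
     zero = (\<lambda>k. 0), add = (\<lambda>v w k. v k + w k),
     smult = (\<lambda>r v k. r * v k),
     hcomp = (\<lambda>j. {v \<in> F. \<forall>k<length ds. v k \<in> homog n (j - ds ! k)})\<rparr>)"

definition graded_hom ::
    "nat \<Rightarrow> ('k::field mpoly, 'b) graded_module \<Rightarrow> ('k mpoly, 'c) graded_module \<Rightarrow> ('b \<Rightarrow> 'c) set"
    where
  "graded_hom n M N =
    {f \<in> hom (add_monoid M) (add_monoid N).
      (\<forall>r\<in>carrier (poly_ring n). \<forall>x\<in>carrier M. f (r \<odot>\<^bsub>M\<^esub> x) = r \<odot>\<^bsub>N\<^esub> f x) \<and>
      (\<forall>j. f ` hcomp M j \<subseteq> hcomp N j)}"

text \<open>The resolution \<open>\<cdots> \<rightarrow> F\<^sub>2 \<rightarrow> F\<^sub>1 \<rightarrow> F\<^sub>0 \<rightarrow> M \<rightarrow> 0\<close> has \<open>F\<^sub>i = free_module n (ds i)\<close>, augmentation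
  \<open>\<epsilon> : F\<^sub>0 \<rightarrow> M\<close> and differentials \<open>\<delta> i : F\<^bsub>i+1\<^esub> \<rightarrow> F\<^sub>i\<close>. Minimality means that the image of
  \<open>\<delta> i\<close> lies in \<open>\<mm> F\<^sub>i\<close>, that is, all coordinates lie in the irrelevant ideal \<open>\<mm>\<close>.\<close>

definition minimal_free_resolution ::
    "nat \<Rightarrow> ('k::field mpoly, 'b) graded_module \<Rightarrow> (nat \<Rightarrow> int list) \<Rightarrow>
     ((nat \<Rightarrow> 'k mpoly) \<Rightarrow> 'b) \<Rightarrow> (nat \<Rightarrow> (nat \<Rightarrow> 'k mpoly) \<Rightarrow> (nat \<Rightarrow> 'k mpoly)) \<Rightarrow> bool" where
  "minimal_free_resolution n M ds \<epsilon> \<delta> \<longleftrightarrow>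
    (let F = (\<lambda>i. free_module n (ds i)) in
      \<epsilon> \<in> graded_hom n (F 0) M \<and>
      (\<forall>i. \<delta> i \<in> graded_hom n (F (Suc i)) (F i)) \<and>
      \<epsilon> ` carrier (F 0) = carrier M \<and>
      \<delta> 0 ` carrier (F 1) = a_kernel (F 0) M \<epsilon> \<and>
      (\<forall>i. \<delta> (Suc i) ` carrier (F (Suc (Suc i))) = a_kernel (F (Suc i)) (F i) (\<delta> i)) \<and>
      (\<forall>i. \<forall>v\<in>carrier (F (Suc i)). \<forall>k<length (ds i). \<delta> i v k \<in> irrelevant_ideal n))"

text \<open>Graded Betti numbers: \<open>F\<^sub>i\<close> is the direct sum of the \<open>R(-j)\<close> with multiplicity \<open>\<beta>\<^bsub>i,j\<^esub>(M)\<close>.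
  The choice of the resolution is immaterial, since minimal graded free resolutions of a finitely
  generated graded module exist and are unique up to isomorphism.\<close>

definition betti :: "nat \<Rightarrow> ('k::field mpoly, 'b) graded_module \<Rightarrow> nat \<Rightarrow> int \<Rightarrow> nat" where
  "betti n M i j =
    count_list ((SOME ds. \<exists>\<epsilon> \<delta>. minimal_free_resolution n M ds \<epsilon> \<delta>) i) j"

text \<open>Castelnuovo--Mumford regularity, for nonzero finitely generated graded modules.\<close>

definition reg :: "nat \<Rightarrow> ('k::field mpoly, 'b) graded_module \<Rightarrow> int" where
  "reg n M = Max {j - int i | i j. betti n M i j \<noteq> 0}"


section \<open>Path ideals of line graphs\<close>

definition path_monomial :: "nat \<Rightarrow> nat \<Rightarrow> 'k::field mpoly" where
  "path_monomial t i = (\<Prod>l = i..<i + t. var l)"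

definition path_ideal :: "nat \<Rightarrow> nat \<Rightarrow> 'k::field mpoly set" where
  "path_ideal n t = genideal (poly_ring n) {path_monomial t i | i. 1 \<le> i \<and> i + t \<le> n + 1}"

definition ideal_power :: "nat \<Rightarrow> 'k::field mpoly set \<Rightarrow> nat \<Rightarrow> 'k mpoly set" where
  "ideal_power n I s = I [^]\<^bsub>ideals_set (poly_ring n)\<^esub> s"

definition Gamma :: "nat \<Rightarrow> nat \<Rightarrow> int" where
  "Gamma n t =
    (let p = n div (t + 1); d = n mod (t + 1) in
      if d < t then int p * (int t - 1) else (int p + 1) * (int t - 1))"

end

theory Submission
  imports Defs "HOL-Library.Function_Algebras" "HOL.Vector_Spaces"
begin

text \<open>The regularity is read off from Koszul homology: dimension shifting along a minimal free resolution
  \<open>F\<close> of \<open>M\<close> shows that \<open>F\<^sub>i\<close> has a generator in degree \<open>j\<close> iff \<open>H\<^sub>i(x\<^sub>1, \<dots>, x\<^sub>n; M)\<^sub>j \<noteq> 0\<close>. The same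
  equivalence gives the finiteness needed to construct a minimal resolution: when the Koszul homology
  of \<open>M\<close> is bounded, every syzygy module is generated in bounded degrees.

  Upper bound. A monomial \<open>x\<^sup>b\<close> lies in \<open>I\<^sup>s\<close> iff at least \<open>s\<close> paths can be packed into \<open>b\<close>, and the
  greedy packing from left to right is optimal. Sorting the monomials outside \<open>I\<^sup>s\<close> by their greedy
  packing \<open>u\<close> filters \<open>R/I\<^sup>s\<close> with quotients \<open>u \<cdot> R/(I + (x\<^sub>a | a \<in> A))\<close>, where \<open>u\<close> is a product of fewer
  than \<open>s\<close> paths and \<open>a \<in> A\<close> iff \<open>u\<close> uses the path that starts at \<open>a + 1\<close>. Each of these is filtered further
  by shifted copies of \<open>R/(x\<^sub>i | i \<in> Z)\<close>, whose shifts have degree at most \<open>\<Gamma>(n,t)\<close>.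

  Lower bound. Let \<open>B\<^sub>1, \<dots>, B\<^sub>q\<close> be the paths that start at \<open>1, t + 2, 2t + 3, \<dots>\<close>. In the multidegree
  of \<open>B\<^sub>1\<^sup>s B\<^sub>2 \<cdots> B\<^sub>q\<close>, a Koszul chain on the variables \<open>S\<close> is nonzero modulo \<open>I\<^sup>s\<close> iff \<open>S\<close> meets all blocks,
  and summing the coefficients over all transversals detects a nonzero class in \<open>H\<^sub>q\<close>.\<close>


section \<open>Box filtrations\<close>

text \<open>The definition of Betti numbers picks some minimal resolution, so its degrees must not
  depend on the choice; comparing them with Koszul homology settles this without lifting maps
  between resolutions. Quotients never become types: a subquotient is a pair of families of sets and
  homology is phrased as a congruence, so one calculus covers \<open>R/I\<^sup>s\<close> and all its
  syzygies.

  The upper bound rests on two facts. Multiplication by a monomial never decreases a greedy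
  multiplicity as long as the earlier ones are unchanged, so the pieces are subquotients of modules.
  And the variables in \<open>A\<close> only empty a box or confine more of its coordinates; they
  never raise a shift, so the bound \<Gamma>(n,t) holds for every \<open>u\<close>, and
  \<open>u\<close> itself adds at most \<open>t (s - 1)\<close>. A box with corner \<sigma> has
  homology only where \<open>j - p\<close> is the degree of \<sigma>.

  The bounds meet because \<Gamma>(n,t) is \<open>(t - 1) q\<close> with \<open>q\<close> the
  integer part of \<open>(n + 1) / (t + 1)\<close>: the class of the lower bound has
  \<open>j = t (s + q - 1)\<close> and \<open>p = q\<close>.\<close>

definition exps :: "nat \<Rightarrow> (nat \<Rightarrow> nat) set" where
  "exps n = {b. \<forall>i. i \<notin> {1..n} \<longrightarrow> b i = 0}"

definition box :: "nat \<Rightarrow> (nat \<Rightarrow> nat) \<Rightarrow> nat set \<Rightarrow> (nat \<Rightarrow> nat) set" where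
  "box n \<sigma> Z = {b \<in> exps n. \<sigma> \<le> b \<and> (\<forall>i\<in>Z. b i = \<sigma> i)}"

text \<open>The sets of exponents behind filtrations of a monomial quotient by shifted copies of
  \<open>R/(x\<^sub>i | i \<in> Z)\<close> with shifts of degree at most \<open>r\<close>; the part \<open>V\<close> of a split is the submodule.\<close>

inductive box_filt :: "nat \<Rightarrow> nat \<Rightarrow> (nat \<Rightarrow> nat) set \<Rightarrow> bool" for n r where
  empty: "box_filt n r {}"
| box: "\<sigma> \<in> exps n \<Longrightarrow> Z \<subseteq> {1..n} \<Longrightarrow> (\<Sum>i=1..n. \<sigma> i) \<le> r \<Longrightarrow> box_filt n r (box n \<sigma> Z)"
| split: "box_filt n r V \<Longrightarrow> box_filt n r (W - V) \<Longrightarrow> V \<subseteq> W \<Longrightarrow>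
    \<forall>b\<in>V. \<forall>c\<in>W. b \<le> c \<longrightarrow> c \<in> V \<Longrightarrow> box_filt n r W"

lemma box_filt_mono:
  assumes "box_filt n r W" "r \<le> r'"
  shows "box_filt n r' W"
  using assms(1)
proof induction
  case empty
  show ?case by (rule box_filt.empty)
next
  case (box \<sigma> Z)
  then show ?case using assms(2) by (intro box_filt.box) auto
next
  case (split V W)
  show ?case by (rule box_filt.split[OF split.IH split.hyps(3,4)])
qed

text \<open>Translation by \<open>u\<close> is multiplication by a monomial: it preserves and
  reflects the order, so boxes and splits are carried along and only the degree of the corners
  grows.\<close>

lemma box_filt_shift:
  assumes "box_filt n r W" "u \<in> exps n"
  shows "box_filt n (r + (\<Sum>i=1..n. u i)) ((\<lambda>c i. u i + c i) ` W)"
  using assms(1)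
proof induction
  case empty
  then show ?case by (simp add: box_filt.empty)
next
  case (box \<sigma> Z)
  have "(\<lambda>c i. u i + c i) ` box n \<sigma> Z = box n (\<lambda>i. u i + \<sigma> i) Z" (is "?L = ?R")
  proof
    show "?L \<subseteq> ?R" using assms(2) by (auto simp: box_def exps_def le_fun_def)
    show "?R \<subseteq> ?L"
    proof
      fix c assume c: "c \<in> ?R"
      then have 1: "u i + \<sigma> i \<le> c i" for i by (auto simp: box_def le_fun_def)
      have "c = (\<lambda>i. u i + (c i - u i))" by (rule ext) (use 1 in \<open>metis add_leD1 le_add_diff_inverse\<close>)
      moreover have "(\<lambda>i. c i - u i) \<in> box n \<sigma> Z"
        using c 1 by (auto simp: box_def exps_def le_fun_def nat_le_iff_add) (metis add_diff_cancel_left' add.assoc le_add1)+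
      ultimately show "c \<in> ?L" by (rule image_eqI)
    qed
  qed
  moreover have "box_filt n (r + (\<Sum>i=1..n. u i)) (box n (\<lambda>i. u i + \<sigma> i) Z)"
    using box assms(2) by (intro box_filt.box) (auto simp: exps_def sum.distrib)
  ultimately show ?case by simp
next
  case (split V W)
  let ?s = "\<lambda>c i. u i + c i"
  have inj: "inj ?s" by (auto simp: inj_def fun_eq_iff)
  show ?case
  proof (rule box_filt.split)
    show "box_filt n (r + (\<Sum>i=1..n. u i)) (?s ` V)" by (rule split.IH)
    show "box_filt n (r + (\<Sum>i=1..n. u i)) (?s ` W - ?s ` V)"
      using split.IH(2) by (simp add: image_set_diff[OF inj])
    show "?s ` V \<subseteq> ?s ` W" using split.hyps by blast
    show "\<forall>b\<in>?s ` V. \<forall>c\<in>?s ` W. b \<le> c \<longrightarrow> c \<in> ?s ` V"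
      using split.hyps by (auto simp: le_fun_def)
  qed
qed

text \<open>Multiplying by a monomial never lowers \<open>\<kappa>\<close>, so the elements with the
  largest value form a submodule; peeling off these layers from the top reduces the claim to single
  values.\<close>

lemma box_filt_key:
  fixes \<kappa> :: "(nat \<Rightarrow> nat) \<Rightarrow> nat"
  assumes "\<And>k. k < s \<Longrightarrow> box_filt n r {b\<in>W. \<kappa> b = k}"
    and "\<And>b. b \<in> W \<Longrightarrow> \<kappa> b < s"
    and "\<And>b c. b \<in> W \<Longrightarrow> c \<in> W \<Longrightarrow> b \<le> c \<Longrightarrow> \<kappa> b \<le> \<kappa> c"
  shows "box_filt n r W"
  using assms
proof (induction s arbitrary: W)
  case 0
  then have "W = {}" by auto
  then show ?case by (simp add: box_filt.empty)
next
  case (Suc s)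
  let ?V = "{b\<in>W. \<kappa> b = s}"
  show ?case
  proof (rule box_filt.split[where V = ?V])
    show "box_filt n r ?V" using Suc.prems(1)[of s] by simp
    show "box_filt n r (W - ?V)"
    proof (rule Suc.IH)
      fix k assume "k < s"
      then have "{b \<in> W - ?V. \<kappa> b = k} = {b\<in>W. \<kappa> b = k}" by auto
      then show "box_filt n r {b \<in> W - ?V. \<kappa> b = k}" using Suc.prems(1)[of k] \<open>k < s\<close> by simp
    qed (use Suc.prems(2,3) less_Suc_eq in auto)
    show "?V \<subseteq> W" by auto
    show "\<forall>b\<in>?V. \<forall>c\<in>W. b \<le> c \<longrightarrow> c \<in> ?V"
      using Suc.prems(2,3) by (auto simp: less_Suc_eq_le le_antisym)
  qed
qed

text \<open>State of a left-to-right scan: the entries before \<open>j\<close> are already confined to the box of \<open>\<sigma>\<close> and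
  \<open>Z\<close>, the interval \<open>[j, j + l)\<close> must contain a zero (if it fits into \<open>[1, n]\<close>), and so must all paths
  that start after \<open>j\<close>.\<close>

definition path_free :: "nat \<Rightarrow> nat \<Rightarrow> nat set \<Rightarrow> nat \<Rightarrow> nat \<Rightarrow> (nat \<Rightarrow> nat) \<Rightarrow> nat set \<Rightarrow> (nat \<Rightarrow> nat) set"
  where "path_free n t A j l \<sigma> Z = {c \<in> exps n. (\<forall>i<j. \<sigma> i \<le> c i \<and> (i \<in> Z \<longrightarrow> c i = \<sigma> i)) \<and>
    (\<forall>a\<in>A. c a = 0) \<and> (j + l \<le> n + 1 \<longrightarrow> (\<exists>i\<in>{j..<j + l}. c i = 0)) \<and>
    (\<forall>i>j. i + t \<le> n + 1 \<longrightarrow> (\<exists>k\<in>{i..<i + t}. c k = 0))}"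

text \<open>Extends \<Gamma> to a scan with \<open>R\<close> variables left whose current interval
  has length \<open>l\<close>; \<open>path_reg t n t\<close> is \<Gamma>(n,t). The formula dominates
  the recursion in which the interval either yields \<open>l - 1\<close> forced positive entries or
  loses its first position.\<close>

definition path_reg :: "nat \<Rightarrow> nat \<Rightarrow> nat \<Rightarrow> nat" where
  "path_reg t R l = (t - 1) * (R div (t + 1)) + (if l \<le> R mod (t + 1) then l - 1 else 0)"

lemma path_freeI:
  assumes "c \<in> exps n" "\<And>i. i < j \<Longrightarrow> \<sigma> i \<le> c i" "\<And>i. i < j \<Longrightarrow> i \<in> Z \<Longrightarrow> c i = \<sigma> i"
    "\<And>a. a \<in> A \<Longrightarrow> c a = 0" "j + l \<le> n + 1 \<Longrightarrow> \<exists>i\<in>{j..<j + l}. c i = 0"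
    "\<And>i. j < i \<Longrightarrow> i + t \<le> n + 1 \<Longrightarrow> \<exists>k\<in>{i..<i + t}. c k = 0"
  shows "c \<in> path_free n t A j l \<sigma> Z"
  using assms unfolding path_free_def by blast

lemma path_freeD:
  assumes "c \<in> path_free n t A j l \<sigma> Z"
  shows "c \<in> exps n" "i < j \<Longrightarrow> \<sigma> i \<le> c i" "i < j \<Longrightarrow> i \<in> Z \<Longrightarrow> c i = \<sigma> i"
    "a \<in> A \<Longrightarrow> c a = 0" "j + l \<le> n + 1 \<Longrightarrow> \<exists>i\<in>{j..<j + l}. c i = 0"
    "j < i \<Longrightarrow> i + t \<le> n + 1 \<Longrightarrow> \<exists>k\<in>{i..<i + t}. c k = 0"
  using assms unfolding path_free_def by blast+

lemma path_reg_eq: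
  assumes "\<rho> \<le> t"
  shows "path_reg t (q * (t + 1) + \<rho>) l = (t - 1) * q + (if l \<le> \<rho> then l - 1 else 0)"
proof -
  have "(q * (t + 1) + \<rho>) div (t + 1) = q" "(q * (t + 1) + \<rho>) mod (t + 1) = \<rho>"
    using assms by (simp_all del: mult_Suc_right add_Suc_right)
  then show ?thesis by (simp only: path_reg_def)
qed

text \<open>Both cases are in fact equalities, so this branch determines the formula. Either
  \<open>l\<close> fits into the remainder \<rho> and leaves too little for a further contribution,
  or a full period is broken and its unspent part \<open>t - l\<close> is the remainder term of the
  new scan.\<close>

lemma path_reg_step1:
  assumes "1 \<le> l" "l \<le> t" "l \<le> R"
  shows "l - 1 + path_reg t (R - l) (t - l + 1) \<le> path_reg t R l"
proof -
  define q \<rho> where "q = R div (t + 1)" and "\<rho> = R mod (t + 1)"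
  have R: "R = q * (t + 1) + \<rho>" and "\<rho> < t + 1"
    by (simp_all only: q_def \<rho>_def div_mult_mod_eq) simp
  then have \<rho>: "\<rho> \<le> t" by simp
  show ?thesis
  proof (cases "l \<le> \<rho>")
    case True
    have e: "R - l = q * (t + 1) + (\<rho> - l)" using R True by simp
    have "path_reg t (R - l) (t - l + 1) = (t - 1) * q"
      unfolding e using \<rho> True assms by (subst path_reg_eq) auto
    moreover have "path_reg t R l = (t - 1) * q + (l - 1)"
      unfolding R using True by (simp only: path_reg_eq[OF \<rho>] if_True)
    ultimately show ?thesis by simp
  next
    case False
    then obtain q' where q: "q = Suc q'" using R assms by (cases q) auto
    have e: "R - l = q' * (t + 1) + (t + 1 + \<rho> - l)" using R q False assms by (simp add: algebra_simps)
    have "path_reg t (R - l) (t - l + 1) = (t - 1) * q' + (t - l)"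
      unfolding e using \<rho> False assms by (subst path_reg_eq) auto
    moreover have "path_reg t R l = (t - 1) * q' + (t - 1)"
      unfolding R using False q by (simp only: path_reg_eq[OF \<rho>] if_False) simp
    ultimately show ?thesis using assms by simp
  qed
qed

text \<open>Only \<rho> = 0 needs thought: removing a position then breaks a whole period worth
  \<open>t - 1\<close>, while the new remainder \<open>t\<close> earns just
  \<open>l - 2\<close>.\<close>

lemma path_reg_step2:
  assumes "2 \<le> l" "l \<le> t" "l \<le> R"
  shows "path_reg t (R - 1) (l - 1) \<le> path_reg t R l"
proof -
  define q \<rho> where "q = R div (t + 1)" and "\<rho> = R mod (t + 1)"
  have R: "R = q * (t + 1) + \<rho>" and "\<rho> < t + 1"
    by (simp_all only: q_def \<rho>_def div_mult_mod_eq) simp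
  then have \<rho>: "\<rho> \<le> t" by simp
  show ?thesis
  proof (cases \<rho>)
    case (Suc \<rho>')
    have e: "R - 1 = q * (t + 1) + \<rho>'" using R Suc by simp
    have "path_reg t (R - 1) (l - 1) = (t - 1) * q + (if l - 1 \<le> \<rho>' then l - 1 - 1 else 0)"
      unfolding e using Suc \<rho> by (subst path_reg_eq) auto
    moreover have "path_reg t R l = (t - 1) * q + (if l \<le> \<rho> then l - 1 else 0)"
      unfolding R by (simp only: path_reg_eq[OF \<rho>])
    ultimately show ?thesis using assms Suc by auto
  next
    case 0
    then obtain q' where q: "q = Suc q'" using R assms by (cases q) auto
    have e: "R - 1 = q' * (t + 1) + t" using R q 0 by (simp add: algebra_simps)
    have "path_reg t (R - 1) (l - 1) = (t - 1) * q' + (l - 2)"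
      unfolding e using assms by (subst path_reg_eq) auto
    moreover have "path_reg t R l = (t - 1) * q' + (t - 1)"
      unfolding R using 0 q assms by (simp only: path_reg_eq[OF le0] 0) simp
    moreover have "l - 2 \<le> t - 1" using assms by linarith
    ultimately show ?thesis by linarith
  qed
qed

text \<open>Split according to whether all entries in \<open>[j + 1, j + l)\<close> are positive. If so, the zero is at
  \<open>j\<close>; otherwise the entry at \<open>j\<close> is free.\<close>

lemma box_filt_path_free:
  assumes "1 \<le> l" "l \<le> t" "1 \<le> j" "\<sigma> \<in> exps n" "Z \<subseteq> {1..n}"
    and "\<forall>i\<ge>j. \<sigma> i = 0" "Z \<subseteq> {..<j}"
  shows "box_filt n ((\<Sum>i=1..n. \<sigma> i) + path_reg t (n + 1 - j) l) (path_free n t A j l \<sigma> Z)"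
  using assms
proof (induction "n + 1 - j" arbitrary: j l \<sigma> Z rule: less_induct)
  case less
  show ?case
  proof (cases "j + l \<le> n + 1")
    case False
    \<comment> \<open>The scan is over: without room for the current interval there is none for a
      later path, so only the zeros prescribed by \<open>A\<close> remain. They either contradict an
      entry already forced to be positive or confine further variables.\<close>
    have noi: "\<not> i + t \<le> n + 1" if "i > j" for i using that False less.prems by linarith
    show ?thesis
    proof (cases "\<exists>a\<in>A. \<sigma> a > 0")
      case True
      then obtain a where a: "a \<in> A" "\<sigma> a > 0" by blast
      then have "a < j" using less.prems by (metis linorder_not_less less_numeral_extra(3))
      then have "path_free n t A j l \<sigma> Z = {}" using a by (fastforce simp: path_free_def)
      then show ?thesis by (simp add: box_filt.empty)
    next
      case nA: False
      have s0: "\<sigma> i = 0" if "\<not> i < j" for i using less.prems that by auto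
      have "path_free n t A j l \<sigma> Z = box n \<sigma> (Z \<union> (A \<inter> {1..n}))"
      proof (rule Set.set_eqI)
        fix c
        have 1: "(\<forall>i<j. \<sigma> i \<le> c i) \<longleftrightarrow> \<sigma> \<le> c" using s0 by (metis le_fun_def zero_le)
        have 2: "(\<forall>i<j. i \<in> Z \<longrightarrow> c i = \<sigma> i) \<longleftrightarrow> (\<forall>i\<in>Z. c i = \<sigma> i)" using less.prems by auto
        have 3: "(\<forall>a\<in>A. c a = 0) \<longleftrightarrow> (\<forall>i\<in>A \<inter> {1..n}. c i = \<sigma> i)" if "c \<in> exps n"
        proof
          show "\<forall>i\<in>A \<inter> {1..n}. c i = \<sigma> i" if "\<forall>a\<in>A. c a = 0" using that nA by auto
          show "\<forall>a\<in>A. c a = 0" if "\<forall>i\<in>A \<inter> {1..n}. c i = \<sigma> i"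
          proof
            fix a assume "a \<in> A"
            then show "c a = 0"
              using that nA \<open>c \<in> exps n\<close> by (cases "a \<in> {1..n}") (auto simp: exps_def)
          qed
        qed
        show "c \<in> path_free n t A j l \<sigma> Z \<longleftrightarrow> c \<in> box n \<sigma> (Z \<union> (A \<inter> {1..n}))"
          using 1 2 3 False noi by (auto simp: path_free_def box_def)
      qed
      then show ?thesis using less.prems by (auto intro!: box_filt.box)
    qed
  next
    case True
    let ?W = "path_free n t A j l \<sigma> Z"
    let ?V = "{c \<in> ?W. \<forall>i\<in>{j+1..<j+l}. c i \<ge> 1}"
    \<comment> \<open>The new corner records the forced entries in \<open>[j + 1, j + l)\<close>.
      Position \<open>j\<close> joins \<open>Z\<close> with value 0, so \<open>l\<close> positions
      are read at a cost of \<open>l - 1\<close>.\<close>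
    define \<sigma>' where "\<sigma>' = (\<lambda>i. \<sigma> i + (if i \<in> {j+1..<j+l} then 1 else 0))"
    have s0: "\<sigma> i = 0" if "\<not> i < j" for i using less.prems that by auto
    \<comment> \<open>The path starting at \<open>j + 1\<close> needs a zero and its first
      \<open>l - 1\<close> entries are positive, so the zero lies among the \<open>t - l + 1\<close>
      positions from \<open>j + l\<close> on. Every path starting in \<open>[j + 1, j + l]\<close>
      contains this interval, which therefore takes care of all of them.\<close>
    have V: "?V = path_free n t A (j + l) (t - l + 1) \<sigma>' (insert j Z)"
    proof (intro equalityI subsetI)
      fix c assume "c \<in> ?V"
      then have c: "c \<in> ?W" and "\<forall>i\<in>{j+1..<j+l}. c i \<ge> 1" by blast+
      then have pos: "c i \<noteq> 0" if "i \<in> {j+1..<j+l}" for i using that by force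
      have cj: "c j = 0"
      proof -
        obtain i where i: "i \<in> {j..<j+l}" "c i = 0" using path_freeD(5)[OF c True] by blast
        then have "i \<notin> {j+1..<j+l}" using pos by blast
        then have "i = j" using i by simp
        then show ?thesis using i by simp
      qed
      have \<sigma>': "\<sigma>' i \<le> c i \<and> (i \<in> insert j Z \<longrightarrow> c i = \<sigma>' i)" if "i < j + l" for i
      proof -
        have "i < j \<or> i = j \<or> i \<in> {j+1..<j+l}" using that by auto
        then consider "i < j" | "i = j" | "i \<in> {j+1..<j+l}" by blast
        then show ?thesis
        proof cases
          case 1
          then show ?thesis using path_freeD(2,3)[OF c 1] by (simp add: \<sigma>'_def)
        next
          case 2
          then show ?thesis using cj s0[of j] by (simp add: \<sigma>'_def)
        next
          case 3
          then have "i \<notin> insert j Z" using less.prems(7) by auto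
          then show ?thesis using pos[OF 3] s0[of i] 3 by (simp add: \<sigma>'_def)
        qed
      qed
      show "c \<in> path_free n t A (j + l) (t - l + 1) \<sigma>' (insert j Z)"
      proof (rule path_freeI)
        assume "j + l + (t - l + 1) \<le> n + 1"
        then have "j + 1 + t \<le> n + 1" using less.prems by simp
        then obtain k where k: "k \<in> {j+1..<j+1+t}" "c k = 0" using path_freeD(6)[OF c, of "j+1"] by (meson less_add_one)
        then have "k \<notin> {j+1..<j+l}" using pos by blast
        then show "\<exists>i\<in>{j+l..<j+l + (t-l+1)}. c i = 0" using k less.prems by (intro bexI[of _ k]) auto
      next
        fix i assume "j + l < i" "i + t \<le> n + 1"
        then show "\<exists>k\<in>{i..<i + t}. c k = 0" by (intro path_freeD(6)[OF c]) auto
      qed (use path_freeD(1,4)[OF c] \<sigma>' in blast)+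
    next
      fix c assume c: "c \<in> path_free n t A (j + l) (t - l + 1) \<sigma>' (insert j Z)"
      have cj: "c j = 0" using path_freeD(3)[OF c, of j] s0[of j] less.prems(1) by (simp add: \<sigma>'_def)
      have c1: "c i \<ge> 1" if "i \<in> {j+1..<j+l}" for i
        using path_freeD(2)[OF c, of i] that by (simp add: \<sigma>'_def)
      have "c \<in> ?W"
      proof (rule path_freeI)
        fix i assume i: "j < i" "i + t \<le> n + 1"
        show "\<exists>k\<in>{i..<i + t}. c k = 0"
        proof (cases "i > j + l")
          case True
          then show ?thesis using path_freeD(6)[OF c] i by blast
        next
          case False
          have "j + l + (t - l + 1) \<le> n + 1" using i less.prems by linarith
          then obtain k where "k \<in> {j+l..<j+l+(t-l+1)}" "c k = 0" using path_freeD(5)[OF c] by blast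
          then show ?thesis using i False less.prems by (intro bexI[of _ k]) auto
        qed
      next
        fix i assume "i < j"
        then show "\<sigma> i \<le> c i" "i \<in> Z \<Longrightarrow> c i = \<sigma> i"
          using path_freeD(2,3)[OF c, of i] by (auto simp: \<sigma>'_def)
      next
        show "\<exists>i\<in>{j..<j + l}. c i = 0" using cj less.prems(1) by (intro bexI[of _ j]) auto
      qed (use path_freeD(1,4)[OF c] in blast)+
      then show "c \<in> ?V" using c1 by blast
    qed
    have sum': "(\<Sum>i=1..n. \<sigma>' i) = (\<Sum>i=1..n. \<sigma> i) + (l - 1)"
    proof -
      have "(\<Sum>i=1..n. if i \<in> {j+1..<j+l} then 1 else 0 :: nat) = card ({1..n} \<inter> {j+1..<j+l})"
        by (subst sum.inter_restrict[symmetric]) auto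
      also have "{1..n} \<inter> {j+1..<j+l} = {j+1..<j+l}" using True less.prems by auto
      finally show ?thesis by (simp add: \<sigma>'_def sum.distrib)
    qed
    have "box_filt n ((\<Sum>i=1..n. \<sigma>' i) + path_reg t (n + 1 - (j + l)) (t - l + 1))
       (path_free n t A (j + l) (t - l + 1) \<sigma>' (insert j Z))"
      using less.prems True
      by (intro less.hyps) (auto simp: \<sigma>'_def exps_def subset_iff)
    then have fV: "box_filt n ((\<Sum>i=1..n. \<sigma> i) + path_reg t (n + 1 - j) l) ?V"
      unfolding V
    proof (rule box_filt_mono)
      have "l \<le> n + 1 - j" using True by linarith
      then show "(\<Sum>i=1..n. \<sigma>' i) + path_reg t (n + 1 - (j + l)) (t - l + 1)
          \<le> (\<Sum>i=1..n. \<sigma> i) + path_reg t (n + 1 - j) l"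
        using path_reg_step1[of l t "n + 1 - j"] less.prems(1,2) unfolding sum' diff_diff_left by linarith
    qed
    show ?thesis
    proof (rule box_filt.split[OF fV])
      show "?V \<subseteq> ?W" by blast
      show "\<forall>b\<in>?V. \<forall>c\<in>?W. b \<le> c \<longrightarrow> c \<in> ?V"
      proof (intro ballI impI)
        fix b c assume b: "b \<in> ?V" and c: "c \<in> ?W" and "b \<le> c"
        have "1 \<le> c i" if "i \<in> {j+1..<j+l}" for i
          using b that le_funD[OF \<open>b \<le> c\<close>, of i] by force
        then show "c \<in> ?V" using c by blast
      qed
      show "box_filt n ((\<Sum>i=1..n. \<sigma> i) + path_reg t (n + 1 - j) l) (?W - ?V)"
      proof (cases "l = 1")
        case True
        \<comment> \<open>For \<open>l = 1\<close> the positivity condition is vacuous, so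
          everything lies in the submodule.\<close>
        then have "?W - ?V = {}" by auto
        then show ?thesis by (simp only: box_filt.empty)
      next
        case l: False
        \<comment> \<open>A zero in \<open>[j + 1, j + l)\<close> settles both the current interval
          and the path at \<open>j + 1\<close>; the scan advances by one position and leaves the
          entry at \<open>j\<close> unconstrained.\<close>
        have eq: "?W - ?V = path_free n t A (j + 1) (l - 1) \<sigma> Z"
        proof (intro equalityI subsetI)
          fix c assume "c \<in> ?W - ?V"
          then have c: "c \<in> ?W" and "\<not> (\<forall>i\<in>{j+1..<j+l}. c i \<ge> 1)" by blast+
          then obtain k where k: "k \<in> {j+1..<j+l}" "c k = 0" by (auto simp: not_le)
          show "c \<in> path_free n t A (j + 1) (l - 1) \<sigma> Z"
          proof (rule path_freeI)
            fix i assume "i < j + 1"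
            then have "i < j \<or> i = j" by auto
            then show "\<sigma> i \<le> c i" "i \<in> Z \<Longrightarrow> c i = \<sigma> i"
              using path_freeD(2,3)[OF c, of i] s0[of j] less.prems(7) by auto
          next
            show "\<exists>i\<in>{j+1..<j+1+(l-1)}. c i = 0" using k by (intro bexI[of _ k]) auto
          next
            fix i assume "j + 1 < i" "i + t \<le> n + 1"
            then show "\<exists>k\<in>{i..<i + t}. c k = 0" by (intro path_freeD(6)[OF c]) auto
          qed (use path_freeD(1,4)[OF c] in blast)+
        next
          fix c assume c: "c \<in> path_free n t A (j + 1) (l - 1) \<sigma> Z"
          then obtain k where k: "k \<in> {j+1..<j+l}" "c k = 0"
            using True less.prems(1) path_freeD(5)[OF c] by auto
          have "c \<in> ?W"
          proof (rule path_freeI)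
            fix i assume i: "j < i" "i + t \<le> n + 1"
            show "\<exists>k\<in>{i..<i + t}. c k = 0"
            proof (cases "i = j + 1")
              case True
              then show ?thesis using k less.prems by (intro bexI[of _ k]) auto
            next
              case False
              then show ?thesis using path_freeD(6)[OF c] i by simp
            qed
          next
            show "\<exists>i\<in>{j..<j + l}. c i = 0" using k by (intro bexI[of _ k]) auto
          next
            fix i assume "i < j"
            then show "\<sigma> i \<le> c i" "i \<in> Z \<Longrightarrow> c i = \<sigma> i" using path_freeD(2,3)[OF c, of i] by auto
          qed (use path_freeD(1,4)[OF c] in blast)+
          moreover have "\<not> (\<forall>i\<in>{j+1..<j+l}. c i \<ge> 1)" using k by force
          ultimately show "c \<in> ?W - ?V" by blast
        qed
        have "box_filt n ((\<Sum>i=1..n. \<sigma> i) + path_reg t (n + 1 - (j + 1)) (l - 1))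
          (path_free n t A (j + 1) (l - 1) \<sigma> Z)"
          using less.prems True l by (intro less.hyps) (auto simp: subset_iff less_Suc_eq)
        then show ?thesis
          unfolding eq
        proof (rule box_filt_mono)
          have "l \<le> n + 1 - j" "2 \<le> l" using True l less.prems(1) by linarith+
          then show "(\<Sum>i=1..n. \<sigma> i) + path_reg t (n + 1 - (j + 1)) (l - 1)
              \<le> (\<Sum>i=1..n. \<sigma> i) + path_reg t (n + 1 - j) l"
            using path_reg_step2[of l t "n + 1 - j"] less.prems(2) unfolding diff_diff_left by linarith
        qed
      qed
    qed
  qed
qed

section \<open>Greedy packings of paths\<close>

lemma expsD: "b \<in> exps n \<Longrightarrow> b i \<noteq> 0 \<Longrightarrow> i \<in> {1..n}"
  by (auto simp: exps_def)

text \<open>The exponents of \<open>\<Prod>\<^sub>i u\<^sub>i\<^bsup>g i\<^esup>\<close>.\<close>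

definition path_exp :: "nat \<Rightarrow> (nat \<Rightarrow> nat) \<Rightarrow> nat \<Rightarrow> nat" where
  "path_exp t g l = sum g {i. 1 \<le> i \<and> i \<le> l \<and> l < i + t}"

text \<open>\<open>h i\<close> counts the copies of the path starting at \<open>i\<close>. These are
  the exponents of the monomials in \<open>I\<^sup>s\<close>, as confirmed by
  \<open>ideal_power_eq\<close>.\<close>

definition power_exps :: "nat \<Rightarrow> nat \<Rightarrow> nat \<Rightarrow> (nat \<Rightarrow> nat) set" where
  "power_exps n t s =
    {b \<in> exps n. \<exists>h \<in> exps (n + 1 - t). (\<Sum>i=1..n + 1 - t. h i) = s \<and> path_exp t h \<le> b}"

lemma finite_window [simp]: "finite {i. 1 \<le> i \<and> i \<le> (l::nat) \<and> l < i + t}"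
  by (rule finite_subset[of _ "{..l}"]) auto

lemma path_exp_mono: "(\<And>i. g i \<le> h i) \<Longrightarrow> path_exp t g l \<le> path_exp t h l"
  unfolding path_exp_def by (rule sum_mono) auto

lemma path_exp_in_exps:
  assumes "g \<in> exps (n + 1 - t)" "t \<ge> 1" "n \<ge> t"
  shows "path_exp t g \<in> exps n"
proof -
  have "path_exp t g l = 0" if "l \<notin> {1..n}" for l
  proof -
    have "g i = 0" if "1 \<le> i \<and> i \<le> l \<and> l < i + t" for i
    proof -
      have "i \<notin> {1..n + 1 - t}" using that \<open>l \<notin> {1..n}\<close> assms by auto
      then show ?thesis using assms(1) by (auto simp: exps_def)
    qed
    then show ?thesis unfolding path_exp_def by (intro sum.neutral) auto
  qed
  then show ?thesis by (auto simp: exps_def)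
qed

lemma exists_le_sum_eq:
  fixes g :: "nat \<Rightarrow> nat"
  assumes "finite I" "s \<le> sum g I"
  shows "\<exists>h. (\<forall>i. h i \<le> g i) \<and> sum h I = s"
  using assms(2)
proof (induction s)
  case 0
  show ?case by (intro exI[of _ "\<lambda>_. 0"]) auto
next
  case (Suc s)
  then obtain h where h: "\<forall>i. h i \<le> g i" "sum h I = s" by auto
  have "\<exists>i\<in>I. h i < g i"
  proof (rule ccontr)
    assume "\<not> ?thesis"
    then have "sum g I \<le> sum h I" by (intro sum_mono) (auto simp: not_less)
    then show False using Suc.prems h by simp
  qed
  then obtain i where i: "i \<in> I" "h i < g i" by blast
  have "sum (h(i := Suc (h i))) I = Suc s"
    using sum.remove[OF assms(1) i(1), of h] sum.remove[OF assms(1) i(1), of "h(i := Suc (h i))"] h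
    by simp
  moreover have "(h(i := Suc (h i))) k \<le> g k" for k using h i by auto
  ultimately show ?case by blast
qed

text \<open>Membership in \<open>power_exps\<close> asks for exactly \<open>s\<close> paths; surplus
  copies in a larger packing are dropped one at a time.\<close>

lemma power_exps_ge:
  assumes "b \<in> exps n" "h \<in> exps (n + 1 - t)" "s \<le> (\<Sum>i=1..n + 1 - t. h i)" "path_exp t h \<le> b"
  shows "b \<in> power_exps n t s"
proof -
  obtain k where k: "\<forall>i. k i \<le> h i" "(\<Sum>i=1..n + 1 - t. k i) = s"
    using exists_le_sum_eq[OF _ assms(3)] by auto
  have "k \<in> exps (n + 1 - t)" using assms(2) k by (auto simp: exps_def) (metis le_zero_eq)+
  moreover have "path_exp t k \<le> b"
    using path_exp_mono[of k h t] k assms(4) by (auto simp: le_fun_def intro: order_trans)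
  ultimately show ?thesis using assms(1) k by (auto simp: power_exps_def)
qed

section \<open>Optimality and fibers of the greedy packing\<close>

text \<open>What the first \<open>j\<close> steps consume of the variable \<open>l\<close>. This may
  be less than \<open>path_exp t g l\<close>, which also counts later paths through
  \<open>l\<close>.\<close>

definition cover_count :: "nat \<Rightarrow> (nat \<Rightarrow> nat) \<Rightarrow> nat \<Rightarrow> nat \<Rightarrow> nat" where
  "cover_count t g j l = sum g {i. 1 \<le> i \<and> i \<le> j \<and> l < i + t}"

lemma finite_window2 [simp]: "finite {i. 1 \<le> i \<and> i \<le> (j::nat) \<and> l < i + t}"
  by (rule finite_subset[of _ "{..j}"]) auto

text \<open>At step \<open>j\<close> the greedy packing has used up some variable \<open>l\<close>
  of the path at \<open>j\<close>. All paths starting in \<open>(l - t, j]\<close> pass through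
  \<open>l\<close>, so a competitor \<open>h\<close> uses no more of them than \<open>g\<close>
  does; those starting earlier are compared by induction.\<close>

lemma greedy_stays_ahead:
  assumes greedy: "\<And>i. 1 \<le> i \<Longrightarrow> i \<le> N \<Longrightarrow> \<exists>l\<in>{i..<i + t}. b l = cover_count t g i l"
    and h: "path_exp t h \<le> b" and "j \<le> N"
  shows "(\<Sum>i=1..j. h i) \<le> (\<Sum>i=1..j. g i)"
  using assms(3)
proof (induction j rule: less_induct)
  case (less j)
  show ?case
  proof (cases "j = 0")
    case False
    then obtain l where l: "l \<in> {j..<j + t}" "b l = cover_count t g j l" using greedy[of j] less.prems by auto
    have split: "(\<Sum>i=1..j. f i) = (\<Sum>i=1..l - t. f i) + cover_count t f j l" for f :: "nat \<Rightarrow> nat"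
    proof -
      have "{1..j} = {1..l - t} \<union> {i. 1 \<le> i \<and> i \<le> j \<and> l < i + t}" using l by auto
      then show ?thesis unfolding cover_count_def by (simp only:) (rule sum.union_disjoint, auto)
    qed
    have "cover_count t h j l \<le> path_exp t h l"
      unfolding cover_count_def path_exp_def by (rule sum_mono2) (use l in auto)
    also have "\<dots> \<le> cover_count t g j l" using h l by (metis le_funD)
    finally have "cover_count t h j l \<le> cover_count t g j l" .
    moreover have "l - t < j" using l False by auto
    then have "(\<Sum>i=1..l - t. h i) \<le> (\<Sum>i=1..l - t. g i)" using less by simp
    ultimately show ?thesis using split[of h] split[of g] by linarith
  qed simp
qed

text \<open>The monomials outside \<open>I\<^sup>s\<close> for which the greedy packing uses \<open>u\<^sub>i\<close> exactly \<open>g i\<close> times, for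
  all \<open>i \<le> j\<close>: after step \<open>i\<close>, some variable of \<open>u\<^sub>i\<close> is used up.\<close>

definition greedy_fiber :: "nat \<Rightarrow> nat \<Rightarrow> nat \<Rightarrow> nat \<Rightarrow> (nat \<Rightarrow> nat) \<Rightarrow> (nat \<Rightarrow> nat) set" where
  "greedy_fiber n t s j g = {b \<in> exps n - power_exps n t s. path_exp t g \<le> b \<and>
    (\<forall>i. 1 \<le> i \<and> i \<le> j \<longrightarrow> (\<exists>l\<in>{i..<i + t}. b l = cover_count t g i l))}"

lemma greedy_fiberD:
  assumes "b \<in> greedy_fiber n t s j g"
  shows "b \<in> exps n" "b \<notin> power_exps n t s" "path_exp t g l \<le> b l"
    "1 \<le> i \<Longrightarrow> i \<le> j \<Longrightarrow> \<exists>l\<in>{i..<i + t}. b l = cover_count t g i l"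
  using assms unfolding greedy_fiber_def le_fun_def by blast+

lemma greedy_fiberI:
  assumes "b \<in> exps n" "b \<notin> power_exps n t s" "\<And>l. path_exp t g l \<le> b l"
    "\<And>i. 1 \<le> i \<Longrightarrow> i \<le> j \<Longrightarrow> \<exists>l\<in>{i..<i + t}. b l = cover_count t g i l"
  shows "b \<in> greedy_fiber n t s j g"
  using assms unfolding greedy_fiber_def le_fun_def by blast

lemma path_exp_upd:
  assumes "g j = 0" "1 \<le> j"
  shows "path_exp t (g(j := k)) l = path_exp t g l + (if j \<le> l \<and> l < j + t then k else 0)"
proof -
  let ?A = "{i. 1 \<le> i \<and> i \<le> l \<and> l < i + t}"
  show ?thesis
  proof (cases "j \<in> ?A")
    case True
    have "sum (g(j := k)) ?A = k + sum (g(j := k)) (?A - {j})" using sum.remove[OF _ True, of "g(j := k)"] by simp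
    also have "sum (g(j := k)) (?A - {j}) = sum g (?A - {j})" by (rule sum.cong) auto
    also have "\<dots> = sum g ?A" using sum.remove[OF _ True, of g] assms by simp
    finally show ?thesis using True by (simp add: path_exp_def)
  next
    case False
    then have "sum (g(j := k)) ?A = sum g ?A" by (intro sum.cong) auto
    then show ?thesis using False assms by (auto simp: path_exp_def)
  qed
qed

lemma cover_count_eq_path_exp:
  assumes "\<forall>i>j. g i = 0" "j \<le> l"
  shows "cover_count t g j l = path_exp t g l"
proof -
  have "i \<le> j" if "0 < g i" for i using assms(1) that by (metis less_irrefl not_le)
  then show ?thesis
    unfolding cover_count_def path_exp_def
    by (intro sum.mono_neutral_left) (use assms(2) in auto)
qed

lemma cover_count_upd:
  assumes "i < j"
  shows "cover_count t (g(j := k)) i l = cover_count t g i l"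
  unfolding cover_count_def by (rule sum.cong) (use assms in auto)

text \<open>The residual \<open>c\<close> has a zero in every path and moreover \<open>c\<^sub>a = 0\<close> whenever \<open>u\<^bsub>a+1\<^esub>\<close> is used, since
  otherwise the greedy packing would have taken another copy of \<open>u\<^sub>a\<close>.\<close>

lemma greedy_fiber_last:
  assumes n: "n \<ge> t" "t \<ge> 1" and g: "g \<in> exps (n + 1 - t)"
  defines "A \<equiv> {a. 1 \<le> a \<and> g (Suc a) \<noteq> 0}"
  shows "greedy_fiber n t s (n + 1 - t) g =
    (if (\<Sum>i=1..n + 1 - t. g i) < s then (\<lambda>c i. path_exp t g i + c i) ` path_free n t A 1 t (\<lambda>_. 0) {} else {})"
proof -
  define N where "N = n + 1 - t"
  have N1: "1 \<le> N" using n by (simp add: N_def)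
  \<comment> \<open>At step \<open>i\<close> the variable \<open>l\<close> is used up iff the
    residual vanishes there and no path starting in \<open>(i, l]\<close> claims a share of it
    later.\<close>
  have win: "b l = cover_count t g i l \<longleftrightarrow> c l = 0 \<and> (\<forall>k. i < k \<and> k \<le> l \<longrightarrow> g k = 0)"
    if "b l = path_exp t g l + c l" "1 \<le> i" "i \<le> l" "l < i + t" for b c :: "nat \<Rightarrow> nat" and i l
  proof -
    have "{k. 1 \<le> k \<and> k \<le> l \<and> l < k + t} = {k. 1 \<le> k \<and> k \<le> i \<and> l < k + t} \<union> {i<..l}"
      using that by auto
    then have "path_exp t g l = cover_count t g i l + sum g {i<..l}"
      unfolding path_exp_def cover_count_def
      by (simp only:) (rule sum.union_disjoint, auto)
    then have "b l = cover_count t g i l \<longleftrightarrow> c l = 0 \<and> sum g {i<..l} = 0" using that by auto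
    then show ?thesis by auto
  qed
  have cond: "(\<forall>i. 1 \<le> i \<and> i \<le> N \<longrightarrow> (\<exists>l\<in>{i..<i + t}. b l = cover_count t g i l)) \<longleftrightarrow>
      c \<in> path_free n t A 1 t (\<lambda>_. 0) {}"
    if b: "b = (\<lambda>l. path_exp t g l + c l)" and c: "c \<in> exps n" for b c
  proof
    assume *: "\<forall>i. 1 \<le> i \<and> i \<le> N \<longrightarrow> (\<exists>l\<in>{i..<i + t}. b l = cover_count t g i l)"
    then have z: "\<exists>l\<in>{i..<i + t}. c l = 0 \<and> (\<forall>k. i < k \<and> k \<le> l \<longrightarrow> g k = 0)" if "1 \<le> i" "i \<le> N" for i
    proof -
      obtain l where l: "l \<in> {i..<i + t}" "b l = cover_count t g i l" using * \<open>1 \<le> i\<close> \<open>i \<le> N\<close> by blast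
      have "b l = path_exp t g l + c l" by (simp add: b)
      from win[of b l c i, OF this \<open>1 \<le> i\<close>] l have "c l = 0 \<and> (\<forall>k. i < k \<and> k \<le> l \<longrightarrow> g k = 0)"
        unfolding atLeastLessThan_iff by blast
      then show ?thesis using l(1) by blast
    qed
    show "c \<in> path_free n t A 1 t (\<lambda>_. 0) {}"
    proof (rule path_freeI)
      fix a assume "a \<in> A"
      then have a: "1 \<le> a" "g (Suc a) \<noteq> 0" by (auto simp: A_def)
      have "Suc a \<in> {1..N}" unfolding N_def by (rule expsD[OF g a(2)])
      then have "a \<le> N" by simp
      then obtain l where l: "l \<in> {a..<a + t}" "c l = 0" "\<forall>k. a < k \<and> k \<le> l \<longrightarrow> g k = 0"
        using z[OF a(1)] by blast
      have "\<not> Suc a \<le> l" using l(3) a(2) by (meson lessI)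
      then have "l = a" using l(1) by simp
      then show "c a = 0" using l(2) by simp
    next
      show "\<exists>i\<in>{1..<1 + t}. c i = 0" using z[OF le_refl N1] by blast
    next
      fix i assume "1 < i" "i + t \<le> n + 1"
      then have "1 \<le> i" "i \<le> N" by (auto simp: N_def)
      then show "\<exists>k\<in>{i..<i + t}. c k = 0" using z by blast
    qed (use c in auto)
  next
    assume *: "c \<in> path_free n t A 1 t (\<lambda>_. 0) {}"
    show "\<forall>i. 1 \<le> i \<and> i \<le> N \<longrightarrow> (\<exists>l\<in>{i..<i + t}. b l = cover_count t g i l)"
    proof (intro allI impI)
      fix i assume i: "1 \<le> i \<and> i \<le> N"
      have 1: "\<exists>l\<in>{i..<i + t}. c l = 0 \<and> (\<forall>k. i < k \<and> k \<le> l \<longrightarrow> g k = 0)"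
      proof (cases "\<exists>k. i < k \<and> k < i + t \<and> g k \<noteq> 0")
        case True
        \<comment> \<open>If some later path starting inside this window is used, take the first
          such start \<open>k\<close>. Then \<open>k - 1\<close> lies in the window and in
          \<open>A\<close>, so the residual vanishes there, and no used path starts in
          \<open>(i, k - 1]\<close>.\<close>
        define k where "k = (LEAST k. i < k \<and> k < i + t \<and> g k \<noteq> 0)"
        have k: "i < k \<and> k < i + t \<and> g k \<noteq> 0" unfolding k_def using True by (rule LeastI_ex)
        have "g k' = 0" if "i < k'" "k' \<le> k - 1" for k'
        proof (rule ccontr)
          assume "g k' \<noteq> 0"
          then have "k \<le> k'" unfolding k_def using that k by (intro Least_le) auto
          then show False using that k by linarith
        qed
        moreover have "k - 1 \<in> A" using k i by (auto simp: A_def)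
        then have "c (k - 1) = 0" using path_freeD(4)[OF *] by blast
        ultimately show ?thesis using k by (intro bexI[of _ "k - 1"]) auto
      next
        case False
        have "\<exists>l\<in>{i..<i + t}. c l = 0"
        proof (cases "i = 1")
          case True
          then show ?thesis using path_freeD(5)[OF *] n by simp
        next
          case False
          then have "1 < i" "i + t \<le> n + 1" using i n by (auto simp: N_def)
          then show ?thesis by (rule path_freeD(6)[OF *])
        qed
        then obtain l where l: "l \<in> {i..<i + t}" "c l = 0" by blast
        have "g k = 0" if "i < k" "k \<le> l" for k
        proof -
          have "k < i + t" using that l(1) by simp
          then show ?thesis using False that(1) by blast
        qed
        then show ?thesis using l by blast
      qed
      then obtain l where l: "l \<in> {i..<i + t}" "c l = 0 \<and> (\<forall>k. i < k \<and> k \<le> l \<longrightarrow> g k = 0)" by blast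
      have "b l = path_exp t g l + c l" by (simp add: b)
      from win[of b l c i, OF this] l i have "b l = cover_count t g i l"
        unfolding atLeastLessThan_iff by blast
      then show "\<exists>l\<in>{i..<i + t}. b l = cover_count t g i l" using l(1) by blast
    qed
  qed
  have pe: "path_exp t g \<in> exps n" using path_exp_in_exps[OF g] n by simp
  show ?thesis
  proof (cases "(\<Sum>i=1..N. g i) < s")
    case True
    have "greedy_fiber n t s N g = (\<lambda>c i. path_exp t g i + c i) ` path_free n t A 1 t (\<lambda>_. 0) {}" (is "?L = ?R")
    proof
      show "?L \<subseteq> ?R"
      proof
        fix b assume b: "b \<in> ?L"
        define c where "c = (\<lambda>i. b i - path_exp t g i)"
        have le: "path_exp t g i \<le> b i" for i using b by (auto simp: greedy_fiber_def le_fun_def)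
        then have bc: "b = (\<lambda>i. path_exp t g i + c i)" by (auto simp: c_def)
        have "c \<in> exps n" using b by (auto simp: c_def greedy_fiber_def exps_def)
        moreover have "\<forall>i. 1 \<le> i \<and> i \<le> N \<longrightarrow> (\<exists>l\<in>{i..<i + t}. b l = cover_count t g i l)"
          using b unfolding greedy_fiber_def by blast
        ultimately have "c \<in> path_free n t A 1 t (\<lambda>_. 0) {}" using cond[OF bc] by blast
        then show "b \<in> ?R" unfolding bc by (rule imageI)
      qed
      show "?R \<subseteq> ?L"
      proof
        fix b assume "b \<in> ?R"
        then obtain c where c: "c \<in> path_free n t A 1 t (\<lambda>_. 0) {}" and bc: "b = (\<lambda>i. path_exp t g i + c i)"
          by blast
        have ce: "c \<in> exps n" by (rule path_freeD(1)[OF c])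
        have gr: "\<forall>i. 1 \<le> i \<and> i \<le> N \<longrightarrow> (\<exists>l\<in>{i..<i + t}. b l = cover_count t g i l)"
          using cond[OF bc ce] c by blast
        \<comment> \<open>Optimality enters here: the greedy packing has fewer than \<open>s\<close>
          paths, hence so has every packing.\<close>
        have "b \<notin> power_exps n t s"
        proof
          assume "b \<in> power_exps n t s"
          then obtain h where h: "(\<Sum>i=1..N. h i) = s" "path_exp t h \<le> b"
            unfolding power_exps_def N_def by blast
          have "(\<Sum>i=1..N. h i) \<le> (\<Sum>i=1..N. g i)"
            by (rule greedy_stays_ahead[OF _ h(2) le_refl]) (use gr in blast)
          then show False using h(1) True by simp
        qed
        moreover have "b \<in> exps n" using pe ce by (auto simp: bc exps_def)
        moreover have "path_exp t g \<le> b" by (simp add: bc le_fun_def)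
        ultimately show "b \<in> ?L" using gr unfolding greedy_fiber_def by blast
      qed
    qed
    then show ?thesis using True unfolding N_def by (simp only: if_True)
  next
    case False
    have "b \<notin> greedy_fiber n t s N g" for b
      using power_exps_ge[of b n g t s] False g unfolding greedy_fiber_def N_def not_less by blast
    then have "greedy_fiber n t s N g = {}" by blast
    then show ?thesis using False by (simp add: N_def)
  qed
qed

lemma sum_path_exp:
  assumes "g \<in> exps (n + 1 - t)" "t \<ge> 1" "n \<ge> t"
  shows "(\<Sum>l=1..n. path_exp t g l) = t * (\<Sum>i=1..n + 1 - t. g i)"
proof -
  have "path_exp t g l = (\<Sum>i=1..n + 1 - t. if i \<le> l \<and> l < i + t then g i else 0)" for l
  proof -
    have "path_exp t g l = (\<Sum>i\<in>{i\<in>{1..n + 1 - t}. i \<le> l \<and> l < i + t}. g i)"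
      unfolding path_exp_def by (rule sum.mono_neutral_right) (use assms(1) in \<open>auto simp: exps_def\<close>)
    also have "\<dots> = (\<Sum>i=1..n + 1 - t. if i \<le> l \<and> l < i + t then g i else 0)"
      by (rule sum.inter_filter) simp
    finally show ?thesis .
  qed
  then have "(\<Sum>l=1..n. path_exp t g l) = (\<Sum>i=1..n + 1 - t. \<Sum>l=1..n. if i \<le> l \<and> l < i + t then g i else 0)"
    by (simp only:) (rule sum.swap)
  also have "\<dots> = (\<Sum>i=1..n + 1 - t. t * g i)"
  proof (rule sum.cong[OF refl])
    fix i assume i: "i \<in> {1..n + 1 - t}"
    have "(\<Sum>l=1..n. if i \<le> l \<and> l < i + t then g i else 0) = (\<Sum>l\<in>{l\<in>{1..n}. i \<le> l \<and> l < i + t}. g i)"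
      by (rule sum.inter_filter[symmetric]) simp
    also have "{l\<in>{1..n}. i \<le> l \<and> l < i + t} = {i..<i + t}" using i assms by auto
    finally show "(\<Sum>l=1..n. if i \<le> l \<and> l < i + t then g i else 0) = t * g i" by simp
  qed
  finally show ?thesis by (simp add: sum_distrib_left)
qed

text \<open>The induction runs downwards in the number of decided multiplicities. The next
  multiplicity is a monotone function of the monomial, so its values filter the current piece; once
  all are decided, the piece is a translate of a path-free set. The first summand of the bound is
  \<Gamma>(n,t), paid by the residual; the second is paid by the fewer than \<open>s\<close> paths
  of degree \<open>t\<close>.\<close>

lemma box_filt_greedy_fiber:
  assumes n: "n \<ge> t" "t \<ge> 1" and s: "s \<ge> 1" and "j \<le> n + 1 - t" "g \<in> exps j"
  shows "box_filt n ((t - 1) * ((n + 1) div (t + 1)) + t * (s - 1)) (greedy_fiber n t s j g)"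
  using assms(4,5)
proof (induction j arbitrary: g rule: inc_induct)
  case base
  let ?A = "{a. 1 \<le> a \<and> g (Suc a) \<noteq> 0}"
  show ?case
  proof (cases "(\<Sum>i=1..n + 1 - t. g i) < s")
    case False
    then show ?thesis by (simp only: greedy_fiber_last[OF n base] if_False box_filt.empty)
  next
    case True
    have reg: "path_reg t n t = (t - 1) * ((n + 1) div (t + 1))"
    proof (cases "n mod (t + 1) = t")
      case True
      have "(n + 1) div (t + 1) = n div (t + 1) + 1"
        using True div_Suc[of n "t + 1"] mod_Suc[of n "t + 1"] by simp
      then show ?thesis using True by (simp add: path_reg_def)
    next
      case False
      then have "n mod (t + 1) < t" using mod_less_divisor[of "t + 1" n] by linarith
      moreover have "(n + 1) div (t + 1) = n div (t + 1)"
        using False div_Suc[of n "t + 1"] mod_Suc[of n "t + 1"] by simp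
      ultimately show ?thesis by (simp add: path_reg_def)
    qed
    have "box_filt n ((\<Sum>i=1..n. 0) + path_reg t (n + 1 - 1) t) (path_free n t ?A 1 t (\<lambda>_. 0) {})"
      using n by (intro box_filt_path_free) (auto simp: exps_def)
    then have "box_filt n ((\<Sum>i=1..n. 0) + path_reg t (n + 1 - 1) t + (\<Sum>l=1..n. path_exp t g l))
       ((\<lambda>c i. path_exp t g i + c i) ` path_free n t ?A 1 t (\<lambda>_. 0) {})"
      using path_exp_in_exps[OF base n(2,1)] by (rule box_filt_shift)
    then show ?thesis
      unfolding greedy_fiber_last[OF n base] if_P[OF True]
    proof (rule box_filt_mono)
      have "t * (\<Sum>i=1..n + 1 - t. g i) \<le> t * (s - 1)" using True by (intro mult_left_mono) auto
      then show "(\<Sum>i=1..n. 0) + path_reg t (n + 1 - 1) t + (\<Sum>l=1..n. path_exp t g l)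
          \<le> (t - 1) * ((n + 1) div (t + 1)) + t * (s - 1)"
        unfolding sum_path_exp[OF base n(2,1)] add_diff_cancel_right' reg by simp
    qed
  qed
next
  case (step j)
  let ?J = "Suc j"
  \<comment> \<open>The number of further copies of the path at \<open>j + 1\<close> that fit: the
    least remaining exponent along it.\<close>
  let ?\<kappa> = "\<lambda>b. Min ((\<lambda>l. b l - path_exp t g l) ` {?J..<?J + t})"
  have ne: "(\<lambda>l. b l - path_exp t g l) ` {?J..<?J + t} \<noteq> {}" for b using n by auto
  have g0: "g i = 0" if "i > j" for i using step.prems that by (auto simp: exps_def)
  show ?case
  proof (rule box_filt_key[where \<kappa> = ?\<kappa> and s = s])
    fix k assume "k < s"
    let ?g = "g(?J := k)"
    have pe: "path_exp t ?g l = path_exp t g l + (if ?J \<le> l \<and> l < ?J + t then k else 0)" for l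
      using g0 by (intro path_exp_upd) auto
    have cc: "cover_count t ?g ?J l = path_exp t g l + k" if "?J \<le> l" "l < ?J + t" for l
      using cover_count_eq_path_exp[of ?J ?g l t] g0 that pe by simp
    have "{b \<in> greedy_fiber n t s j g. ?\<kappa> b = k} = greedy_fiber n t s ?J ?g"
    proof (intro equalityI subsetI)
      fix b assume b: "b \<in> {b \<in> greedy_fiber n t s j g. ?\<kappa> b = k}"
      then have bf: "b \<in> greedy_fiber n t s j g" by simp
      have le: "path_exp t g l \<le> b l" for l by (rule greedy_fiberD(3)[OF bf])
      have "k \<le> b l - path_exp t g l" if "?J \<le> l" "l < ?J + t" for l
      proof -
        have "?\<kappa> b \<le> b l - path_exp t g l" using that by (intro Min_le) auto
        then show ?thesis using b by simp
      qed
      then have "path_exp t ?g l \<le> b l" for l using le[of l] pe[of l] by (force simp: le_diff_conv2)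
      moreover have "?\<kappa> b \<in> (\<lambda>l. b l - path_exp t g l) ` {?J..<?J + t}" using ne by (intro Min_in) auto
      then obtain l where l: "l \<in> {?J..<?J + t}" "b l - path_exp t g l = k" using b by auto
      then have "b l = cover_count t ?g ?J l" using cc[of l] le[of l] by simp
      moreover have "\<exists>l\<in>{i..<i + t}. b l = cover_count t ?g i l" if i: "1 \<le> i" "i \<le> ?J" for i
      proof (cases "i = ?J")
        case True
        then show ?thesis using l(1) \<open>b l = _\<close> by blast
      next
        case False
        then have "i \<le> j" using i by simp
        then have "\<exists>l\<in>{i..<i + t}. b l = cover_count t g i l"
          by (rule greedy_fiberD(4)[OF bf i(1)])
        then show ?thesis using \<open>i \<le> j\<close> by (simp add: cover_count_upd)
      qed
      ultimately show "b \<in> greedy_fiber n t s ?J ?g"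
        using greedy_fiberI greedy_fiberD(1,2)[OF bf] by blast
    next
      fix b assume b: "b \<in> greedy_fiber n t s ?J ?g"
      have le: "path_exp t ?g l \<le> b l" for l by (rule greedy_fiberD(3)[OF b])
      then have le': "path_exp t g l \<le> b l" for l using pe[of l] le[of l] by simp
      obtain l where l: "l \<in> {?J..<?J + t}" "b l = cover_count t ?g ?J l"
        using greedy_fiberD(4)[OF b, of ?J] by auto
      have "?\<kappa> b = k"
      proof (rule Min_eqI)
        show "k \<in> (\<lambda>l. b l - path_exp t g l) ` {?J..<?J + t}" using l cc[of l] by (intro image_eqI[of _ _ l]) auto
        fix y assume "y \<in> (\<lambda>l. b l - path_exp t g l) ` {?J..<?J + t}"
        then obtain m where "m \<in> {?J..<?J + t}" "y = b m - path_exp t g m" by blast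
        then show "k \<le> y" using le[of m] pe[of m] by auto
      qed simp
      moreover have "\<exists>l\<in>{i..<i + t}. b l = cover_count t g i l" if "1 \<le> i" "i \<le> j" for i
      proof -
        have "i \<le> ?J" using that by simp
        then have "\<exists>l\<in>{i..<i + t}. b l = cover_count t ?g i l"
          by (rule greedy_fiberD(4)[OF b that(1)])
        then show ?thesis using that by (simp add: cover_count_upd)
      qed
      ultimately show "b \<in> {b \<in> greedy_fiber n t s j g. ?\<kappa> b = k}"
        using greedy_fiberI[OF greedy_fiberD(1,2)[OF b] le'] by blast
    qed
    moreover have "?g \<in> exps ?J" using step.prems by (auto simp: exps_def)
    ultimately show "box_filt n ((t - 1) * ((n + 1) div (t + 1)) + t * (s - 1))
        {b \<in> greedy_fiber n t s j g. ?\<kappa> b = k}"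
      using step.IH[of ?g] by (simp only: )
  next
    fix b assume b: "b \<in> greedy_fiber n t s j g"
    show "?\<kappa> b < s"
    proof (rule ccontr)
      assume "\<not> ?\<kappa> b < s"
      \<comment> \<open>Otherwise \<open>s\<close> copies of this single path would fit into
        \<open>b\<close>, which lies outside \<open>I\<^sup>s\<close>.\<close>
      let ?h = "(\<lambda>_. 0)(?J := s)"
      have ph: "path_exp t ?h l = (if ?J \<le> l \<and> l < ?J + t then s else 0)" for l
      proof -
        have "path_exp t (\<lambda>_. 0) l = 0" by (simp add: path_exp_def)
        then show ?thesis by (simp only: path_exp_upd[of "\<lambda>_. 0" ?J])
      qed
      have "path_exp t ?h l \<le> b l" for l
      proof (cases "?J \<le> l \<and> l < ?J + t")
        case True
        then have "?\<kappa> b \<le> b l - path_exp t g l" by (intro Min_le) auto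
        then have "s \<le> b l" using \<open>\<not> ?\<kappa> b < s\<close> by linarith
        then show ?thesis by (simp only: ph) simp
      next
        case False
        then show ?thesis by (simp only: ph) simp
      qed
      moreover have "?h \<in> exps (n + 1 - t)" using step.hyps by (auto simp: exps_def)
      moreover have "(\<Sum>i=1..n + 1 - t. ?h i) = s"
        using step.hyps sum.delta[of "{1..n + 1 - t}" ?J "\<lambda>_. s"] by (simp add: fun_upd_def)
      ultimately have "b \<in> power_exps n t s"
        using greedy_fiberD(1)[OF b] power_exps_ge[of b n ?h t s] by (simp add: le_fun_def)
      then show False using greedy_fiberD(2)[OF b] by blast
    qed
  next
    fix b c :: "nat \<Rightarrow> nat" assume "b \<le> c"
    show "?\<kappa> b \<le> ?\<kappa> c"
    proof (subst Min_ge_iff)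
      show "\<forall>a\<in>(\<lambda>l. c l - path_exp t g l) ` {?J..<?J + t}. ?\<kappa> b \<le> a"
      proof
        fix a assume "a \<in> (\<lambda>l. c l - path_exp t g l) ` {?J..<?J + t}"
        then obtain l where l: "l \<in> {?J..<?J + t}" "a = c l - path_exp t g l" by blast
        have "?\<kappa> b \<le> b l - path_exp t g l" using l by (intro Min_le) auto
        also have "\<dots> \<le> a" using \<open>b \<le> c\<close> l by (simp add: le_fun_def diff_le_mono)
        finally show "?\<kappa> b \<le> a" .
      qed
    qed (use ne in auto)
  qed
qed

theorem box_filt_power:
  assumes "n \<ge> t" "t \<ge> 1" "s \<ge> 1"
  shows "box_filt n ((t - 1) * ((n + 1) div (t + 1)) + t * (s - 1)) (exps n - power_exps n t s)"
proof -
  have "greedy_fiber n t s 0 (\<lambda>_. 0) = exps n - power_exps n t s"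
    by (auto simp: greedy_fiber_def path_exp_def le_fun_def)
  then show ?thesis using box_filt_greedy_fiber[OF assms, of 0 "\<lambda>_. 0"] by (simp add: exps_def)
qed

section \<open>Koszul homology of graded subquotients\<close>

text \<open>The sign that moves the exterior generator \<open>e\<^sub>i\<close> into its place in
  \<open>e\<^sub>S\<close>; as an additive involution it asks for no scalars on the coefficient
  group.\<close>

definition ksign :: "nat \<Rightarrow> nat set \<Rightarrow> 'v::ab_group_add \<Rightarrow> 'v" where
  "ksign i S v = (if even (card {k \<in> S. k < i}) then v else - v)"

lemma ksign_simps [simp]:
  "ksign i S 0 = 0" "ksign i S (a + b) = ksign i S a + ksign i S b"
  "ksign i S (a - b) = ksign i S a - ksign i S b" "ksign i S (- a) = - ksign i S a"
  "ksign i S (ksign i S a) = a"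
  by (auto simp: ksign_def)

lemma ksign_commute: "ksign i S (ksign j T a) = ksign j T (ksign i S a)"
  by (auto simp: ksign_def)

lemma ksign_insert:
  assumes "finite S" "i \<notin> S"
  shows "ksign j (insert i S) a = (if i < j then - ksign j S a else ksign j S a)"
proof -
  have "{k \<in> insert i S. k < j} = (if i < j then insert i {k \<in> S. k < j} else {k \<in> S. k < j})" by auto
  then show ?thesis using assms by (simp add: ksign_def)
qed

lemma ksign_anticommute:
  assumes "finite S" "i \<notin> S" "j \<notin> S" "i \<noteq> j"
  shows "ksign i S (ksign j (insert i S) a) = - ksign j S (ksign i (insert j S) a)"
  using assms by (auto simp: ksign_insert ksign_commute[of i S j])

text \<open>Pairs with \<open>i < j\<close> cancel against those with \<open>j < i\<close>.
  Concluding from \<open>x = - x\<close> instead would fail in characteristic 2.\<close>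

lemma sum_antisymmetric_zero:
  fixes f :: "nat \<Rightarrow> nat \<Rightarrow> 'v::ab_group_add"
  assumes "finite D" "\<And>i j. i \<in> D \<Longrightarrow> j \<in> D \<Longrightarrow> i \<noteq> j \<Longrightarrow> f i j = - f j i"
  shows "(\<Sum>i\<in>D. \<Sum>j\<in>D - {i}. f i j) = 0"
proof -
  let ?P = "{(i, j). i \<in> D \<and> j \<in> D \<and> i < j}" and ?Q = "{(i, j). i \<in> D \<and> j \<in> D \<and> j < i}"
  have fin: "finite ?P" "finite ?Q" by (rule finite_subset[of _ "D \<times> D"], use assms(1) in auto)+
  have "(\<Sum>i\<in>D. \<Sum>j\<in>D - {i}. f i j) = (\<Sum>(i, j)\<in>Sigma D (\<lambda>i. D - {i}). f i j)"
    using assms(1) by (simp add: sum.Sigma)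
  also have "Sigma D (\<lambda>i. D - {i}) = ?P \<union> ?Q" by auto
  also have "(\<Sum>(i, j)\<in>?P \<union> ?Q. f i j) = (\<Sum>(i, j)\<in>?P. f i j) + (\<Sum>(i, j)\<in>?Q. f i j)"
    by (rule sum.union_disjoint[OF fin]) auto
  also have "(\<Sum>(i, j)\<in>?Q. f i j) = (\<Sum>(i, j)\<in>?P. f j i)"
    by (rule sum.reindex_bij_witness[of _ prod.swap prod.swap]) auto
  also have "(\<Sum>(i, j)\<in>?P. f j i) = (\<Sum>(i, j)\<in>?P. - f i j)"
    by (rule sum.cong[OF refl]) (use assms(2) in auto)
  finally show ?thesis by (simp add: case_prod_unfold sum_negf)
qed

text \<open>A chain assigns a coefficient to each set of exterior generators, and the boundary at
  \<open>S\<close> collects the contributions of all \<open>insert i S\<close>. The shift by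
  \<open>p\<close> in \<open>kchain\<close> is the degree of the basis elements.\<close>

definition kdiff :: "nat \<Rightarrow> (nat \<Rightarrow> 'v \<Rightarrow> 'v) \<Rightarrow> (nat set \<Rightarrow> 'v::ab_group_add) \<Rightarrow> nat set \<Rightarrow> 'v" where
  "kdiff n X c S = (if S \<subseteq> {1..n} then \<Sum>i\<in>{1..n} - S. ksign i S (X i (c (insert i S))) else 0)"

definition kchain :: "nat \<Rightarrow> (int \<Rightarrow> 'v::ab_group_add set) \<Rightarrow> nat \<Rightarrow> int \<Rightarrow> (nat set \<Rightarrow> 'v) set" where
  "kchain n A p j =
    {c. \<forall>S. if S \<subseteq> {1..n} \<and> card S = p then c S \<in> A (j - int p) else c S = 0}"

text \<open>A graded subquotient \<open>A/B\<close> is given by the families of the homogeneous components of \<open>A\<close> and \<open>B\<close>;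
  the predicate says that \<open>H\<^sub>p(x\<^sub>1, \<dots>, x\<^sub>n; A/B)\<close> vanishes in degree \<open>j\<close>.\<close>

definition koszul_zero ::
    "nat \<Rightarrow> (nat \<Rightarrow> 'v \<Rightarrow> 'v) \<Rightarrow> (int \<Rightarrow> 'v::ab_group_add set) \<Rightarrow> (int \<Rightarrow> 'v set) \<Rightarrow> nat \<Rightarrow> int \<Rightarrow> bool"
  where "koszul_zero n X A B p j \<longleftrightarrow> (\<forall>c\<in>kchain n A p j.
    (\<forall>S. kdiff n X c S \<in> B (j - int p + 1)) \<longrightarrow>
    (\<exists>e\<in>kchain n A (Suc p) j. \<forall>S. c S - kdiff n X e S \<in> B (j - int p)))"

text \<open>The Koszul calculus uses nothing but additivity and commutation of the variables, so one
  development serves both polynomials (\<open>vmult\<close>) and vectors of polynomials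
  (\<open>fmult\<close>).\<close>

locale commuting_action =
  fixes n :: nat and X :: "nat \<Rightarrow> 'v::ab_group_add \<Rightarrow> 'v"
  assumes X_add: "X i (a + b) = X i a + X i b"
    and X_commute: "X i (X j a) = X j (X i a)"
begin

definition graded_sub :: "(int \<Rightarrow> 'v set) \<Rightarrow> bool" where
  "graded_sub A \<longleftrightarrow> (\<forall>j. 0 \<in> A j \<and> (\<forall>a\<in>A j. \<forall>b\<in>A j. a - b \<in> A j) \<and>
    (\<forall>a\<in>A j. \<forall>i\<in>{1..n}. X i a \<in> A (j + 1)))"

lemma X_zero: "X i 0 = 0"
  using X_add[of i 0 0] by simp

lemma X_minus: "X i (- a) = - X i a"
  using X_add[of i a "- a"] X_zero by (simp add: eq_neg_iff_add_eq_0 add.commute)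

lemma X_diff: "X i (a - b) = X i a - X i b"
  using X_add[of i a "- b"] X_minus by simp

lemma X_sum: "X i (sum f A) = (\<Sum>a\<in>A. X i (f a))"
  by (induction A rule: infinite_finite_induct) (auto simp: X_zero X_add)

lemma X_ksign: "X i (ksign j S a) = ksign j S (X i a)"
  by (auto simp: ksign_def X_minus)

lemma graded_subD:
  assumes "graded_sub A"
  shows "0 \<in> A j" "a \<in> A j \<Longrightarrow> b \<in> A j \<Longrightarrow> a - b \<in> A j"
    "a \<in> A j \<Longrightarrow> - a \<in> A j" "a \<in> A j \<Longrightarrow> b \<in> A j \<Longrightarrow> a + b \<in> A j"
    "a \<in> A j \<Longrightarrow> i \<in> {1..n} \<Longrightarrow> X i a \<in> A (j + 1)"
    "a \<in> A j \<Longrightarrow> ksign i S a \<in> A j"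
proof -
  show *: "0 \<in> A j" "a \<in> A j \<Longrightarrow> b \<in> A j \<Longrightarrow> a - b \<in> A j" for a b
    using assms by (auto simp: graded_sub_def)
  show "a \<in> A j \<Longrightarrow> i \<in> {1..n} \<Longrightarrow> X i a \<in> A (j + 1)" using assms by (auto simp: graded_sub_def)
  show **: "a \<in> A j \<Longrightarrow> - a \<in> A j" for a using *(2)[of 0 a] *(1) by simp
  show "a \<in> A j \<Longrightarrow> b \<in> A j \<Longrightarrow> a + b \<in> A j" using *(2)[of a "- b"] **[of b] by simp
  show "a \<in> A j \<Longrightarrow> ksign i S a \<in> A j" using ** by (simp add: ksign_def)
qed

lemma graded_sub_sum:
  assumes "graded_sub A" "\<And>i. i \<in> I \<Longrightarrow> f i \<in> A j"
  shows "sum f I \<in> A j"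
  using assms(2) by (induction I rule: infinite_finite_induct) (auto intro: graded_subD[OF assms(1)])

lemma graded_sub_zero: "graded_sub (\<lambda>_. {0})"
  by (auto simp: graded_sub_def X_zero)

lemma kdiff_diff: "kdiff n X (\<lambda>S. c S - e S) S = kdiff n X c S - kdiff n X e S"
  by (simp add: kdiff_def X_diff sum_subtractf)

lemma kdiff_zero: "kdiff n X (\<lambda>S. 0) S = 0"
  by (simp add: kdiff_def X_zero)

lemma kdiff_kdiff: "kdiff n X (kdiff n X c) S = 0"
proof (cases "S \<subseteq> {1..n}")
  case True
  then have fin: "finite S" by (rule finite_subset) simp
  let ?D = "{1..n} - S"
  have "kdiff n X (kdiff n X c) S =
      (\<Sum>i\<in>?D. \<Sum>j\<in>?D - {i}. ksign i S (ksign j (insert i S) (X i (X j (c (insert j (insert i S)))))))"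
    (is "_ = (\<Sum>i\<in>?D. \<Sum>j\<in>?D - {i}. ?f i j)")
  proof -
    have "ksign i S (X i (kdiff n X c (insert i S))) = (\<Sum>j\<in>?D - {i}. ?f i j)" if i: "i \<in> ?D" for i
    proof -
      have sub: "insert i S \<subseteq> {1..n}" and D: "{1..n} - insert i S = ?D - {i}" using True i by auto
      have "kdiff n X c (insert i S) = (\<Sum>j\<in>?D - {i}. ksign j (insert i S) (X j (c (insert j (insert i S)))))"
        unfolding kdiff_def D using sub by simp
      then show ?thesis
        by (simp add: X_sum X_ksign) (simp add: ksign_def sum_negf)
    qed
    then show ?thesis unfolding kdiff_def[of n X _ S] using True by simp
  qed
  also have "\<dots> = 0"
  proof (rule sum_antisymmetric_zero)
    fix i j assume "i \<in> ?D" "j \<in> ?D" "i \<noteq> j"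
    then show "?f i j = - ?f j i"
      using ksign_anticommute[OF fin, of i j] by (simp add: X_commute[of i j] insert_commute[of i j])
  qed simp
  finally show ?thesis .
qed (simp add: kdiff_def)

lemma kdiff_in:
  assumes "graded_sub A" "\<And>S. c S \<in> A j"
  shows "kdiff n X c S \<in> A (j + 1)"
  using assms by (auto simp: kdiff_def intro!: graded_sub_sum graded_subD)

lemma kchain_in:
  assumes "graded_sub A" "c \<in> kchain n A p j"
  shows "c S \<in> A (j - int p)"
  using assms graded_subD(1)[OF assms(1)] by (auto simp: kchain_def split: if_splits)

lemma kchainI:
  assumes "\<And>S. S \<subseteq> {1..n} \<Longrightarrow> card S = p \<Longrightarrow> c S \<in> A (j - int p)"
    "\<And>S. \<not> (S \<subseteq> {1..n} \<and> card S = p) \<Longrightarrow> c S = 0"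
  shows "c \<in> kchain n A p j"
  using assms by (simp add: kchain_def)

lemma kchain_zero: "c \<in> kchain n A p j \<Longrightarrow> \<not> (S \<subseteq> {1..n} \<and> card S = p) \<Longrightarrow> c S = 0"
  unfolding kchain_def by (auto split: if_splits)

lemma kdiff_zero_chain:
  assumes "c \<in> kchain n A 0 j"
  shows "kdiff n X c S = 0"
proof (cases "S \<subseteq> {1..n}")
  case True
  then have "finite S" by (rule finite_subset) simp
  then have "c (insert i S) = 0" for i using kchain_zero[OF assms, of "insert i S"] by simp
  then show ?thesis by (simp add: kdiff_def X_zero)
qed (simp add: kdiff_def)

lemma kchain_kdiff:
  assumes "graded_sub A" "c \<in> kchain n A (Suc p) j"
  shows "kdiff n X c \<in> kchain n A p j"
proof (rule kchainI)
  fix S assume "S \<subseteq> {1..n}" "card S = p"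
  show "kdiff n X c S \<in> A (j - int p)"
    using kdiff_in[OF assms(1), of c "j - int (Suc p)" S] kchain_in[OF assms] by (simp add: algebra_simps)
next
  fix S assume S: "\<not> (S \<subseteq> {1..n} \<and> card S = p)"
  show "kdiff n X c S = 0"
  proof (cases "S \<subseteq> {1..n}")
    case True
    then have "finite S" by (rule finite_subset) simp
    then have "c (insert i S) = 0" if "i \<in> {1..n} - S" for i
      using kchain_zero[OF assms(2), of "insert i S"] that S True by simp
    then show ?thesis by (simp add: kdiff_def X_zero)
  qed (simp add: kdiff_def)
qed

lemma kchain_diff:
  assumes "graded_sub A" "c \<in> kchain n A p j" "e \<in> kchain n A p j"
  shows "(\<lambda>S. c S - e S) \<in> kchain n A p j"
  by (rule kchainI) (use kchain_in[OF assms(1,2)] kchain_in[OF assms(1,3)] graded_subD(2)[OF assms(1)]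
    kchain_zero[OF assms(2)] kchain_zero[OF assms(3)] in auto)

lemma kchain_add:
  assumes "graded_sub A" "c \<in> kchain n A p j" "e \<in> kchain n A p j"
  shows "(\<lambda>S. c S + e S) \<in> kchain n A p j"
  by (rule kchainI) (use kchain_in[OF assms(1,2)] kchain_in[OF assms(1,3)] graded_subD(4)[OF assms(1)]
    kchain_zero[OF assms(2)] kchain_zero[OF assms(3)] in auto)

lemma kchain_mono:
  assumes "\<And>j. A j \<subseteq> B j"
  shows "kchain n A p j \<subseteq> kchain n B p j"
  using assms by (fastforce simp: kchain_def split: if_splits)

text \<open>The middle of the long exact sequence for \<open>C/B\<close>, \<open>A/B\<close>,
  \<open>A/C\<close>: a cycle modulo \<open>B\<close> is a boundary modulo \<open>C\<close>, and the
  remaining chain in \<open>C\<close> is then a boundary modulo \<open>B\<close>.\<close>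

lemma koszul_zero_filtration:
  assumes A: "graded_sub A" and C: "graded_sub C" and B: "graded_sub B"
    and BC: "\<And>j. B j \<subseteq> C j" and CA: "\<And>j. C j \<subseteq> A j"
    and 1: "koszul_zero n X C B p j" and 2: "koszul_zero n X A C p j"
  shows "koszul_zero n X A B p j"
  unfolding koszul_zero_def
proof (intro ballI impI)
  fix c assume c: "c \<in> kchain n A p j" "\<forall>S. kdiff n X c S \<in> B (j - int p + 1)"
  then have "\<forall>S. kdiff n X c S \<in> C (j - int p + 1)" using BC by blast
  then obtain e where e: "e \<in> kchain n A (Suc p) j" "\<forall>S. c S - kdiff n X e S \<in> C (j - int p)"
    using 2 c(1) unfolding koszul_zero_def by blast
  let ?c = "\<lambda>S. c S - kdiff n X e S"
  have "?c \<in> kchain n C p j"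
  proof (rule kchainI)
    show "?c S = 0" if "\<not> (S \<subseteq> {1..n} \<and> card S = p)" for S
      using kchain_zero[OF c(1) that] kchain_zero[OF kchain_kdiff[OF A e(1)] that] by simp
  qed (use e(2) in blast)
  moreover have "\<forall>S. kdiff n X ?c S \<in> B (j - int p + 1)" using c(2) by (simp add: kdiff_diff kdiff_kdiff)
  ultimately obtain e' where e': "e' \<in> kchain n C (Suc p) j" "\<forall>S. ?c S - kdiff n X e' S \<in> B (j - int p)"
    using 1 unfolding koszul_zero_def by blast
  have "e' \<in> kchain n A (Suc p) j" using e'(1) kchain_mono[of C A, OF CA] by blast
  then have ee: "(\<lambda>S. e S + e' S) \<in> kchain n A (Suc p) j" by (rule kchain_add[OF A e(1)])
  have "kdiff n X (\<lambda>S. e S + e' S) S = kdiff n X e S + kdiff n X e' S" for S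
    by (simp add: kdiff_def X_add sum.distrib)
  then have "c S - kdiff n X (\<lambda>S. e S + e' S) S = ?c S - kdiff n X e' S" for S by simp
  then have "\<forall>S. c S - kdiff n X (\<lambda>S. e S + e' S) S \<in> B (j - int p)" using e'(2) by metis
  then show "\<exists>e\<in>kchain n A (Suc p) j. \<forall>S. c S - kdiff n X e S \<in> B (j - int p)" using ee by blast
qed

end

section \<open>Dimension shifting along a cover\<close>

text \<open>\<open>f\<close> represents a surjection from \<open>F\<close> onto \<open>A/B\<close>
  without dividing by \<open>B\<close>, so that a cover of \<open>R/I\<^sup>s\<close> takes values
  in polynomials. Additivity is asked within one degree only, since the maps of a resolution are
  controlled just on the carriers of the free modules.\<close>

locale koszul_cover = F: commuting_action n X + A: commuting_action n Y
  for n :: nat and X :: "nat \<Rightarrow> 'v::ab_group_add \<Rightarrow> 'v" and Y :: "nat \<Rightarrow> 'w::ab_group_add \<Rightarrow> 'w" +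
  fixes F :: "int \<Rightarrow> 'v set" and A B :: "int \<Rightarrow> 'w set" and f :: "'v \<Rightarrow> 'w"
  assumes F: "F.graded_sub F" and A: "A.graded_sub A" and B: "A.graded_sub B"
    and BA: "B j \<subseteq> A j"
    and f_in: "v \<in> F j \<Longrightarrow> f v \<in> A j"
    and f_add: "v \<in> F j \<Longrightarrow> w \<in> F j \<Longrightarrow> f (v + w) = f v + f w"
    and f_X: "v \<in> F j \<Longrightarrow> i \<in> {1..n} \<Longrightarrow> f (X i v) = Y i (f v)"
    and f_onto: "a \<in> A j \<Longrightarrow> \<exists>v\<in>F j. a - f v \<in> B j"
begin

definition K :: "int \<Rightarrow> 'v set" where
  "K j = {v \<in> F j. f v \<in> B j}"

lemma f_zero: "f 0 = 0"
  using f_add[of 0 0 0] F.graded_subD(1)[OF F, of 0] by simp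

lemma f_minus: "v \<in> F j \<Longrightarrow> f (- v) = - f v"
  using f_add[of v j "- v"] F.graded_subD(3)[OF F, of v j] f_zero
  by (simp add: eq_neg_iff_add_eq_0 add.commute)

lemma f_diff: "v \<in> F j \<Longrightarrow> w \<in> F j \<Longrightarrow> f (v - w) = f v - f w"
  using f_add[of v j "- w"] F.graded_subD(3)[OF F, of w j] f_minus[of w j] by simp

lemma f_sum: "(\<And>i. i \<in> I \<Longrightarrow> g i \<in> F j) \<Longrightarrow> f (sum g I) = (\<Sum>i\<in>I. f (g i))"
proof (induction I rule: infinite_finite_induct)
  case (insert i I)
  have "sum g I \<in> F j" by (rule F.graded_sub_sum[OF F]) (use insert.prems in auto)
  then show ?case using insert f_add[of "g i" j "sum g I"] by simp
qed (auto simp: f_zero)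

lemma graded_sub_K: "F.graded_sub K"
  unfolding F.graded_sub_def
proof (intro allI conjI ballI)
  fix j
  show "0 \<in> K j" using F.graded_subD(1)[OF F] A.graded_subD(1)[OF B] f_zero by (simp add: K_def)
  fix a assume a: "a \<in> K j"
  show "a - b \<in> K j" if "b \<in> K j" for b
    using a that F.graded_subD(2)[OF F] A.graded_subD(2)[OF B] by (auto simp: K_def f_diff[of a j b])
  show "X i a \<in> K (j + 1)" if "i \<in> {1..n}" for i
    using a that F.graded_subD(5)[OF F] A.graded_subD(5)[OF B] f_X[of a j i] by (auto simp: K_def)
qed

lemma kdiff_f:
  assumes "\<And>S. c S \<in> F j"
  shows "kdiff n Y (\<lambda>S. f (c S)) S = f (kdiff n X c S)"
proof (cases "S \<subseteq> {1..n}")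
  case True
  have t: "ksign i S (X i (c (insert i S))) \<in> F (j + 1)" if "i \<in> {1..n} - S" for i
    using that assms F.graded_subD(5,6)[OF F] by auto
  have "f (ksign i S (X i (c (insert i S)))) = ksign i S (Y i (f (c (insert i S))))" if "i \<in> {1..n} - S" for i
    using that assms F.graded_subD(5)[OF F] f_minus[of "X i (c (insert i S))" "j + 1"] f_X[of "c (insert i S)" j i]
    by (auto simp: ksign_def)
  then show ?thesis using True f_sum[of "{1..n} - S" "\<lambda>i. ksign i S (X i (c (insert i S)))" "j + 1", OF t] by (simp add: kdiff_def)
qed (simp add: kdiff_def f_zero)

lemma kchain_f:
  assumes "c \<in> kchain n F p j"
  shows "(\<lambda>S. f (c S)) \<in> kchain n A p j"
  by (rule A.kchainI) (use F.kchain_in[OF F assms] F.kchain_zero[OF assms] f_in f_zero in auto)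

lemma kchain_lift:
  assumes "c \<in> kchain n A p j"
  obtains c' where "c' \<in> kchain n F p j" "\<And>S. c S - f (c' S) \<in> B (j - int p)"
proof -
  have "\<exists>v. v \<in> F (j - int p) \<and> c S - f v \<in> B (j - int p)" for S
    using f_onto[OF A.kchain_in[OF A assms, of S]] by blast
  then obtain g where g: "\<And>S. g S \<in> F (j - int p)" "\<And>S. c S - f (g S) \<in> B (j - int p)" by metis
  let ?c = "\<lambda>S. if S \<subseteq> {1..n} \<and> card S = p then g S else 0"
  show thesis
  proof (rule that)
    show "?c \<in> kchain n F p j" by (rule F.kchainI) (use g in auto)
    show "c S - f (?c S) \<in> B (j - int p)" for S
      using g(2)[of S] A.kchain_zero[OF assms, of S] A.graded_subD(1)[OF B] f_zero by simp
  qed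
qed

text \<open>By \<open>bdd\<close> the map \<open>H\<^sub>p(K) \<rightarrow> H\<^sub>p(F)\<close> is
  zero, so each class of \<open>K\<close> comes, by the connecting map, from homology of
  \<open>A/B\<close> in homological degree \<open>p + 1\<close>, which vanishes. Concretely, the
  bounding chain \<open>e\<close> is corrected by a boundary until it lies in
  \<open>K\<close>.\<close>

lemma koszul_zero_kernel:
  assumes van: "koszul_zero n Y A B (Suc p) j"
    and bdd: "\<And>c. c \<in> kchain n K p j \<Longrightarrow> (\<And>S. kdiff n X c S = 0) \<Longrightarrow>
      \<exists>e\<in>kchain n F (Suc p) j. \<forall>S. c S = kdiff n X e S"
  shows "koszul_zero n X K (\<lambda>_. {0}) p j"
  unfolding koszul_zero_def
proof (intro ballI impI)
  fix k assume k: "k \<in> kchain n K p j" "\<forall>S. kdiff n X k S \<in> {0}"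
  then obtain e where e: "e \<in> kchain n F (Suc p) j" "\<And>S. k S = kdiff n X e S" using bdd[of k] by auto
  have eF: "e S \<in> F (j - int (Suc p))" for S by (rule F.kchain_in[OF F e(1)])
  let ?fe = "\<lambda>S. f (e S)"
  have "kdiff n Y ?fe S \<in> B (j - int (Suc p) + 1)" for S
    using F.kchain_in[OF graded_sub_K k(1), of S] kdiff_f[of e, OF eF] e(2)[of S] by (simp add: K_def)
  then obtain E where E: "E \<in> kchain n A (Suc (Suc p)) j"
      "\<And>S. ?fe S - kdiff n Y E S \<in> B (j - int (Suc p))"
    using van kchain_f[OF e(1)] unfolding koszul_zero_def by blast
  obtain E' where E': "E' \<in> kchain n F (Suc (Suc p)) j" "\<And>S. E S - f (E' S) \<in> B (j - int (Suc (Suc p)))"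
    using kchain_lift[OF E(1)] by blast
  have E'F: "E' S \<in> F (j - int (Suc (Suc p)))" for S by (rule F.kchain_in[OF F E'(1)])
  let ?e = "\<lambda>S. e S - kdiff n X E' S"
  have eF2: "?e \<in> kchain n F (Suc p) j"
    by (rule F.kchain_diff[OF F e(1) F.kchain_kdiff[OF F E'(1)]])
  have "f (?e S) \<in> B (j - int (Suc p))" for S
  proof -
    have "kdiff n X E' S \<in> F (j - int (Suc p))"
      by (rule F.kchain_in[OF F F.kchain_kdiff[OF F E'(1)]])
    then have "f (?e S) = f (e S) - kdiff n Y (\<lambda>S. f (E' S)) S"
      using f_diff[OF eF] kdiff_f[of E', OF E'F] by simp
    also have "\<dots> = (f (e S) - kdiff n Y E S) + kdiff n Y (\<lambda>S. E S - f (E' S)) S"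
      by (simp add: A.kdiff_diff)
    also have "\<dots> \<in> B (j - int (Suc p))"
    proof (rule A.graded_subD(4)[OF B E(2)])
      have "j - int (Suc (Suc p)) + 1 = j - int (Suc p)" by simp
      then show "kdiff n Y (\<lambda>S. E S - f (E' S)) S \<in> B (j - int (Suc p))"
        using A.kdiff_in[of B "\<lambda>S. E S - f (E' S)", OF B E'(2)] by metis
    qed
    finally show ?thesis .
  qed
  then have "?e \<in> kchain n K (Suc p) j"
    using F.kchain_in[OF F eF2] F.kchain_zero[OF eF2] by (intro F.kchainI) (auto simp: K_def)
  moreover have "k S - kdiff n X ?e S = 0" for S by (simp add: F.kdiff_diff F.kdiff_kdiff e(2))
  ultimately show "\<exists>e\<in>kchain n K (Suc p) j. \<forall>S. k S - kdiff n X e S \<in> {0}" by blast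
qed

text \<open>The other half of the sequence: a cycle of \<open>A/B\<close> lifts to \<open>F\<close>,
  the boundary of the lift is a cycle of \<open>K\<close> and bounds there, and subtracting leaves a
  cycle of \<open>F\<close>, which bounds as well.\<close>

lemma koszul_zero_cokernel:
  assumes K: "koszul_zero n X K (\<lambda>_. {0}) p j" and FZ: "koszul_zero n X F (\<lambda>_. {0}) (Suc p) j"
  shows "koszul_zero n Y A B (Suc p) j"
  unfolding koszul_zero_def
proof (intro ballI impI)
  fix c assume c: "c \<in> kchain n A (Suc p) j" "\<forall>S. kdiff n Y c S \<in> B (j - int (Suc p) + 1)"
  obtain c' where c': "c' \<in> kchain n F (Suc p) j" "\<And>S. c S - f (c' S) \<in> B (j - int (Suc p))"
    using kchain_lift[OF c(1)] by blast
  have c'F: "c' S \<in> F (j - int (Suc p))" for S by (rule F.kchain_in[OF F c'(1)])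
  let ?k = "kdiff n X c'"
  have kF: "?k \<in> kchain n F p j" by (rule F.kchain_kdiff[OF F c'(1)])
  have "f (?k S) \<in> B (j - int p)" for S
  proof -
    have "f (?k S) = kdiff n Y c S - kdiff n Y (\<lambda>S. c S - f (c' S)) S"
      using kdiff_f[of c', OF c'F] by (simp add: A.kdiff_diff)
    also have "\<dots> \<in> B (j - int (Suc p) + 1)"
      by (rule A.graded_subD(2)[OF B c(2)[rule_format] A.kdiff_in[of B "\<lambda>S. c S - f (c' S)", OF B c'(2)]])
    finally show ?thesis by (simp add: algebra_simps)
  qed
  then have "?k \<in> kchain n K p j"
    using F.kchain_in[OF F kF] F.kchain_zero[OF kF] by (intro F.kchainI) (auto simp: K_def)
  then obtain e where e: "e \<in> kchain n K (Suc p) j" "\<And>S. ?k S - kdiff n X e S = 0"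
    using K F.kdiff_kdiff unfolding koszul_zero_def by auto
  have eK: "e S \<in> K (j - int (Suc p))" for S by (rule F.kchain_in[OF graded_sub_K e(1)])
  have eF: "e \<in> kchain n F (Suc p) j" using e(1) F.kchain_mono[of K F] by (auto simp: K_def)
  have "(\<lambda>S. c' S - e S) \<in> kchain n F (Suc p) j" by (rule F.kchain_diff[OF F c'(1) eF])
  moreover have "kdiff n X (\<lambda>S. c' S - e S) S = 0" for S using e(2) by (simp add: F.kdiff_diff)
  ultimately obtain E where E: "E \<in> kchain n F (Suc (Suc p)) j" "\<And>S. (c' S - e S) - kdiff n X E S = 0"
    using FZ unfolding koszul_zero_def by fastforce
  have EF: "E S \<in> F (j - int (Suc (Suc p)))" for S by (rule F.kchain_in[OF F E(1)])
  have "c S - kdiff n Y (\<lambda>S. f (E S)) S \<in> B (j - int (Suc p))" for S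
  proof -
    have "kdiff n Y (\<lambda>S. f (E S)) S = f (c' S - e S)" using kdiff_f[of E, OF EF] E(2)[of S] by simp
    also have "\<dots> = f (c' S) - f (e S)" using f_diff[OF c'F, of "e S"] eK[of S] by (simp add: K_def)
    finally have "c S - kdiff n Y (\<lambda>S. f (E S)) S = (c S - f (c' S)) + f (e S)" by simp
    also have "\<dots> \<in> B (j - int (Suc p))"
      using c'(2)[of S] eK[of S] A.graded_subD(4)[OF B] by (simp add: K_def)
    finally show ?thesis .
  qed
  then show "\<exists>e\<in>kchain n A (Suc (Suc p)) j. \<forall>S. c S - kdiff n Y e S \<in> B (j - int (Suc p))"
    using kchain_f[OF E(1)] by blast
qed

end

section \<open>Koszul homology of monomial quotients\<close>

lemma lookup_single_times:
  fixes p :: "'k::field mpoly"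
  shows "Poly_Mapping.lookup (Poly_Mapping.single k a * p) (k + m) = a * Poly_Mapping.lookup p m"
    and "\<nexists>q. m = k + q \<Longrightarrow> Poly_Mapping.lookup (Poly_Mapping.single k a * p) m = 0"
proof -
  have *: "Poly_Mapping.lookup (Poly_Mapping.single k a * p) m =
      a * (\<Sum>q. Poly_Mapping.lookup p q when m = k + q)" for m
  proof -
    have "Poly_Mapping.lookup (Poly_Mapping.single k a * p) m =
        (\<Sum>l. (a * (\<Sum>q. Poly_Mapping.lookup p q when m = l + q)) when l = k)"
      unfolding lookup_mult by (intro Sum_any.cong) (auto simp: lookup_single when_def)
    then show ?thesis by simp
  qed
  have "(\<Sum>q. Poly_Mapping.lookup p q when k + m = k + q) = Poly_Mapping.lookup p m"
    by (simp add: eq_commute[of m])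
  then show "Poly_Mapping.lookup (Poly_Mapping.single k a * p) (k + m) = a * Poly_Mapping.lookup p m"
    unfolding * by simp
  show "Poly_Mapping.lookup (Poly_Mapping.single k a * p) m = 0" if "\<nexists>q. m = k + q"
  proof -
    have "(Poly_Mapping.lookup p q when m = k + q) = 0" for q using that by auto
    then show ?thesis unfolding * by simp
  qed
qed

lemma diff_single_add:
  fixes m :: "nat \<Rightarrow>\<^sub>0 nat"
  assumes "Poly_Mapping.lookup m i \<noteq> 0"
  shows "Poly_Mapping.single i 1 + (m - Poly_Mapping.single i 1) = m"
  by (rule poly_mapping_eqI)
    (use assms in \<open>auto simp: lookup_add lookup_minus lookup_single when_def\<close>)

lemma lookup_var_times:
  fixes p :: "'k::field mpoly"
  shows "Poly_Mapping.lookup (var i * p) m =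
    (if Poly_Mapping.lookup m i = 0 then 0 else Poly_Mapping.lookup p (m - Poly_Mapping.single i 1))"
proof (cases "Poly_Mapping.lookup m i = 0")
  case True
  then have "\<nexists>q. m = Poly_Mapping.single i 1 + q" by (auto simp: lookup_add)
  then show ?thesis using True lookup_single_times(2) by (simp add: var_def)
next
  case False
  then show ?thesis
    using lookup_single_times(1)[of "Poly_Mapping.single i 1" 1 p "m - Poly_Mapping.single i 1"]
    by (simp add: var_def diff_single_add del: One_nat_def)
qed

lemma keys_subset_iff_exps: "Poly_Mapping.keys m \<subseteq> {1..n} \<longleftrightarrow> Poly_Mapping.lookup m \<in> exps n"
  unfolding exps_def by (auto simp: in_keys_iff subset_iff)

lemma monom_deg_eq:
  assumes "Poly_Mapping.lookup m \<in> exps n"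
  shows "monom_deg m = (\<Sum>i=1..n. Poly_Mapping.lookup m i)"
  unfolding monom_deg_def
  by (rule sum.mono_neutral_left) (use assms keys_subset_iff_exps[of m n] in \<open>auto simp: in_keys_iff\<close>)

lemma monom_deg_superset:
  assumes "finite I" "Poly_Mapping.keys m \<subseteq> I"
  shows "monom_deg m = (\<Sum>i\<in>I. Poly_Mapping.lookup m i)"
  unfolding monom_deg_def by (rule sum.mono_neutral_left) (use assms in \<open>auto simp: in_keys_iff\<close>)

lemma monom_deg_add: "monom_deg (a + b) = monom_deg a + monom_deg b"
proof -
  let ?I = "Poly_Mapping.keys a \<union> Poly_Mapping.keys b"
  have "Poly_Mapping.keys (a + b) \<subseteq> ?I" by (rule keys_add)
  then show ?thesis
    by (simp add: monom_deg_superset[of ?I] lookup_add sum.distrib)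
qed

lemma monom_deg_single [simp]: "monom_deg (Poly_Mapping.single i k) = k"
  by (simp add: monom_deg_def)

lemma homog_iff:
  "p \<in> homog n j \<longleftrightarrow> (\<forall>m. Poly_Mapping.lookup p m \<noteq> 0 \<longrightarrow>
     Poly_Mapping.lookup m \<in> exps n \<and> int (monom_deg m) = j)"
  unfolding homog_def poly_ring_def
  by (simp add: keys_subset_iff_exps del: One_nat_def) (metis in_keys_iff)

section \<open>Spans of monomials and up-sets of exponents\<close>

definition mon_part :: "nat \<Rightarrow> (nat \<Rightarrow> nat) set \<Rightarrow> int \<Rightarrow> 'k::field mpoly set" where
  "mon_part n U j = {p \<in> homog n j. \<forall>m\<in>Poly_Mapping.keys p. Poly_Mapping.lookup m \<in> U}"

lemma mon_part_iff:
  "p \<in> mon_part n U j \<longleftrightarrow> (\<forall>m. Poly_Mapping.lookup p m \<noteq> 0 \<longrightarrow>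
     Poly_Mapping.lookup m \<in> exps n \<and> Poly_Mapping.lookup m \<in> U \<and> int (monom_deg m) = j)"
  by (auto simp: mon_part_def homog_iff in_keys_iff)

lemma mon_part_exps: "mon_part n (exps n) = homog n"
  by (auto simp: fun_eq_iff mon_part_iff homog_iff set_eq_iff)

definition upset :: "nat \<Rightarrow> (nat \<Rightarrow> nat) set \<Rightarrow> bool" where
  "upset n U \<longleftrightarrow> U \<subseteq> exps n \<and> (\<forall>b\<in>U. \<forall>c\<in>exps n. b \<le> c \<longrightarrow> c \<in> U)"

lemma upsetD: "upset n U \<Longrightarrow> b \<in> U \<Longrightarrow> c \<in> exps n \<Longrightarrow> b \<le> c \<Longrightarrow> c \<in> U"
  by (auto simp: upset_def)

abbreviation vmult :: "nat \<Rightarrow> 'k::field mpoly \<Rightarrow> 'k mpoly" where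
  "vmult i p \<equiv> var i * p"

global_interpretation R: commuting_action n vmult for n
  by unfold_locales (auto simp: distrib_left mult.left_commute)

lemma exps_diff_single:
  assumes "Poly_Mapping.lookup m \<in> exps n"
  shows "Poly_Mapping.lookup (m - Poly_Mapping.single i 1) \<in> exps n"
  using assms by (auto simp: exps_def lookup_minus)

lemma exps_add_single:
  assumes "Poly_Mapping.lookup m \<in> exps n" "i \<in> {1..n}"
  shows "Poly_Mapping.lookup (m + Poly_Mapping.single i 1) \<in> exps n"
  using assms by (auto simp: exps_def lookup_add lookup_single when_def)

lemma monom_deg_diff_single:
  assumes "Poly_Mapping.lookup m i \<noteq> 0"
  shows "int (monom_deg (m - Poly_Mapping.single i 1)) = int (monom_deg m) - 1"
  using monom_deg_add[of "Poly_Mapping.single i 1" "m - Poly_Mapping.single i 1"] diff_single_add[OF assms]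
  by simp

lemma graded_sub_mon_part:
  assumes "upset n U"
  shows "R.graded_sub n (mon_part n U :: int \<Rightarrow> 'k::field mpoly set)"
  unfolding R.graded_sub_def
proof (intro allI conjI ballI)
  fix j
  show "0 \<in> (mon_part n U j :: 'k mpoly set)" by (simp add: mon_part_iff)
  fix a :: "'k mpoly" assume a: "a \<in> mon_part n U j"
  show "a - b \<in> mon_part n U j" if "b \<in> mon_part n U j" for b
    using a that unfolding mon_part_iff by (auto simp: lookup_minus) (metis diff_zero)+
  show "vmult i a \<in> mon_part n U (j + 1)" if "i \<in> {1..n}" for i
    unfolding mon_part_iff
  proof (intro allI impI)
    fix m assume "Poly_Mapping.lookup (var i * a) m \<noteq> 0"
    then have i: "Poly_Mapping.lookup m i \<noteq> 0"
      and nz: "Poly_Mapping.lookup a (m - Poly_Mapping.single i 1) \<noteq> 0"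
      by (auto simp: lookup_var_times split: if_splits)
    let ?m = "m - Poly_Mapping.single i 1"
    have m: "m = ?m + Poly_Mapping.single i 1" using diff_single_add[OF i] by (simp add: add.commute)
    have *: "Poly_Mapping.lookup ?m \<in> exps n" "Poly_Mapping.lookup ?m \<in> U" "int (monom_deg ?m) = j"
      using a nz unfolding mon_part_iff by blast+
    have e: "Poly_Mapping.lookup m \<in> exps n" using exps_add_single[OF *(1) that] m by simp
    moreover have "Poly_Mapping.lookup m \<in> U"
      by (rule upsetD[OF assms *(2) e]) (auto simp: le_fun_def lookup_minus)
    moreover have "int (monom_deg m) = j + 1" using monom_deg_diff_single[OF i] *(3) by simp
    ultimately show "Poly_Mapping.lookup m \<in> exps n \<and> Poly_Mapping.lookup m \<in> U \<and> int (monom_deg m) = j + 1"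
      by blast
  qed
qed

lemma lookup_ksign:
  fixes p :: "'k::field mpoly"
  shows "Poly_Mapping.lookup (ksign i S p) m = ksign i S (Poly_Mapping.lookup p m)"
  by (simp add: ksign_def)

lemma lookup_kdiff:
  fixes c :: "nat set \<Rightarrow> 'k::field mpoly"
  assumes "S \<subseteq> {1..n}"
  shows "Poly_Mapping.lookup (kdiff n vmult c S) m = (\<Sum>i\<in>{1..n} - S. ksign i S
    (if Poly_Mapping.lookup m i = 0 then 0 else Poly_Mapping.lookup (c (insert i S)) (m - Poly_Mapping.single i 1)))"
  using assms by (simp only: kdiff_def lookup_sum lookup_ksign lookup_var_times if_True)

text \<open>Contracting homotopy: in multidegree \<open>\<alpha>\<close>, divide by \<open>x\<^sub>i\<close> for the least \<open>i \<notin> Z\<close> with \<open>\<sigma>\<^sub>i < \<alpha>\<^sub>i\<close>.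
  Without such \<open>i\<close> the only chain lives on \<open>x\<^sup>\<sigma>\<close> and a subset of \<open>Z\<close>.\<close>

lemma koszul_zero_box:
  fixes j :: int
  assumes V: "upset n V" and VW: "upset n (V \<union> W)" and disj: "V \<inter> W = {}"
    and W: "W = box n \<sigma> Z" and \<sigma>: "\<sigma> \<in> exps n" and Z: "Z \<subseteq> {1..n}"
    and j: "j - int p \<noteq> int (\<Sum>i=1..n. \<sigma> i) \<or> card Z < p"
  shows "koszul_zero n vmult (mon_part n (V \<union> W) :: int \<Rightarrow> 'k::field mpoly set) (mon_part n V) p j"
  unfolding koszul_zero_def
proof (intro ballI impI)
  let ?lk = Poly_Mapping.lookup
  let ?e = "\<lambda>i. Poly_Mapping.single i (1::nat)"
  let ?A = "mon_part n (V \<union> W) :: int \<Rightarrow> 'k mpoly set"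
  fix c assume c: "c \<in> kchain n ?A p j" and dc: "\<forall>S. kdiff n vmult c S \<in> mon_part n V (j - int p + 1)"
  note gA = graded_sub_mon_part[OF VW, where ?'k = 'k]
  have cA: "c S \<in> ?A (j - int p)" for S by (rule R.kchain_in[OF gA c])
  \<comment> \<open>\<open>\<alpha> T \<mu>\<close> is the multidegree of
    \<open>x\<^sup>\<mu> e\<^sub>T\<close>, and the pivot \<open>pk\<close> depends on it alone. The
    differential preserves multidegrees, so one pivot serves all terms of an identity.\<close>
  define \<alpha> where "\<alpha> = (\<lambda>T \<mu> (i::nat). ?lk \<mu> i + (if i \<in> T then 1 else 0 :: nat))"
  define P where "P = (\<lambda>T \<mu> i. i \<in> {1..n} - Z \<and> \<sigma> i < \<alpha> T \<mu> i)"
  define pk where "pk = (\<lambda>T \<mu>. LEAST i. P T \<mu> i)"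
  define co where "co = (\<lambda>T \<mu>. if ?lk \<mu> \<in> W \<and> (\<exists>i. P T \<mu> i) \<and> pk T \<mu> \<in> T
    then ksign (pk T \<mu>) (T - {pk T \<mu>}) (?lk (c (T - {pk T \<mu>})) (\<mu> + ?e (pk T \<mu>))) else 0)"
  define E where "E = (\<lambda>T. if T \<subseteq> {1..n} \<and> card T = Suc p then Abs_poly_mapping (co T) else 0)"
  have fin: "finite {\<mu>. co T \<mu> \<noteq> 0}" if "finite T" for T
  proof (rule finite_subset)
    show "{\<mu>. co T \<mu> \<noteq> 0} \<subseteq> (\<Union>i\<in>T. (\<lambda>m. m - ?e i) ` Poly_Mapping.keys (c (T - {i})))"
    proof
      fix \<mu> assume "\<mu> \<in> {\<mu>. co T \<mu> \<noteq> 0}"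
      then have *: "pk T \<mu> \<in> T" "?lk (c (T - {pk T \<mu>})) (\<mu> + ?e (pk T \<mu>)) \<noteq> 0"
        by (auto simp: co_def split: if_splits)
      then have "\<mu> \<in> (\<lambda>m. m - ?e (pk T \<mu>)) ` Poly_Mapping.keys (c (T - {pk T \<mu>}))"
        by (intro image_eqI[of _ _ "\<mu> + ?e (pk T \<mu>)"]) (auto simp: in_keys_iff)
      then show "\<mu> \<in> (\<Union>i\<in>T. (\<lambda>m. m - ?e i) ` Poly_Mapping.keys (c (T - {i})))" using * by blast
    qed
  qed (use that in auto)
  have lkE: "?lk (E T) = co T" if "T \<subseteq> {1..n}" "card T = Suc p" for T
  proof -
    have "finite T" using that(1) by (rule finite_subset) simp
    then show ?thesis using fin[of T] that by (simp add: E_def)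
  qed
  have EA: "E \<in> kchain n ?A (Suc p) j"
  proof (rule R.kchainI)
    fix T assume T: "T \<subseteq> {1..n}" "card T = Suc p"
    show "E T \<in> ?A (j - int (Suc p))"
      unfolding mon_part_iff lkE[OF T]
    proof (intro allI impI)
      fix \<mu> assume "co T \<mu> \<noteq> 0"
      then have *: "?lk \<mu> \<in> W" "?lk (c (T - {pk T \<mu>})) (\<mu> + ?e (pk T \<mu>)) \<noteq> 0"
        by (auto simp: co_def split: if_splits)
      then have "int (monom_deg (\<mu> + ?e (pk T \<mu>))) = j - int p"
        using cA[of "T - {pk T \<mu>}"] unfolding mon_part_iff by blast
      then have "int (monom_deg \<mu>) = j - int (Suc p)" by (simp add: monom_deg_add)
      then show "?lk \<mu> \<in> exps n \<and> ?lk \<mu> \<in> V \<union> W \<and> int (monom_deg \<mu>) = j - int (Suc p)"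
        using * VW by (auto simp: upset_def)
    qed
  qed (auto simp: E_def)
  have main: "?lk (c S) \<mu> = ?lk (kdiff n vmult E S) \<mu>"
    if S: "S \<subseteq> {1..n}" "card S = p" and \<mu>: "?lk \<mu> \<in> W" for S \<mu>
  proof -
    have finS: "finite S" using S(1) by (rule finite_subset) simp
    have \<mu>W: "\<sigma> i \<le> ?lk \<mu> i" "i \<in> Z \<Longrightarrow> ?lk \<mu> i = \<sigma> i" "?lk \<mu> \<in> exps n" for i
      using \<mu> by (auto simp: W box_def le_fun_def)
    have \<alpha>eq: "\<alpha> (insert i S) (\<mu> - ?e i) = \<alpha> S \<mu>" if "i \<notin> S" "?lk \<mu> i \<noteq> 0" for i
      using that by (auto simp: \<alpha>_def fun_eq_iff lookup_minus lookup_single when_def)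
    have Peq: "P (insert i S) (\<mu> - ?e i) = P S \<mu>" "pk (insert i S) (\<mu> - ?e i) = pk S \<mu>"
      if "i \<notin> S" "?lk \<mu> i \<noteq> 0" for i
      using \<alpha>eq[OF that] by (auto simp: P_def pk_def)
    have lkd: "?lk (kdiff n vmult E S) \<mu> = (\<Sum>i\<in>{1..n} - S. ksign i S
        (if ?lk \<mu> i = 0 then 0 else co (insert i S) (\<mu> - ?e i)))"
      unfolding lookup_kdiff[OF S(1)]
    proof (rule sum.cong[OF refl])
      fix i assume "i \<in> {1..n} - S"
      then have "?lk (E (insert i S)) = co (insert i S)" using S finS by (intro lkE) auto
      then show "ksign i S (if ?lk \<mu> i = 0 then 0 else ?lk (E (insert i S)) (\<mu> - ?e i)) =
          ksign i S (if ?lk \<mu> i = 0 then 0 else co (insert i S) (\<mu> - ?e i))" by simp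
    qed
    show ?thesis
    proof (cases "\<exists>i. P S \<mu> i")
      case False
      have r: "?lk (kdiff n vmult E S) \<mu> = 0"
        unfolding lkd by (rule sum.neutral) (use False Peq in \<open>auto simp: co_def\<close>)
      have "?lk (c S) \<mu> = 0"
      proof (rule ccontr)
        assume "?lk (c S) \<mu> \<noteq> 0"
        then have deg: "int (monom_deg \<mu>) = j - int p" using cA[of S] unfolding mon_part_iff by blast
        have n: "i \<notin> S \<and> ?lk \<mu> i = \<sigma> i" if "i \<in> {1..n} - Z" for i
          using False \<mu>W(1)[of i] that by (auto simp: P_def \<alpha>_def not_less split: if_splits)
        then have "S \<subseteq> Z" using S by blast
        then have "p \<le> card Z" using S Z card_mono[of Z S] by (simp add: finite_subset)
        moreover have "monom_deg \<mu> = (\<Sum>i=1..n. \<sigma> i)"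
          unfolding monom_deg_eq[OF \<mu>W(3)] using n \<mu>W(2) by (intro sum.cong) auto
        ultimately show False using j deg by simp
      qed
      then show ?thesis using r by simp
    next
      case True
      define i where "i = pk S \<mu>"
      have i: "i \<in> {1..n}" "i \<notin> Z" "\<sigma> i < \<alpha> S \<mu> i"
        using LeastI_ex[OF True] by (auto simp: i_def pk_def P_def)
      have co: "co (insert k S) (\<mu> - ?e k) = (if ?lk (\<mu> - ?e k) \<in> W \<and> i \<in> insert k S
          then ksign i (insert k S - {i}) (?lk (c (insert k S - {i})) (\<mu> - ?e k + ?e i)) else 0)"
        if "k \<notin> S" "?lk \<mu> k \<noteq> 0" for k
        using Peq[OF that] True unfolding co_def i_def by auto
      show ?thesis
      proof (cases "i \<in> S")
        case False
        \<comment> \<open>The homotopy is supported on sets that contain the pivot, so only the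
          summand inserting \<open>i\<close> survives, and it returns the coefficient of
          \<open>c\<close>.\<close>
        have li: "?lk \<mu> i \<noteq> 0" "\<sigma> i < ?lk \<mu> i" using i False by (auto simp: \<alpha>_def)
        have "?lk (\<mu> - ?e i) \<in> W"
          using \<mu>W i li exps_diff_single[OF \<mu>W(3), of i]
          by (auto simp: W box_def le_fun_def lookup_minus lookup_single when_def)
        then have "co (insert i S) (\<mu> - ?e i) = ksign i S (?lk (c S) \<mu>)"
          using co[OF False li(1)] False diff_single_add[OF li(1)] by (simp add: add.commute)
        moreover have "ksign k S (if ?lk \<mu> k = 0 then 0 else co (insert k S) (\<mu> - ?e k)) = 0"
          if "k \<in> {1..n} - S - {i}" for k
          using co[of k] that False by auto
        ultimately show ?thesis
          unfolding lkd using i False li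
          by (subst sum.remove[of _ i]) (auto simp: sum.neutral)
      next
        case iS: True
        \<comment> \<open>With the pivot in \<open>S\<close>, the cycle condition at
          \<open>S - {i}\<close> and \<open>x\<^sub>i x\<^sup>\<mu>\<close> expresses the
          coefficient of \<open>c\<close> at \<open>S\<close> through the sets
          \<open>insert k (S - {i})\<close>. These are the terms in the boundary of
          \<open>E\<close>.\<close>
        let ?S = "S - {i}"
        have S': "?S \<subseteq> {1..n}" "finite ?S" "i \<notin> ?S" "insert i ?S = S" using S finS iS by auto
        have mW: "?lk (\<mu> + ?e i) \<in> W"
          using \<mu>W i exps_add_single[OF \<mu>W(3) i(1)]
          by (auto simp: W box_def le_fun_def lookup_add lookup_single when_def intro: le_SucI)
        then have "?lk (\<mu> + ?e i) \<notin> V" using disj by blast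
        then have "?lk (kdiff n vmult c ?S) (\<mu> + ?e i) = 0"
          using dc unfolding mon_part_iff by blast
        moreover have "?lk (kdiff n vmult c ?S) (\<mu> + ?e i) = ksign i ?S (?lk (c S) \<mu>) +
            (\<Sum>k\<in>{1..n} - S. ksign k ?S (if ?lk \<mu> k = 0 then 0 else ?lk (c (insert k ?S)) (\<mu> - ?e k + ?e i)))"
        proof -
          have D: "{1..n} - ?S = insert i ({1..n} - S)" using i iS by auto
          have "?lk (\<mu> + ?e i) k = ?lk \<mu> k" "?lk \<mu> k \<noteq> 0 \<Longrightarrow> \<mu> + ?e i - ?e k = \<mu> - ?e k + ?e i"
            if "k \<in> {1..n} - S" for k
            using that iS by (auto simp: lookup_add lookup_single when_def lookup_minus intro!: poly_mapping_eqI)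
          then have "(\<Sum>k\<in>{1..n} - S. ksign k ?S (if ?lk (\<mu> + ?e i) k = 0 then 0
                else ?lk (c (insert k ?S)) (\<mu> + ?e i - ?e k))) =
              (\<Sum>k\<in>{1..n} - S. ksign k ?S (if ?lk \<mu> k = 0 then 0 else ?lk (c (insert k ?S)) (\<mu> - ?e k + ?e i)))"
            by (intro sum.cong) auto
          then show ?thesis
            unfolding lookup_kdiff[OF S'(1)] D using iS S' by (simp add: lookup_add insert_absorb)
        qed
        ultimately have "ksign i ?S (?lk (c S) \<mu>) = - (\<Sum>k\<in>{1..n} - S.
            ksign k ?S (if ?lk \<mu> k = 0 then 0 else ?lk (c (insert k ?S)) (\<mu> - ?e k + ?e i)))"
          by (simp add: eq_neg_iff_add_eq_0)
        then have "ksign i ?S (ksign i ?S (?lk (c S) \<mu>)) = ksign i ?S (- (\<Sum>k\<in>{1..n} - S.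
            ksign k ?S (if ?lk \<mu> k = 0 then 0 else ?lk (c (insert k ?S)) (\<mu> - ?e k + ?e i))))"
          by (rule arg_cong)
        then have cS: "?lk (c S) \<mu> = (\<Sum>k\<in>{1..n} - S. - ksign i ?S (ksign k ?S
            (if ?lk \<mu> k = 0 then 0 else ?lk (c (insert k ?S)) (\<mu> - ?e k + ?e i))))"
          by (simp only: ksign_simps) (simp add: ksign_def sum_negf)
        show ?thesis
          unfolding cS lkd
        proof (rule sum.cong[OF refl])
          fix k assume k: "k \<in> {1..n} - S"
          show "- ksign i ?S (ksign k ?S (if ?lk \<mu> k = 0 then 0 else ?lk (c (insert k ?S)) (\<mu> - ?e k + ?e i)))
            = ksign k S (if ?lk \<mu> k = 0 then 0 else co (insert k S) (\<mu> - ?e k))"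
          proof (cases "?lk \<mu> k = 0")
            case False
            have ki: "k \<noteq> i" "k \<notin> S" using k iS by auto
            have ins: "insert k S - {i} = insert k ?S" using ki by auto
            have sgn: "- ksign i ?S (ksign k ?S a) = ksign k S (ksign i (insert k ?S) a)" for a :: 'k
            proof -
              have 1: "ksign k S b = (if i < k then - ksign k ?S b else ksign k ?S b)" for b :: 'k
                using ksign_insert[OF S'(2,3), of k b] S'(4) by simp
              have 2: "ksign i (insert k ?S) b = (if k < i then - ksign i ?S b else ksign i ?S b)" for b :: 'k
                by (rule ksign_insert[OF S'(2)]) (use ki in simp)
              have "\<not> (i < k \<and> k < i)" "i < k \<or> k < i" using ki by linarith+
              then show ?thesis
                unfolding 1 2 ksign_commute[of i ?S k ?S a] by (cases "i < k") simp_all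
            qed
            \<comment> \<open>The homotopy omits terms whose monomial leaves \<open>W\<close>, so
              their coefficients must vanish. A monomial in \<open>V\<close> would force
              \<open>x\<^sub>i x\<^sup>\<mu>\<close> into \<open>V\<close>; one in \<open>W\<close>
              would keep \<open>\<mu> - ?e k\<close> in \<open>W\<close>, because only the entry at
              \<open>i\<close> changes, which is not confined and is at least
              \<open>\<sigma> i\<close> already in \<mu>.\<close>
            have "?lk (c (insert k ?S)) (\<mu> - ?e k + ?e i) = 0" if nW: "?lk (\<mu> - ?e k) \<notin> W"
            proof (rule ccontr)
              assume "?lk (c (insert k ?S)) (\<mu> - ?e k + ?e i) \<noteq> 0"
              then have "?lk (\<mu> - ?e k + ?e i) \<in> V \<union> W"
                using cA[of "insert k ?S"] unfolding mon_part_iff by blast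
              then show False
              proof
                assume "?lk (\<mu> - ?e k + ?e i) \<in> V"
                moreover have "?lk (\<mu> - ?e k + ?e i) \<le> ?lk (\<mu> + ?e i)"
                  by (auto simp: le_fun_def lookup_add lookup_minus)
                ultimately have "?lk (\<mu> + ?e i) \<in> V" by (rule upsetD[OF V _ exps_add_single[OF \<mu>W(3) i(1)]])
                then show False using mW disj by blast
              next
                assume w: "?lk (\<mu> - ?e k + ?e i) \<in> W"
                have "\<sigma> l \<le> ?lk (\<mu> - ?e k) l" for l
                proof (cases "l = i")
                  case True
                  then show ?thesis using \<mu>W(1)[of i] ki by (simp add: lookup_minus lookup_single)
                next
                  case False
                  have "\<sigma> l \<le> ?lk (\<mu> - ?e k + ?e i) l" using w by (simp add: W box_def le_fun_def)
                  then show ?thesis using False by (simp add: lookup_add lookup_single)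
                qed
                moreover have "?lk (\<mu> - ?e k) l = \<sigma> l" if "l \<in> Z" for l
                proof -
                  have "?lk (\<mu> - ?e k + ?e i) l = \<sigma> l" "l \<noteq> i" using w i(2) that by (auto simp: W box_def)
                  then show ?thesis by (simp add: lookup_add lookup_single)
                qed
                ultimately show False
                  using nW exps_diff_single[OF \<mu>W(3), of k] by (auto simp: W box_def le_fun_def)
              qed
            qed
            then show ?thesis using False co[OF ki(2) False] iS sgn by (simp add: ins)
          qed simp
        qed
      qed
    qed
  qed
  have "c S - kdiff n vmult E S \<in> mon_part n V (j - int p)" for S
  proof (cases "S \<subseteq> {1..n} \<and> card S = p")
    case True
    have "c S - kdiff n vmult E S \<in> ?A (j - int p)"
      by (rule R.kchain_in[OF gA R.kchain_diff[OF gA c R.kchain_kdiff[OF gA EA]]])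
    then show ?thesis using main True unfolding mon_part_iff
      by (auto simp: lookup_minus) 
  next
    case False
    then show ?thesis
      using R.kchain_zero[OF c False] R.kchain_zero[OF R.kchain_kdiff[OF gA EA] False]
      by (simp add: mon_part_iff)
  qed
  then show "\<exists>e\<in>kchain n ?A (Suc p) j. \<forall>S. c S - kdiff n vmult e S \<in> mon_part n V (j - int p)"
    using EA by blast
qed

text \<open>The submodule \<open>V\<close> that is divided out stays arbitrary in the induction,
  because a split inserts an intermediate up-set. For a box, homology occurs only where
  \<open>j - p\<close> is the degree of the corner, hence not above \<open>r\<close>.\<close>

lemma koszul_zero_box_filt:
  assumes "box_filt n r W" "upset n V" "upset n (V \<union> W)" "V \<inter> W = {}" "int r < j - int p"
  shows "koszul_zero n vmult (mon_part n (V \<union> W) :: int \<Rightarrow> 'k::field mpoly set) (mon_part n V) p j"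
  using assms
proof (induction arbitrary: V)
  case empty
  have z: "(0::'k mpoly) \<in> mon_part n V j" for j by (simp add: mon_part_iff)
  show ?case
    unfolding koszul_zero_def
  proof (intro ballI impI bexI allI)
    fix c :: "nat set \<Rightarrow> 'k mpoly" and S
    assume "c \<in> kchain n (mon_part n (V \<union> {})) p j"
    then show "c S - kdiff n vmult (\<lambda>_. 0) S \<in> mon_part n V (j - int p)"
      using R.kchain_in[OF graded_sub_mon_part, of n "V \<union> {}" c p j S] empty by (simp add: R.kdiff_zero)
    show "(\<lambda>_. 0) \<in> kchain n (mon_part n (V \<union> {}) :: int \<Rightarrow> 'k mpoly set) (Suc p) j"
      by (rule R.kchainI) (use z in auto)
  qed
next
  case (box \<sigma> Z)
  then have "j - int p \<noteq> int (\<Sum>i=1..n. \<sigma> i)" by linarith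
  then show ?case using box by (intro koszul_zero_box[OF _ _ _ refl]) auto
next
  case (split W1 W)
  have up: "upset n (V \<union> W1)"
    unfolding upset_def
  proof (intro conjI ballI impI)
    show "V \<union> W1 \<subseteq> exps n" using split.prems(2) split.hyps by (auto simp: upset_def)
    fix b c assume b: "b \<in> V \<union> W1" and c: "c \<in> exps n" "b \<le> c"
    show "c \<in> V \<union> W1"
    proof (cases "b \<in> V")
      case True
      then show ?thesis using upsetD[OF split.prems(1) True c] by blast
    next
      case False
      then have "c \<in> V \<union> W" using b split.hyps by (intro upsetD[OF split.prems(2) _ c]) auto
      then show ?thesis using b c False split.hyps by blast
    qed
  qed
  have eq: "V \<union> W1 \<union> (W - W1) = V \<union> W" using split.hyps by blast
  show ?case
  proof (rule R.koszul_zero_filtration[where C = "mon_part n (V \<union> W1)"])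
    show "koszul_zero n vmult (mon_part n (V \<union> W1) :: int \<Rightarrow> 'k mpoly set) (mon_part n V) p j"
      using split up by (intro split.IH(1)) auto
    show "koszul_zero n vmult (mon_part n (V \<union> W) :: int \<Rightarrow> 'k mpoly set) (mon_part n (V \<union> W1)) p j"
      using split.IH(2)[of "V \<union> W1"] split.prems split.hyps up unfolding eq by blast
    show "mon_part n V j \<subseteq> (mon_part n (V \<union> W1) j :: 'k mpoly set)"
      "mon_part n (V \<union> W1) j \<subseteq> (mon_part n (V \<union> W) j :: 'k mpoly set)" for j
      using split.hyps(3) by (auto simp: mon_part_def)
  qed (use split.prems up in \<open>simp_all add: graded_sub_mon_part\<close>)
qed

section \<open>A nonvanishing Koszul class\<close>

definition mono_of :: "(nat \<Rightarrow> nat) \<Rightarrow> (nat \<Rightarrow>\<^sub>0 nat)" where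
  "mono_of b = Abs_poly_mapping b"

lemma lookup_mono_of: "b \<in> exps n \<Longrightarrow> Poly_Mapping.lookup (mono_of b) = b"
  unfolding mono_of_def
  by (rule lookup_Abs_poly_mapping) (rule finite_subset[of _ "{1..n}"], auto simp: exps_def)

locale disjoint_blocks =
  fixes n t s q :: nat
  assumes n: "t \<le> n" "1 \<le> t" and s: "1 \<le> s"
  defines "q \<equiv> (n + 1) div (t + 1)"
begin

text \<open>The blocks are indexed from \<open>0\<close>, and \<open>\<beta> S\<close> is the exponent \<open>\<alpha> - S\<close>, where \<open>\<alpha>\<close> is the exponent of
  \<open>B\<^sub>1\<^sup>s B\<^sub>2 \<cdots> B\<^sub>q\<close>.\<close>

definition blk :: "nat \<Rightarrow> nat set" where
  "blk k = {k * (t + 1) + 1..k * (t + 1) + t}"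

definition blocks :: "nat set" where
  "blocks = (\<Union>k<q. blk k)"

definition bidx :: "nat \<Rightarrow> nat" where
  "bidx i = (i - 1) div (t + 1)"

definition \<alpha> :: "nat \<Rightarrow> nat" where
  "\<alpha> i = (if i \<in> blocks then if bidx i = 0 then s else 1 else 0)"

definition transv :: "nat set set" where
  "transv = {S. S \<subseteq> blocks \<and> (\<forall>k<q. \<exists>!i. i \<in> S \<inter> blk k)}"

definition \<beta> :: "nat set \<Rightarrow> nat \<Rightarrow>\<^sub>0 nat" where
  "\<beta> S = mono_of (\<lambda>i. \<alpha> i - (if i \<in> S then 1 else 0))"

definition S0 :: "nat set" where
  "S0 = (\<lambda>k. k * (t + 1) + 1) ` {..<q}"

lemma q1: "1 \<le> q"
  using n by (simp add: q_def Suc_le_eq div_greater_zero_iff)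

lemma bidx_blk: "i \<in> blk k \<Longrightarrow> bidx i = k"
  unfolding blk_def bidx_def by (intro div_nat_eqI) (auto simp: algebra_simps)

lemma blk_bidx: "i \<in> blocks \<Longrightarrow> i \<in> blk (bidx i) \<and> bidx i < q"
  unfolding blocks_def using bidx_blk by auto

text \<open>The \<open>q\<close> blocks and the \<open>q - 1\<close> gaps between them fill
  \<open>q * (t + 1) - 1\<close> positions, which is at most \<open>n\<close> by the choice of
  \<open>q\<close>.\<close>

lemma blocks_sub: "blocks \<subseteq> {1..n}"
proof
  fix i assume "i \<in> blocks"
  then obtain k where k: "k < q" "i \<in> blk k" by (auto simp: blocks_def)
  have "(k + 1) * (t + 1) \<le> q * (t + 1)" using k by (intro mult_right_mono) auto
  also have "\<dots> \<le> n + 1" unfolding q_def by (rule div_times_less_eq_dividend)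
  finally show "i \<in> {1..n}" using k by (auto simp: blk_def)
qed

lemma S0_transv: "S0 \<in> transv"
proof -
  have b: "k * (t + 1) + 1 \<in> blk k" for k using n by (simp add: blk_def)
  have "\<exists>!i. i \<in> S0 \<inter> blk k" if "k < q" for k
  proof (rule ex1I[of _ "k * (t + 1) + 1"])
    show "k * (t + 1) + 1 \<in> S0 \<inter> blk k" using b that by (auto simp: S0_def)
    fix i assume "i \<in> S0 \<inter> blk k"
    then obtain l where l: "i = l * (t + 1) + 1" "i \<in> blk k" by (auto simp: S0_def)
    then have "l = k" using bidx_blk[OF b, of l] bidx_blk[of i k] by simp
    then show "i = k * (t + 1) + 1" using l by simp
  qed
  moreover have "S0 \<subseteq> blocks" unfolding S0_def blocks_def using b by blast
  ultimately show ?thesis by (simp add: transv_def)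
qed

lemma inj_S0: "inj_on (\<lambda>k. k * (t + 1) + 1) {..<q}"
  by (rule inj_onI) (simp only: add_right_cancel mult_cancel2, simp)

lemma card_S0: "card S0 = q"
  unfolding S0_def by (subst card_image[OF inj_S0]) simp

lemma alpha_exps: "\<alpha> \<in> exps n"
  using blocks_sub by (auto simp: \<alpha>_def exps_def)

lemma lookup_beta: "Poly_Mapping.lookup (\<beta> S) = (\<lambda>i. \<alpha> i - (if i \<in> S then 1 else 0))"
  unfolding \<beta>_def by (rule lookup_mono_of[of _ n]) (use alpha_exps in \<open>auto simp: exps_def\<close>)

lemma beta_exps: "Poly_Mapping.lookup (\<beta> S) \<in> exps n"
  unfolding lookup_beta using alpha_exps by (auto simp: exps_def)

lemma alpha_pos: "i \<in> blocks \<Longrightarrow> 1 \<le> \<alpha> i"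
  using s by (simp add: \<alpha>_def)

lemma transv_fin: "S \<in> transv \<Longrightarrow> S \<subseteq> {1..n} \<and> finite S"
  using blocks_sub finite_subset by (auto simp: transv_def intro: finite_subset[of _ "{1..n}"])

lemma sum_alpha: "(\<Sum>i=1..n. \<alpha> i) = t * (s + q - 1)"
proof -
  have "(\<Sum>i=1..n. \<alpha> i) = (\<Sum>i\<in>blocks. \<alpha> i)"
    by (rule sum.mono_neutral_right) (use blocks_sub in \<open>auto simp: \<alpha>_def\<close>)
  also have "\<dots> = (\<Sum>k<q. \<Sum>i\<in>blk k. \<alpha> i)"
    unfolding blocks_def
  proof (rule sum.UNION_disjoint)
    show "\<forall>i\<in>{..<q}. finite (blk i)" by (simp add: blk_def)
    show "\<forall>i\<in>{..<q}. \<forall>j\<in>{..<q}. i \<noteq> j \<longrightarrow> blk i \<inter> blk j = {}"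
      using bidx_blk by blast
  qed simp
  also have "\<dots> = (\<Sum>k<q. t * (if k = 0 then s else 1))"
  proof (rule sum.cong[OF refl])
    fix k assume "k \<in> {..<q}"
    then have "\<alpha> i = (if k = 0 then s else 1)" if "i \<in> blk k" for i
      using that bidx_blk[OF that] by (auto simp: \<alpha>_def blocks_def)
    then have "(\<Sum>i\<in>blk k. \<alpha> i) = (\<Sum>i\<in>blk k. if k = 0 then s else 1)" by (rule sum.cong[OF refl])
    then show "(\<Sum>i\<in>blk k. \<alpha> i) = t * (if k = 0 then s else 1)" by (simp add: blk_def)
  qed
  also have "\<dots> = t * (s + q - 1)"
  proof -
    obtain q' where q': "q = Suc q'" using q1 by (cases q) auto
    have "(\<Sum>k<Suc q'. t * (if k = 0 then s else 1)) = t * s + (\<Sum>k<q'. t)"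
      by (simp add: sum.lessThan_Suc_shift del: sum.lessThan_Suc)
    then show ?thesis unfolding q' by (simp add: algebra_simps)
  qed
  finally show ?thesis .
qed

lemma deg_beta:
  assumes "S \<in> transv" "card S = q"
  shows "int (monom_deg (\<beta> S)) = int (t * (s + q - 1)) - int q"
proof -
  have "(\<Sum>i=1..n. \<alpha> i) = (\<Sum>i=1..n. Poly_Mapping.lookup (\<beta> S) i + (if i \<in> S then 1 else 0))"
  proof (rule sum.cong[OF refl])
    fix i
    show "\<alpha> i = Poly_Mapping.lookup (\<beta> S) i + (if i \<in> S then 1 else 0)"
      using alpha_pos[of i] assms(1) by (auto simp: lookup_beta transv_def)
  qed
  also have "\<dots> = monom_deg (\<beta> S) + card S"
    using transv_fin[OF assms(1)] monom_deg_eq[OF beta_exps]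
    by (simp add: sum.distrib sum.inter_restrict[symmetric] Int_absorb1)
  finally have "t * (s + q - 1) = monom_deg (\<beta> S) + q" using sum_alpha assms(2) by simp
  then show ?thesis by (simp only: of_nat_add)
qed

text \<open>A path on which the exponents of \<alpha> are positive avoids the gaps and is a whole
  block. A transversal lowers one exponent in every block, which rules out all blocks but the first
  and leaves at most \<open>s - 1\<close> copies of that one.\<close>

lemma transv_notin:
  assumes S: "S \<in> transv"
  shows "Poly_Mapping.lookup (\<beta> S) \<notin> power_exps n t s"
proof
  assume "Poly_Mapping.lookup (\<beta> S) \<in> power_exps n t s"
  then obtain h where h: "h \<in> exps (n + 1 - t)" "(\<Sum>i=1..n + 1 - t. h i) = s"
      and le: "path_exp t h \<le> Poly_Mapping.lookup (\<beta> S)"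
    by (auto simp: power_exps_def)
  have hw: "h w \<le> path_exp t h l" if "1 \<le> w" "w \<le> l" "l < w + t" for w l
    unfolding path_exp_def by (rule member_le_sum) (use that in auto)
  have hb: "h w \<le> \<alpha> l - (if l \<in> S then 1 else 0)" if "1 \<le> w" "w \<le> l" "l < w + t" for w l
    using hw[OF that] le_funD[OF le, of l] by (simp add: lookup_beta)
  have start: "w = 1 \<and> h w \<le> s - 1" if w: "h w \<noteq> 0" for w
  proof -
    have w1: "1 \<le> w" using expsD[OF h(1) w] by simp
    have inb: "l \<in> blocks" if "w \<le> l" "l < w + t" for l
      using hb[OF w1 that] w by (auto simp: \<alpha>_def split: if_splits)
    define k where "k = bidx w"
    have wk: "w \<in> blk k" "k < q" using blk_bidx[OF inb[of w]] n by (auto simp: k_def)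
    \<comment> \<open>Otherwise the path would run over the gap behind block \<open>k\<close>, at
      the position \<open>(k + 1) * (t + 1)\<close>.\<close>
    have "w = k * (t + 1) + 1"
    proof (rule ccontr)
      assume "w \<noteq> k * (t + 1) + 1"
      then have "w \<le> (k + 1) * (t + 1)" "(k + 1) * (t + 1) < w + t" using wk(1) by (auto simp: blk_def)
      then have "(k + 1) * (t + 1) \<in> blocks" by (rule inb)
      then obtain k' where k': "(k + 1) * (t + 1) \<in> blk k'" by (auto simp: blocks_def)
      have "((k + 1) * (t + 1) - 1) mod (t + 1) = t"
      proof -
        have "(k + 1) * (t + 1) - 1 = t + k * (t + 1)" by simp
        then show ?thesis by (simp del: mult_Suc_right add_Suc_right)
      qed
      moreover have "((k + 1) * (t + 1) - 1) mod (t + 1) < t"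
      proof -
        define r where "r = (k + 1) * (t + 1) - 1 - k' * (t + 1)"
        have r: "(k + 1) * (t + 1) - 1 = r + k' * (t + 1)" "r < t"
          using k' unfolding blk_def r_def atLeastAtMost_iff by linarith+
        then show ?thesis by (simp only: mod_mult_self1) simp
      qed
      ultimately show False by simp
    qed
    moreover obtain i where i: "i \<in> S" "i \<in> blk k" using S wk(2) unfolding transv_def by blast
    ultimately have "h w \<le> \<alpha> i - 1" using hb[OF w1, of i] by (auto simp: blk_def)
    moreover have "i \<in> blocks" "bidx i = k" using i wk(2) bidx_blk by (auto simp: blocks_def)
    ultimately have "k = 0" "h w \<le> s - 1" using w by (auto simp: \<alpha>_def split: if_splits)
    then show ?thesis using \<open>w = k * (t + 1) + 1\<close> by simp
  qed
  have "(\<Sum>i=1..n + 1 - t. h i) = (\<Sum>i\<in>{1}. h i)"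
    by (rule sum.mono_neutral_right) (use start n in auto)
  also have "\<dots> \<le> s - 1" using start[of 1] by (cases "h 1 = 0") auto
  finally show False using h(2) s by linarith
qed

text \<open>Without \<open>i\<close> its block is complete again and supplies the missing path:
  \<open>s\<close> copies of the first block, or \<open>s - 1\<close> of them and one copy of
  another block. This makes the chain on \<open>S0\<close> a cycle modulo
  \<open>I\<^sup>s\<close>.\<close>

lemma nontransv_in:
  assumes i: "i \<in> S0"
  shows "Poly_Mapping.lookup (\<beta> (S0 - {i})) \<in> power_exps n t s"
proof -
  obtain k where k: "k < q" "i = k * (t + 1) + 1" using i by (auto simp: S0_def)
  define h where "h = (if k = 0 then (\<lambda>_. 0)(1 := s) else (\<lambda>_. 0)(1 := s - 1, i := 1))"
  have iN: "i \<in> {1..n + 1 - t}"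
  proof -
    have "i + t - 1 \<in> blk k" using k n by (auto simp: blk_def)
    then have "i + t - 1 \<in> {1..n}" using blocks_sub k by (auto simp: blocks_def)
    then show ?thesis using k n by auto
  qed
  have he: "h \<in> exps (n + 1 - t)" using iN n by (auto simp: h_def exps_def)
  have i1: "i \<noteq> 1" if "k \<noteq> 0" using k that by simp
  have sum: "(\<Sum>i=1..n + 1 - t. h i) = s"
  proof (cases "k = 0")
    case True
    have "(\<Sum>i=1..n + 1 - t. h i) = (\<Sum>i\<in>{1}. h i)"
      by (rule sum.mono_neutral_right) (use n True in \<open>auto simp: h_def\<close>)
    then show ?thesis using True by (simp add: h_def)
  next
    case False
    have "(\<Sum>i=1..n + 1 - t. h i) = (\<Sum>i\<in>{1, i}. h i)"
      by (rule sum.mono_neutral_right) (use n iN False in \<open>auto simp: h_def split: if_splits\<close>)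
    then show ?thesis using False i1 s by (simp add: h_def)
  qed
  have "path_exp t h l \<le> Poly_Mapping.lookup (\<beta> (S0 - {i})) l" for l
  proof -
    have z: "path_exp t (\<lambda>_. 0) l = 0" for l by (simp add: path_exp_def)
    have p1: "path_exp t ((\<lambda>_. 0)(1 := a)) l = (if 1 \<le> l \<and> l < 1 + t then a else 0)" for a l
      using path_exp_upd[of "\<lambda>_. 0" 1 t a l] z by simp
    have S0blk: "x = kk * (t + 1) + 1" if "x \<in> S0" "x \<in> blk kk" for x kk
    proof -
      obtain m where m: "x = m * (t + 1) + 1" "m < q" using \<open>x \<in> S0\<close> by (auto simp: S0_def)
      then have "x \<in> blk m" using n by (simp add: blk_def)
      then show ?thesis using m bidx_blk[of x m] bidx_blk[of x kk] that by simp
    qed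
    have b0: "1 \<le> l \<and> l < 1 + t \<Longrightarrow> l \<in> blk 0" by (simp add: blk_def)
    have inb: "l \<in> blk kk \<Longrightarrow> kk < q \<Longrightarrow> l \<in> blocks \<and> bidx l = kk" for kk
      using bidx_blk by (auto simp: blocks_def)
    show ?thesis
    proof (cases "k = 0")
      case True
      then have "path_exp t h l = (if 1 \<le> l \<and> l < 1 + t then s else 0)" using p1 by (simp add: h_def)
      moreover have "s \<le> Poly_Mapping.lookup (\<beta> (S0 - {i})) l" if l: "1 \<le> l \<and> l < 1 + t"
      proof -
        have "l \<notin> S0 - {i}" using S0blk[OF _ b0[OF l]] k True by auto
        then show ?thesis using inb[OF b0[OF l]] q1 by (auto simp: lookup_beta \<alpha>_def)
      qed
      ultimately show ?thesis by simp
    next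
      case False
      have "path_exp t h l = path_exp t ((\<lambda>_. 0)(1 := s - 1)) l + (if i \<le> l \<and> l < i + t then 1 else 0)"
        using False i1 iN path_exp_upd[of "(\<lambda>_. 0)(1 := s - 1)" i t 1 l] by (simp add: h_def)
      then have pe: "path_exp t h l =
          (if 1 \<le> l \<and> l < 1 + t then s - 1 else 0) + (if i \<le> l \<and> l < i + t then 1 else 0)"
        by (simp only: p1)
      have bk: "i \<le> l \<and> l < i + t \<Longrightarrow> l \<in> blk k" using k by (simp add: blk_def)
      consider "1 \<le> l \<and> l < 1 + t" "\<not> (i \<le> l \<and> l < i + t)" | "i \<le> l \<and> l < i + t" "\<not> (1 \<le> l \<and> l < 1 + t)"
        | "\<not> (i \<le> l \<and> l < i + t)" "\<not> (1 \<le> l \<and> l < 1 + t)"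
        using bidx_blk[OF b0] bidx_blk[OF bk] False by blast
      then show ?thesis
      proof cases
        case 1
        then show ?thesis using inb[OF b0] q1 unfolding pe by (auto simp: lookup_beta \<alpha>_def)
      next
        case 2
        have "l \<notin> S0 - {i}" using S0blk[OF _ bk[OF 2(1)]] k by auto
        then show ?thesis using 2 inb[OF bk] k False unfolding pe by (auto simp: lookup_beta \<alpha>_def)
      next
        case 3
        then show ?thesis unfolding pe by auto
      qed
    qed
  qed
  then show ?thesis using he sum beta_exps by (auto simp: power_exps_def le_fun_def)
qed

text \<open>Exchanging the inserted element with the element of \<open>S\<close> in the same block is a
  sign-reversing involution, hence the sum of the coefficients over all transversals kills
  boundaries.\<close>

lemma sum_transv_kdiff:
  fixes g :: "nat set \<Rightarrow> 'k::ab_group_add"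
  shows "(\<Sum>S\<in>transv. \<Sum>i\<in>blocks - S. ksign i S (g (insert i S))) = 0"
proof -
  \<comment> \<open>The element of \<open>S\<close> in the block of \<open>i\<close>. Thus
    \<open>insert i S\<close> contains exactly two transversals, \<open>S\<close> and the one with
    \<open>i\<close> in place of \<open>rep S i\<close>; their contributions will cancel.\<close>
  define rep where "rep = (\<lambda>S i. THE j. j \<in> S \<inter> blk (bidx i))"
  have rep: "rep S i \<in> S \<and> rep S i \<in> blk (bidx i)" "j \<in> S \<Longrightarrow> j \<in> blk (bidx i) \<Longrightarrow> j = rep S i"
    if "S \<in> transv" "i \<in> blocks" for S i j
  proof -
    have "bidx i < q" using blk_bidx[OF that(2)] by blast
    then have ex: "\<exists>!j. j \<in> S \<inter> blk (bidx i)" using that(1) unfolding transv_def by blast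
    show "rep S i \<in> S \<and> rep S i \<in> blk (bidx i)"
      using theI'[OF ex] unfolding rep_def Int_iff .
    show "j = rep S i" if "j \<in> S" "j \<in> blk (bidx i)"
      unfolding rep_def using the1_equality[OF ex, of j] that by simp
  qed
  let ?P = "{(S, i). S \<in> transv \<and> i \<in> blocks - S \<and> i < rep S i}"
  let ?Q = "{(S, i). S \<in> transv \<and> i \<in> blocks - S \<and> rep S i < i}"
  let ?f = "\<lambda>(S, i). ksign i S (g (insert i S))"
  let ?w = "\<lambda>(S, i). (insert i (S - {rep S i}), rep S i)"
  have finb: "finite blocks" using blocks_sub by (rule finite_subset) simp
  have fint: "finite transv" by (rule finite_subset[of _ "Pow blocks"]) (use finb in \<open>auto simp: transv_def\<close>)
  have fin: "finite ?P" "finite ?Q"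
    by (rule finite_subset[of _ "transv \<times> blocks"], use fint finb in auto)+
  have swap: "insert i (S - {rep S i}) \<in> transv \<and> rep S i \<in> blocks - insert i (S - {rep S i}) \<and>
      rep (insert i (S - {rep S i})) (rep S i) = i \<and>
      insert (rep S i) (insert i (S - {rep S i}) - {i}) = S"
    if S: "S \<in> transv" and i: "i \<in> blocks - S" for S i
  proof -
    define r where "r = rep S i"
    have r: "r \<in> S" "r \<in> blk (bidx i)" using rep(1)[OF S] i by (auto simp: r_def)
    have ib: "i \<in> blk (bidx i)" "bidx i < q" using blk_bidx i by auto
    have rb: "bidx r = bidx i" using bidx_blk r by blast
    have r': "r \<in> blocks" using r S by (auto simp: transv_def)
    have "\<exists>!j. j \<in> insert i (S - {r}) \<inter> blk k" if k: "k < q" for k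
    proof (cases "k = bidx i")
      case True
      show ?thesis
        by (rule ex1I[of _ i]) (use True ib rep(2)[OF S, of i] i in \<open>auto simp: r_def\<close>)
    next
      case False
      then have "i \<notin> blk k" "r \<notin> blk k" using bidx_blk rb by auto
      then have "insert i (S - {r}) \<inter> blk k = S \<inter> blk k" by auto
      then show ?thesis using S k unfolding transv_def by simp
    qed
    then have T: "insert i (S - {r}) \<in> transv" using S i by (auto simp: transv_def)
    moreover have "rep (insert i (S - {r})) r = i"
      using rep(2)[OF T r', of i] ib rb by simp
    moreover have "r \<noteq> i" using r i by auto
    ultimately show ?thesis using r r' i unfolding r_def[symmetric] by auto
  qed
  have neq: "rep S i \<noteq> i" if "S \<in> transv" "i \<in> blocks - S" for S i
    using rep(1)[of S i] that by auto
  have "(\<Sum>S\<in>transv. \<Sum>i\<in>blocks - S. ksign i S (g (insert i S))) = sum ?f (Sigma transv (\<lambda>S. blocks - S))"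
    using fint finb by (simp add: sum.Sigma)
  also have "Sigma transv (\<lambda>S. blocks - S) = ?P \<union> ?Q"
    using neq by (auto simp: neq_iff)
  also have "sum ?f (?P \<union> ?Q) = sum ?f ?P + sum ?f ?Q"
    by (rule sum.union_disjoint[OF fin]) auto
  also have "sum ?f ?Q = (\<Sum>x\<in>?P. - ?f x)"
  proof (rule sum.reindex_bij_witness[of _ ?w ?w])
    fix x assume "x \<in> ?Q"
    then obtain S i where x: "x = (S, i)" and S: "S \<in> transv" "i \<in> blocks - S" "rep S i < i" by auto
    note sw = swap[OF S(1,2)]
    show "?w (?w x) = x" using sw by (simp add: x)
    show "?w x \<in> ?P" using sw S by (simp add: x)
    define r U where "r = rep S i" and "U = S - {rep S i}"
    have U: "S = insert r U" "r \<notin> U" "i \<notin> U" "finite U" "r < i" "r \<noteq> i"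
      using rep(1)[OF S(1)] S transv_fin[OF S(1)] by (auto simp: r_def U_def)
    have rib: "r \<in> blk (bidx i)" "i \<in> blk (bidx i)" using rep(1)[OF S(1)] blk_bidx S by (auto simp: r_def)
    \<comment> \<open>Blocks are intervals, so no other element of the set lies between
      \<open>r\<close> and \<open>i\<close>; the two signs differ only through the mutual position
      of \<open>r\<close> and \<open>i\<close>.\<close>
    have nb: "x \<notin> U" if "r \<le> x" "x \<le> i" for x
    proof
      assume "x \<in> U"
      moreover have "x \<in> blk (bidx i)" using rib that by (auto simp: blk_def)
      ultimately show False using rep(2)[OF S(1), of i x] S(2) by (auto simp: U_def)
    qed
    have "x < r \<longleftrightarrow> x < i" if "x \<in> U" for x
      using nb[of x] U(5) that by (meson less_imp_le_nat less_trans not_less)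
    then have "{x \<in> U. x < r} = {x \<in> U. x < i}" by blast
    then have s: "ksign r U a = ksign i U a" for a :: 'k by (simp add: ksign_def)
    have sg: "ksign i (insert r U) a = - ksign r (insert i U) a" for a :: 'k
      using ksign_insert[OF U(4,2), of i a] ksign_insert[OF U(4,3), of r a] U(5) s by simp
    have "?w x = (insert i U, r)" by (simp add: x r_def U_def)
    then have "?f (?w x) = ksign r (insert i U) (g (insert r (insert i U)))" by simp
    moreover have "?f x = ksign i (insert r U) (g (insert i (insert r U)))" by (simp add: x U(1))
    ultimately show "- ?f (?w x) = ?f x" by (simp add: sg insert_commute)
  next
    fix x assume "x \<in> ?P"
    then obtain S i where x: "x = (S, i)" and S: "S \<in> transv" "i \<in> blocks - S" "i < rep S i" by auto
    note sw = swap[OF S(1,2)]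
    show "?w (?w x) = x" using sw by (simp add: x)
    show "?w x \<in> ?Q" using sw S by (simp add: x)
  qed
  finally show ?thesis by (simp add: sum_negf)
qed

theorem koszul_nonzero:
  "\<not> koszul_zero n vmult (homog n :: int \<Rightarrow> 'k::field mpoly set) (mon_part n (power_exps n t s)) q
    (int (t * (s + q - 1)))"
proof
  let ?j = "int (t * (s + q - 1))"
  let ?U = "power_exps n t s"
  let ?lk = Poly_Mapping.lookup
  assume van: "koszul_zero n vmult (homog n :: int \<Rightarrow> 'k mpoly set) (mon_part n ?U) q ?j"
  have up: "upset n (exps n)" by (auto simp: upset_def)
  note gR = graded_sub_mon_part[OF up, where ?'k = 'k, unfolded mon_part_exps]
  \<comment> \<open>A single term on the transversal of first elements: the sum over transversals
    takes the value 1 on it, so it cannot bound modulo \<open>I\<^sup>s\<close>.\<close>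
  define c :: "nat set \<Rightarrow> 'k mpoly" where
    "c = (\<lambda>S. if S = S0 then Poly_Mapping.single (\<beta> S0) 1 else 0)"
  have S0: "S0 \<subseteq> {1..n}" "finite S0" using transv_fin[OF S0_transv] by auto
  have cc: "c \<in> kchain n (homog n) q ?j"
  proof (rule R.kchainI)
    fix S show "c S \<in> homog n (?j - int q)"
      using deg_beta[OF S0_transv card_S0] beta_exps
      by (auto simp: c_def homog_iff lookup_single when_def)
  qed (use S0 card_S0 in \<open>auto simp: c_def\<close>)
  have dc: "kdiff n vmult c S \<in> mon_part n ?U (?j - int q + 1)" for S
  proof (cases "\<exists>i\<in>S0. S = S0 - {i}")
    case False
    have "c (insert i S) = 0" if "i \<notin> S" for i
      using False that by (auto simp: c_def)
    then have "kdiff n vmult c S = 0" by (simp add: kdiff_def)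
    then show ?thesis by (simp add: mon_part_iff)
  next
    case True
    then obtain i where i: "i \<in> S0" "S = S0 - {i}" by blast
    have "kdiff n vmult c S \<in> homog n (?j - int q + 1)"
      by (rule R.kdiff_in[OF gR]) (rule R.kchain_in[OF gR cc])
    moreover have "?lk m \<in> ?U" if m: "?lk (kdiff n vmult c S) m \<noteq> 0" for m
    proof -
      have Sn: "S \<subseteq> {1..n}" using S0 i by blast
      obtain k where k: "k \<in> {1..n} - S" "ksign k S (if ?lk m k = 0 then 0 else ?lk (c (insert k S)) (m - Poly_Mapping.single k 1)) \<noteq> 0"
        using m unfolding lookup_kdiff[OF Sn] by (rule sum.not_neutral_contains_not_neutral)
      then have k2: "?lk m k \<noteq> 0" "insert k S = S0" "m - Poly_Mapping.single k 1 = \<beta> S0"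
        by (auto simp: c_def lookup_single when_def split: if_splits)
      have "k = i" using k2(2) i k(1) by auto
      have "m = \<beta> S"
      proof (rule poly_mapping_eqI)
        fix l
        have "?lk m l = ?lk (\<beta> S0) l + (if l = k then 1 else 0)"
          using arg_cong[OF diff_single_add[OF k2(1)], of "\<lambda>m. ?lk m l"] k2(3)
          by (auto simp: lookup_add lookup_single when_def)
        moreover have "i \<in> blocks" using i S0_transv by (auto simp: transv_def)
        ultimately show "?lk m l = ?lk (\<beta> S) l"
          using alpha_pos[of i] i \<open>k = i\<close> by (auto simp: lookup_beta)
      qed
      then show ?thesis using nontransv_in[OF i(1)] i by simp
    qed
    ultimately show ?thesis by (auto simp: mon_part_def in_keys_iff)
  qed
  obtain E where E: "E \<in> kchain n (homog n) (Suc q) ?j" "\<And>S. c S - kdiff n vmult E S \<in> mon_part n ?U (?j - int q)"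
    using van cc dc unfolding koszul_zero_def by blast
  \<comment> \<open>At a transversal the monomial \<open>\<beta> S\<close> lies outside
    \<open>I\<^sup>s\<close>, so there the congruence is an equality of coefficients.\<close>
  have eq: "?lk (c S) (\<beta> S) = ?lk (kdiff n vmult E S) (\<beta> S)" if "S \<in> transv" for S
  proof -
    have "?lk (c S - kdiff n vmult E S) (\<beta> S) = 0"
      using E(2)[of S] transv_notin[OF that] unfolding mon_part_iff by blast
    then show ?thesis by (simp add: lookup_minus)
  qed
  have fint: "finite transv" by (rule finite_subset[of _ "Pow {1..n}"]) (use transv_fin in auto)
  have "(\<Sum>S\<in>transv. ?lk (c S) (\<beta> S)) = (\<Sum>S\<in>transv. if S = S0 then 1 else 0)"
    by (rule sum.cong) (auto simp: c_def)
  also have "\<dots> = 1" using fint S0_transv by simp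
  finally have "1 = (\<Sum>S\<in>transv. ?lk (kdiff n vmult E S) (\<beta> S))" using eq by simp
  also have "\<dots> = (\<Sum>S\<in>transv. \<Sum>i\<in>blocks - S. ksign i S (?lk (E (insert i S)) (\<beta> (insert i S))))"
  proof (rule sum.cong[OF refl])
    fix S assume S: "S \<in> transv"
    have Sn: "S \<subseteq> {1..n}" using transv_fin[OF S] by simp
    \<comment> \<open>Variables outside the blocks have exponent 0 in \<open>\<beta> S\<close>, so
      their summands do not reach this coefficient.\<close>
    have "?lk (kdiff n vmult E S) (\<beta> S) = (\<Sum>i\<in>blocks - S. ksign i S
        (if ?lk (\<beta> S) i = 0 then 0 else ?lk (E (insert i S)) (\<beta> S - Poly_Mapping.single i 1)))"
      unfolding lookup_kdiff[OF Sn]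
      by (rule sum.mono_neutral_right) (use blocks_sub in \<open>auto simp: lookup_beta \<alpha>_def\<close>)
    also have "\<dots> = (\<Sum>i\<in>blocks - S. ksign i S (?lk (E (insert i S)) (\<beta> (insert i S))))"
    proof (rule sum.cong[OF refl])
      fix i assume i: "i \<in> blocks - S"
      then have "?lk (\<beta> S) i \<noteq> 0" using alpha_pos[of i] by (simp add: lookup_beta)
      moreover have "\<beta> S - Poly_Mapping.single i 1 = \<beta> (insert i S)"
        by (rule poly_mapping_eqI) (use i in \<open>auto simp: lookup_minus lookup_beta lookup_single when_def\<close>)
      ultimately show "ksign i S (if ?lk (\<beta> S) i = 0 then 0 else ?lk (E (insert i S)) (\<beta> S - Poly_Mapping.single i 1))
          = ksign i S (?lk (E (insert i S)) (\<beta> (insert i S)))" by simp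
    qed
    finally show "?lk (kdiff n vmult E S) (\<beta> S) =
        (\<Sum>i\<in>blocks - S. ksign i S (?lk (E (insert i S)) (\<beta> (insert i S))))" .
  qed
  also have "\<dots> = 0" by (rule sum_transv_kdiff[of "\<lambda>T. ?lk (E T) (\<beta> T)"])
  finally show False by simp
qed

end

section \<open>Minimal covers by free modules\<close>

lemma homogD:
  assumes "p \<in> homog n j" "Poly_Mapping.lookup p m \<noteq> 0"
  shows "Poly_Mapping.lookup m \<in> exps n" "int (monom_deg m) = j"
  using assms by (auto simp: homog_iff)

lemma upset_exps: "upset n (exps n)"
  by (auto simp: upset_def)

lemmas graded_sub_homog = graded_sub_mon_part[OF upset_exps, unfolded mon_part_exps]

lemma homog_zero: "0 \<in> homog n j"
  by (simp add: homog_iff)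

lemma homog_minus: "p \<in> homog n j \<Longrightarrow> - p \<in> homog n j"
  by (rule R.graded_subD(3)[OF graded_sub_homog])

lemma homog_diff: "p \<in> homog n j \<Longrightarrow> q \<in> homog n j \<Longrightarrow> p - q \<in> homog n j"
  by (rule R.graded_subD(2)[OF graded_sub_homog])

lemma homog_var: "i \<in> {1..n} \<Longrightarrow> p \<in> homog n j \<Longrightarrow> var i * p \<in> homog n (j + 1)"
  by (rule R.graded_subD(5)[OF graded_sub_homog])

lemma homog_sum: "(\<And>i. i \<in> I \<Longrightarrow> f i \<in> homog n j) \<Longrightarrow> sum f I \<in> homog n j"
  by (rule R.graded_sub_sum[OF graded_sub_homog])

lemma homog_var_one: "i \<in> {1..n} \<Longrightarrow> var i \<in> homog n 1"
  by (auto simp: homog_iff var_def lookup_single when_def exps_def)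

lemma homog_single_zero: "Poly_Mapping.single 0 a \<in> homog n 0"
  by (auto simp: homog_iff lookup_single when_def exps_def monom_deg_def)

lemma homog_mult:
  assumes "p \<in> homog n i" "q \<in> homog n j"
  shows "p * q \<in> homog n (i + j)"
  unfolding homog_iff
proof (intro allI impI)
  fix m assume "Poly_Mapping.lookup (p * q) m \<noteq> 0"
  then have "m \<in> Poly_Mapping.keys (p * q)" by (simp add: in_keys_iff)
  then obtain a b where ab: "m = a + b" "a \<in> Poly_Mapping.keys p" "b \<in> Poly_Mapping.keys q"
    using keys_mult[of p q] by blast
  then show "Poly_Mapping.lookup m \<in> exps n \<and> int (monom_deg m) = i + j"
    using homogD[OF assms(1), of a] homogD[OF assms(2), of b]
    by (auto simp: in_keys_iff monom_deg_add exps_def lookup_add)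
qed

lemma homog_zero_degree:
  assumes "p \<in> homog n 0"
  shows "p = Poly_Mapping.single 0 (Poly_Mapping.lookup p 0)"
proof (rule poly_mapping_eqI)
  fix m
  have "m = 0" if "Poly_Mapping.lookup p m \<noteq> 0"
  proof -
    have "monom_deg m = 0" using homogD[OF assms that] by simp
    then have "\<forall>i\<in>Poly_Mapping.keys m. Poly_Mapping.lookup m i = 0" by (simp add: monom_deg_def)
    then show ?thesis by (metis in_keys_iff lookup_zero poly_mapping_eqI)
  qed
  then show "Poly_Mapping.lookup p m = Poly_Mapping.lookup (Poly_Mapping.single 0 (Poly_Mapping.lookup p 0)) m"
    by (auto simp: lookup_single when_def)
qed

lemma homog_const_coeff: "p \<in> homog n j \<Longrightarrow> j \<noteq> 0 \<Longrightarrow> Poly_Mapping.lookup p 0 = 0"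
  using homogD(2)[of p n j 0] by (auto simp: monom_deg_def)

section \<open>Graded free modules and their Koszul homology\<close>

type_synonym 'k fvec = "nat \<Rightarrow> 'k mpoly"

abbreviation fmult :: "nat \<Rightarrow> 'k::field fvec \<Rightarrow> 'k fvec" where
  "fmult i v \<equiv> (\<lambda>k. var i * v k)"

global_interpretation Fm: commuting_action n fmult for n
  by unfold_locales (auto simp: distrib_left mult.left_commute fun_eq_iff)

definition free_part :: "nat \<Rightarrow> int list \<Rightarrow> int \<Rightarrow> 'k::field fvec set" where
  "free_part n ds j = {v. \<forall>k. if k < length ds then v k \<in> homog n (j - ds ! k) else v k = 0}"

lemma free_partD:
  assumes "v \<in> free_part n ds j"
  shows "k < length ds \<Longrightarrow> v k \<in> homog n (j - ds ! k)" "\<not> k < length ds \<Longrightarrow> v k = 0"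
  using assms unfolding free_part_def by (metis (mono_tags, lifting) mem_Collect_eq)+

lemma free_partI:
  assumes "\<And>k. k < length ds \<Longrightarrow> v k \<in> homog n (j - ds ! k)" "\<And>k. \<not> k < length ds \<Longrightarrow> v k = 0"
  shows "v \<in> free_part n ds j"
  using assms by (simp add: free_part_def)

lemma graded_sub_free_part: "Fm.graded_sub n (free_part n ds :: int \<Rightarrow> 'k::field fvec set)"
  unfolding Fm.graded_sub_def
proof (intro allI conjI ballI)
  fix j
  show "0 \<in> (free_part n ds j :: 'k fvec set)" by (rule free_partI) (auto simp: homog_zero)
  fix a :: "'k fvec" assume a: "a \<in> free_part n ds j"
  show "a - b \<in> free_part n ds j" if "b \<in> free_part n ds j" for b
    by (rule free_partI) (use free_partD[OF a] free_partD[OF that] in \<open>auto simp: homog_diff\<close>)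
  show "fmult i a \<in> free_part n ds (j + 1)" if "i \<in> {1..n}" for i
  proof (rule free_partI)
    fix k assume "k < length ds"
    then show "var i * a k \<in> homog n (j + 1 - ds ! k)"
      using homog_var[OF that free_partD(1)[OF a, of k]] by (simp add: algebra_simps)
  qed (use free_partD(2)[OF a] in simp)
qed

text \<open>The polynomial ring is the box with corner 0 and no confined variable; the excluded case
  \<open>p = 0\<close>, \<open>j = 0\<close> carries the constants.\<close>

lemma koszul_zero_homog:
  assumes "0 < p \<or> j \<noteq> 0"
  shows "koszul_zero n vmult (homog n :: int \<Rightarrow> 'k::field mpoly set) (\<lambda>_. {0}) p j"
proof -
  have b: "box n (\<lambda>_. 0) {} = exps n" by (auto simp: box_def le_fun_def)
  have m: "mon_part n {} = (\<lambda>_. {0 :: 'k mpoly})"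
    by (auto simp: fun_eq_iff mon_part_iff intro!: poly_mapping_eqI)
  have "koszul_zero n vmult (mon_part n ({} \<union> exps n) :: int \<Rightarrow> 'k mpoly set) (mon_part n {}) p j"
  proof (rule koszul_zero_box[where \<sigma> = "\<lambda>_. 0" and Z = "{}"])
    show "j - int p \<noteq> int (\<Sum>i = 1..n. 0) \<or> card {} < p" using assms by auto
  qed (auto simp: b upset_exps upset_def exps_def)
  then show ?thesis by (simp add: m mon_part_exps)
qed

lemma kdiff_apply:
  fixes c :: "nat set \<Rightarrow> 'k::field fvec"
  shows "kdiff n fmult c S k = kdiff n vmult (\<lambda>S. c S k) S"
proof -
  have "ksign i S (v :: 'k fvec) k = ksign i S (v k)" for i v by (simp add: ksign_def)
  moreover have "sum f I k = (\<Sum>i\<in>I. f i k)" for f :: "nat \<Rightarrow> 'k fvec" and I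
    by (induction I rule: infinite_finite_induct) auto
  ultimately show ?thesis by (simp add: kdiff_def)
qed

text \<open>Each coordinate is a Koszul complex of a shifted polynomial ring, whose only homology
  consists of the constants at \<open>p = 0\<close>; \<open>p0\<close> excludes these.\<close>

lemma koszul_exact_free:
  fixes c :: "nat set \<Rightarrow> 'k::field fvec"
  assumes c: "c \<in> kchain n (free_part n ds) p j" and dc: "\<And>S. kdiff n fmult c S = 0"
    and p0: "p = 0 \<Longrightarrow> \<forall>k<length ds. Poly_Mapping.lookup (c {} k) 0 = 0"
  shows "\<exists>e\<in>kchain n (free_part n ds) (Suc p) j. \<forall>S. c S = kdiff n fmult e S"
proof -
  have cF: "c S \<in> free_part n ds (j - int p)" for S by (rule Fm.kchain_in[OF graded_sub_free_part c])
  have "\<exists>e. e \<in> kchain n (homog n) (Suc p) (j - ds ! k) \<and> (\<forall>S. c S k = kdiff n vmult e S)"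
    if k: "k < length ds" for k
  proof -
    have ck: "(\<lambda>S. c S k) \<in> kchain n (homog n) p (j - ds ! k)"
    proof (rule R.kchainI)
      fix S show "c S k \<in> homog n (j - ds ! k - int p)"
        using free_partD(1)[OF cF k, of S] by (simp add: algebra_simps)
    qed (use Fm.kchain_zero[OF c] in auto)
    have dk: "kdiff n vmult (\<lambda>S. c S k) S = 0" for S using dc[of S] kdiff_apply[of n c S k] by simp
    show ?thesis
    proof (cases "0 < p \<or> j - ds ! k \<noteq> 0")
      case True
      then show ?thesis
        using koszul_zero_homog[OF True, of n, where ?'k = 'k] ck dk unfolding koszul_zero_def by auto
    next
      case False
      have "c S k = 0" for S
      proof (cases "S = {}")
        case True
        have "c {} k \<in> homog n 0" using free_partD(1)[OF cF k, of "{}"] False by simp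
        then show ?thesis using homog_zero_degree[of "c {} k" n] p0 False k True by simp
      next
        case neq: False
        then have "\<not> (S \<subseteq> {1..n} \<and> card S = p)" using False finite_subset[of S "{1..n}"] by auto
        then show ?thesis using Fm.kchain_zero[OF c] by simp
      qed
      moreover have "(\<lambda>_. 0) \<in> kchain n (homog n :: int \<Rightarrow> 'k mpoly set) (Suc p) (j - ds ! k)"
        by (rule R.kchainI) (simp_all add: homog_zero)
      ultimately show ?thesis by (intro exI[of _ "\<lambda>_. 0"]) (simp add: R.kdiff_zero)
    qed
  qed
  then obtain e where e: "\<And>k. k < length ds \<Longrightarrow> e k \<in> kchain n (homog n) (Suc p) (j - ds ! k)"
      "\<And>k S. k < length ds \<Longrightarrow> c S k = kdiff n vmult (e k) S"
    by metis
  define E where "E = (\<lambda>S k. if k < length ds then e k S else 0)"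
  have "E \<in> kchain n (free_part n ds) (Suc p) j"
  proof (rule Fm.kchainI)
    fix S
    show "E S \<in> free_part n ds (j - int (Suc p))"
    proof (rule free_partI)
      fix k assume k: "k < length ds"
      show "E S k \<in> homog n (j - int (Suc p) - ds ! k)"
        using R.kchain_in[OF graded_sub_homog e(1)[OF k], of S] k by (simp add: E_def algebra_simps)
    qed (simp add: E_def)
    show "E S = 0" if "\<not> (S \<subseteq> {1..n} \<and> card S = Suc p)"
      using R.kchain_zero[OF e(1) that] by (auto simp: E_def fun_eq_iff)
  qed
  moreover have "c S = kdiff n fmult E S" for S
  proof
    fix k
    show "c S k = kdiff n fmult E S k"
    proof (cases "k < length ds")
      case True
      then show ?thesis using e(2)[OF True] by (simp add: kdiff_apply E_def)
    next
      case False
      then show ?thesis using free_partD(2)[OF cF False] by (simp add: kdiff_apply E_def R.kdiff_zero)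
    qed
  qed
  ultimately show ?thesis by blast
qed

lemma koszul_zero_free:
  assumes "0 < p"
  shows "koszul_zero n fmult (free_part n ds :: int \<Rightarrow> 'k::field fvec set) (\<lambda>_. {0}) p j"
  unfolding koszul_zero_def
proof (intro ballI impI)
  fix c :: "nat set \<Rightarrow> 'k fvec"
  assume "c \<in> kchain n (free_part n ds) p j" "\<forall>S. kdiff n fmult c S \<in> {0}"
  then have "\<exists>e\<in>kchain n (free_part n ds) (Suc p) j. \<forall>S. c S = kdiff n fmult e S"
    using assms by (intro koszul_exact_free) auto
  then show "\<exists>e\<in>kchain n (free_part n ds) (Suc p) j. \<forall>S. c S - kdiff n fmult e S \<in> {0}" by simp
qed

definition unit_vec :: "nat \<Rightarrow> 'k::field fvec" where
  "unit_vec k = (\<lambda>l. if l = k then 1 else 0)"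

lemma one_homog: "1 \<in> homog n 0"
  by (auto simp: homog_iff lookup_one when_def exps_def monom_deg_def)

lemma unit_vec_free: "k < length ds \<Longrightarrow> unit_vec k \<in> free_part n ds (ds ! k)"
  by (rule free_partI) (auto simp: unit_vec_def homog_zero one_homog)

section \<open>Minimal covers and the degrees of generators\<close>

text \<open>Vanishing constant coefficients express that the kernel lies in \<open>\<mm>F\<close>,
  with \<mm> the irrelevant ideal.\<close>

locale minimal_cover = koszul_cover n fmult Y "free_part n ds" A B f
  for n and Y :: "nat \<Rightarrow> 'w::ab_group_add \<Rightarrow> 'w" and ds A B and f :: "'k::field fvec \<Rightarrow> 'w" +
  assumes minimal: "v \<in> K j \<Longrightarrow> k < length ds \<Longrightarrow> Poly_Mapping.lookup (v k) 0 = 0"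
begin

text \<open>For \<open>p > 0\<close> this needs only the acyclicity of free modules. Minimality
  extends it to \<open>p = 0\<close>: kernel elements lie in \<open>\<mm>F\<close> and hence bound
  in \<open>F\<close>.\<close>

lemma koszul_zero_K: "koszul_zero n fmult K (\<lambda>_. {0}) p j \<longleftrightarrow> koszul_zero n Y A B (Suc p) j"
proof
  assume "koszul_zero n Y A B (Suc p) j"
  then show "koszul_zero n fmult K (\<lambda>_. {0}) p j"
  proof (rule koszul_zero_kernel)
    fix c assume c: "c \<in> kchain n K p j" and dc: "\<And>S. kdiff n fmult c S = 0"
    have "c \<in> kchain n (free_part n ds) p j"
      using c Fm.kchain_mono[of K "free_part n ds"] by (auto simp: K_def)
    then show "\<exists>e\<in>kchain n (free_part n ds) (Suc p) j. \<forall>S. c S = kdiff n fmult e S"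
    proof (rule koszul_exact_free[OF _ dc])
      show "\<forall>k<length ds. Poly_Mapping.lookup (c {} k) 0 = 0"
        using minimal[OF F.kchain_in[OF graded_sub_K c]] by blast
    qed
  qed
next
  assume "koszul_zero n fmult K (\<lambda>_. {0}) p j"
  then show "koszul_zero n Y A B (Suc p) j"
    by (rule koszul_zero_cokernel) (rule koszul_zero_free, simp)
qed

text \<open>A graded Nakayama argument. If the image of a unit vector were a boundary, the unit
  vector minus a boundary would be a kernel element with constant coefficient 1. Conversely, in a
  degree missing from \<open>ds\<close> all constant coefficients vanish, so every element of
  \<open>F\<close> bounds, and so does its image.\<close>

lemma degree_iff: "j \<in> set ds \<longleftrightarrow> \<not> koszul_zero n Y A B 0 j"
proof
  assume "j \<in> set ds"
  then obtain k where k: "k < length ds" "ds ! k = j" by (auto simp: in_set_conv_nth)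
  have eF: "unit_vec k \<in> free_part n ds j" using unit_vec_free[OF k(1)] k(2) by simp
  show "\<not> koszul_zero n Y A B 0 j"
  proof
    assume van: "koszul_zero n Y A B 0 j"
    let ?c = "\<lambda>S :: nat set. if S = {} then f (unit_vec k) else 0"
    have c: "?c \<in> kchain n A 0 j"
    proof (rule A.kchainI)
      fix S :: "nat set" assume "S \<subseteq> {1..n}" "card S = 0"
      then have "S = {}" using finite_subset[of S "{1..n}"] by simp
      then show "?c S \<in> A (j - int 0)" using f_in[OF eF] by simp
    qed auto
    have "kdiff n Y ?c S = 0" for S by (simp add: kdiff_def A.X_zero)
    then obtain E where E: "E \<in> kchain n A (Suc 0) j" "\<And>S. ?c S - kdiff n Y E S \<in> B (j - int 0)"
      using van c A.graded_subD(1)[OF B] unfolding koszul_zero_def by (metis (no_types, lifting))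
    obtain E' where E': "E' \<in> kchain n (free_part n ds) (Suc 0) j" "\<And>S. E S - f (E' S) \<in> B (j - int (Suc 0))"
      using kchain_lift[OF E(1)] by blast
    have E'F: "E' S \<in> free_part n ds (j - int (Suc 0))" for S by (rule F.kchain_in[OF F E'(1)])
    have dE: "kdiff n fmult E' {} \<in> free_part n ds j"
      using F.kdiff_in[of "free_part n ds" E', OF F E'F, of "{}"] by simp
    have "f (unit_vec k - kdiff n fmult E' {}) = f (unit_vec k) - kdiff n Y (\<lambda>S. f (E' S)) {}"
      using f_diff[OF eF dE] kdiff_f[of E', OF E'F] by simp
    also have "\<dots> = (?c {} - kdiff n Y E {}) + kdiff n Y (\<lambda>S. E S - f (E' S)) {}"
      by (simp add: A.kdiff_diff)
    also have "\<dots> \<in> B j"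
    proof (rule A.graded_subD(4)[OF B])
      show "?c {} - kdiff n Y E {} \<in> B j" using E(2)[of "{}"] by simp
      show "kdiff n Y (\<lambda>S. E S - f (E' S)) {} \<in> B j"
        using A.kdiff_in[of B "\<lambda>S. E S - f (E' S)", OF B E'(2), of "{}"] by simp
    qed
    finally have "unit_vec k - kdiff n fmult E' {} \<in> K j"
      using F.graded_subD(2)[OF F eF dE] by (simp add: K_def)
    then have "Poly_Mapping.lookup ((unit_vec k - kdiff n fmult E' {}) k) 0 = 0"
      using minimal k(1) by blast
    moreover have "Poly_Mapping.lookup (kdiff n vmult (\<lambda>S. E' S k) {}) 0 = 0"
      by (simp add: lookup_kdiff)
    ultimately show False
      by (simp add: kdiff_apply unit_vec_def lookup_minus)
  qed
next
  assume nz: "\<not> koszul_zero n Y A B 0 j"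
  show "j \<in> set ds"
  proof (rule ccontr)
    assume j: "j \<notin> set ds"
    have "koszul_zero n Y A B 0 j"
      unfolding koszul_zero_def
    proof (intro ballI impI)
      fix c assume c: "c \<in> kchain n A 0 j"
      obtain c' where c': "c' \<in> kchain n (free_part n ds) 0 j" "\<And>S. c S - f (c' S) \<in> B (j - int 0)"
        using kchain_lift[OF c] by blast
      have "\<exists>e\<in>kchain n (free_part n ds) (Suc 0) j. \<forall>S. c' S = kdiff n fmult e S"
      proof (rule koszul_exact_free[OF c'(1)])
        show "kdiff n fmult c' S = 0" for S by (rule F.kdiff_zero_chain[OF c'(1)])
        show "\<forall>k<length ds. Poly_Mapping.lookup (c' {} k) 0 = 0"
        proof (intro allI impI)
          fix k assume k: "k < length ds"
          have "c' {} k \<in> homog n (j - ds ! k)"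
            using free_partD(1)[OF F.kchain_in[OF F c'(1)] k, of "{}"] by simp
          moreover have "j - ds ! k \<noteq> 0" using j k by (metis nth_mem right_minus_eq)
          ultimately show "Poly_Mapping.lookup (c' {} k) 0 = 0" by (rule homog_const_coeff)
        qed
      qed
      then obtain e where e: "e \<in> kchain n (free_part n ds) (Suc 0) j" "\<And>S. c' S = kdiff n fmult e S"
        by blast
      have "kdiff n Y (\<lambda>S. f (e S)) S = f (c' S)" for S
        using kdiff_f[of e, OF F.kchain_in[OF F e(1)]] e(2) by simp
      then have "\<forall>S. c S - kdiff n Y (\<lambda>S. f (e S)) S \<in> B (j - int 0)" using c'(2) by simp
      then show "\<exists>e\<in>kchain n A (Suc 0) j. \<forall>S. c S - kdiff n Y e S \<in> B (j - int 0)"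
        using kchain_f[OF e(1)] by blast
    qed
    then show False using nz by blast
  qed
qed

end

text \<open>\<open>\<K> i\<close> is the \<open>(i + 1)\<close>-st syzygy module, so each cover shifts the homological degree by one.\<close>

lemma resolution_degrees:
  fixes \<delta> :: "nat \<Rightarrow> 'k::field fvec \<Rightarrow> 'k fvec" and A B :: "int \<Rightarrow> 'k mpoly set"
  assumes f: "minimal_cover n vmult (ds 0) A B f"
    and K0: "\<K> 0 = koszul_cover.K (free_part n (ds 0)) B f"
    and \<delta>: "\<And>i. minimal_cover n fmult (ds (Suc i)) (\<K> i) (\<lambda>_. {0}) (\<delta> i)"
    and KS: "\<And>i. \<K> (Suc i) = koszul_cover.K (free_part n (ds (Suc i))) (\<lambda>_. {0}) (\<delta> i)"
  shows "j \<in> set (ds i) \<longleftrightarrow> \<not> koszul_zero n vmult A B i j"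
proof (cases i)
  case 0
  then show ?thesis using minimal_cover.degree_iff[OF f] by simp
next
  case (Suc i')
  have "koszul_zero n fmult (\<K> l) (\<lambda>_. {0}) p j \<longleftrightarrow> koszul_zero n vmult A B (Suc (l + p)) j" for l p
  proof (induction l arbitrary: p)
    case 0
    show ?case unfolding K0 using minimal_cover.koszul_zero_K[OF f, of p j] by (simp only: add_0)
  next
    case (Suc l)
    show ?case
      unfolding KS using minimal_cover.koszul_zero_K[OF \<delta>, of l p j] Suc[of "Suc p"]
      by (simp only: add_Suc add_Suc_right)
  qed
  from this[of i' 0] show ?thesis using minimal_cover.degree_iff[OF \<delta>, of j i'] Suc by simp
qed

section \<open>Existence of minimal covers\<close>

lemma fun_sum_apply: "sum f I k = (\<Sum>i\<in>I. f i k)" for f :: "'i \<Rightarrow> 'a \<Rightarrow> 'b::comm_monoid_add"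
  by (induction I rule: infinite_finite_induct) auto

section \<open>Homogeneous generation and finiteness\<close>

inductive hgen :: "nat \<Rightarrow> (int \<times> 'k::field fvec) set \<Rightarrow> int \<Rightarrow> 'k fvec \<Rightarrow> bool" for n G j where
  zero: "hgen n G j (\<lambda>_. 0)"
| step: "hgen n G j v \<Longrightarrow> (d, g) \<in> G \<Longrightarrow> p \<in> homog n (j - d) \<Longrightarrow> hgen n G j (\<lambda>k. v k + p * g k)"

lemma hgen_add:
  assumes "hgen n G j v" "hgen n G j w"
  shows "hgen n G j (\<lambda>k. v k + w k)"
  using assms(2)
proof induction
  case zero
  then show ?case using assms(1) by simp
next
  case (step w d g p)
  then have "hgen n G j (\<lambda>k. (v k + w k) + p * g k)" by (intro hgen.step)
  then show ?case by (simp add: add.assoc)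
qed

lemma hgen_mult:
  assumes "hgen n G j v" "a \<in> homog n i"
  shows "hgen n G (i + j) (\<lambda>k. a * v k)"
  using assms(1)
proof induction
  case zero
  then show ?case by (simp add: hgen.zero)
next
  case (step v d g p)
  have "a * p \<in> homog n (i + j - d)"
    using homog_mult[OF assms(2) step.hyps(3)] by (simp add: algebra_simps)
  then have "hgen n G (i + j) (\<lambda>k. a * v k + (a * p) * g k)"
    by (rule hgen.step[OF step.IH step.hyps(2)])
  then show ?case by (simp add: algebra_simps)
qed

lemma hgen_scale: "hgen n G j v \<Longrightarrow> hgen n G j (\<lambda>k. Poly_Mapping.single 0 a * v k)"
  using hgen_mult[OF _ homog_single_zero, of n G j v a] by simp

lemma hgen_mem: "(d, g) \<in> G \<Longrightarrow> hgen n G d g"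
  using hgen.step[OF hgen.zero, of d g G 1 n d] by (simp add: one_homog)

lemma hgen_sum: "(\<And>i. i \<in> I \<Longrightarrow> hgen n G j (f i)) \<Longrightarrow> hgen n G j (\<lambda>k. \<Sum>i\<in>I. f i k)"
  by (induction I rule: infinite_finite_induct) (auto simp: hgen.zero hgen_add)

lemma hgen_trans:
  assumes "hgen n G j v" "\<And>d g. (d, g) \<in> G \<Longrightarrow> hgen n H d g"
  shows "hgen n H j v"
  using assms(1)
proof induction
  case zero
  show ?case by (rule hgen.zero)
next
  case (step v d g p)
  have "hgen n H j (\<lambda>k. p * g k)"
    using hgen_mult[OF assms(2)[OF step.hyps(2)] step.hyps(3)] by simp
  then show ?case by (rule hgen_add[OF step.IH])
qed

definition graded_submodule :: "nat \<Rightarrow> (int \<Rightarrow> 'k::field fvec set) \<Rightarrow> bool" where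
  "graded_submodule n K \<longleftrightarrow> (\<forall>j. (\<lambda>_. 0) \<in> K j \<and> (\<forall>v\<in>K j. \<forall>w\<in>K j. (\<lambda>k. v k + w k) \<in> K j) \<and>
    (\<forall>v\<in>K j. \<forall>i. \<forall>a\<in>homog n i. (\<lambda>k. a * v k) \<in> K (i + j)))"

lemma graded_submoduleD:
  assumes "graded_submodule n K"
  shows "(\<lambda>_. 0) \<in> K j" "v \<in> K j \<Longrightarrow> w \<in> K j \<Longrightarrow> (\<lambda>k. v k + w k) \<in> K j"
    "v \<in> K j \<Longrightarrow> a \<in> homog n i \<Longrightarrow> (\<lambda>k. a * v k) \<in> K (i + j)"
  using assms unfolding graded_submodule_def by blast+

lemma graded_submodule_sum:
  assumes "graded_submodule n K" "\<And>i. i \<in> I \<Longrightarrow> f i \<in> K j"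
  shows "(\<lambda>k. \<Sum>i\<in>I. f i k) \<in> K j"
  using assms(2)
  by (induction I rule: infinite_finite_induct) (auto intro: graded_submoduleD[OF assms(1)])

lemma graded_submodule_graded_sub:
  assumes "graded_submodule n K"
  shows "Fm.graded_sub n K"
  unfolding Fm.graded_sub_def
proof (intro allI conjI ballI)
  fix j
  show "0 \<in> K j" using graded_submoduleD(1)[OF assms] by (simp add: zero_fun_def)
  fix v assume v: "v \<in> K j"
  show "v - w \<in> K j" if "w \<in> K j" for w
  proof -
    have "(\<lambda>k. - 1 * w k) \<in> K (0 + j)"
      by (rule graded_submoduleD(3)[OF assms that]) (rule homog_minus[OF one_homog])
    then have "(\<lambda>k. - 1 * w k) \<in> K j" by simp
    from graded_submoduleD(2)[OF assms v this] show ?thesis by (simp add: fun_diff_def)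
  qed
  show "fmult i v \<in> K (j + 1)" if "i \<in> {1..n}" for i
    using graded_submoduleD(3)[OF assms v homog_var_one[OF that]] by (simp add: add.commute)
qed

lemma finite_monomials: "finite {m. Poly_Mapping.lookup m \<in> exps n \<and> int (monom_deg m) = e}"
proof -
  let ?M = "{m. Poly_Mapping.lookup m \<in> exps n \<and> int (monom_deg m) = e}"
  let ?F = "{b. \<forall>x. (x \<in> {1..n} \<longrightarrow> b x \<in> {0..nat e}) \<and> (x \<notin> {1..n} \<longrightarrow> b x = 0)}"
  have "Poly_Mapping.lookup ` ?M \<subseteq> ?F"
  proof (intro subsetI, elim imageE)
    fix b m assume b: "b = Poly_Mapping.lookup m" and m: "m \<in> ?M"
    have "Poly_Mapping.lookup m x \<le> nat e" if "x \<in> {1..n}" for x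
    proof -
      have "Poly_Mapping.lookup m x \<le> (\<Sum>i=1..n. Poly_Mapping.lookup m i)"
        by (rule member_le_sum) (use that in auto)
      also have "\<dots> = monom_deg m" using m monom_deg_eq[of m n] by simp
      also have "\<dots> = nat e" using m by auto
      finally show ?thesis .
    qed
    then show "b \<in> ?F" using m by (auto simp: b exps_def)
  qed
  moreover have "finite ?F" by (rule finite_set_of_finite_funs) auto
  ultimately have "finite (Poly_Mapping.lookup ` ?M)" by (rule finite_subset)
  then show ?thesis by (rule finite_imageD) (auto simp: inj_on_def intro: poly_mapping_eqI)
qed

lemma homog_negative: "p \<in> homog n j \<Longrightarrow> j < 0 \<Longrightarrow> p = 0"
  by (rule poly_mapping_eqI) (use homogD(2) in fastforce)

text \<open>A single degree of a free module is a finite-dimensional vector space. The quantifier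
  over \<open>G\<close> allows bases of different degrees to be merged into one generating
  set.\<close>

lemma finite_spanning_part:
  fixes K :: "'k::field fvec set"
  assumes "K \<subseteq> free_part n ds d"
  shows "\<exists>B. finite B \<and> B \<subseteq> K \<and> (\<forall>G. (\<forall>g\<in>B. (d, g) \<in> G) \<longrightarrow> (\<forall>v\<in>K. hgen n G d v))"
proof -
  let ?sc = "\<lambda>(a::'k) (v::'k fvec) k. Poly_Mapping.single 0 a * v k"
  interpret VS: vector_space ?sc
    by unfold_locales
      (auto simp: fun_eq_iff distrib_left distrib_right single_add mult_single mult.assoc[symmetric])
  let ?M = "\<lambda>k. {m. Poly_Mapping.lookup m \<in> exps n \<and> int (monom_deg m) = d - ds ! k}"
  let ?e = "\<lambda>(k, m) l. if l = k then Poly_Mapping.single m (1::'k) else 0"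
  let ?I = "SIGMA k:{..<length ds}. ?M k"
  have finT: "finite (?e ` ?I)" using finite_monomials by (intro finite_imageI finite_SigmaI) auto
  have KT: "K \<subseteq> VS.span (?e ` ?I)"
  proof
    fix v assume "v \<in> K"
    then have v: "v \<in> free_part n ds d" using assms by blast
    have "v = (\<Sum>x\<in>?I. ?sc (Poly_Mapping.lookup (v (fst x)) (snd x)) (?e x))"
    proof
      fix l
      show "v l = (\<Sum>x\<in>?I. ?sc (Poly_Mapping.lookup (v (fst x)) (snd x)) (?e x)) l"
      proof (rule poly_mapping_eqI)
        fix y
        have fI: "finite ?I" using finite_monomials by (intro finite_SigmaI) auto
        have "Poly_Mapping.lookup ((\<Sum>x\<in>?I. ?sc (Poly_Mapping.lookup (v (fst x)) (snd x)) (?e x)) l) y =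
            (\<Sum>x\<in>?I. if x = (l, y) then Poly_Mapping.lookup (v l) y else 0)"
          unfolding fun_sum_apply lookup_sum
          by (rule sum.cong) (auto simp: mult_single lookup_single when_def split: if_splits)
        also have "\<dots> = (if (l, y) \<in> ?I then Poly_Mapping.lookup (v l) y else 0)"
          using fI by (simp add: sum.delta)
        also have "\<dots> = Poly_Mapping.lookup (v l) y"
        proof (cases "Poly_Mapping.lookup (v l) y = 0")
          case False
          then have "l < length ds" using free_partD(2)[OF v, of l] by (metis lookup_zero)
          then show ?thesis using homogD[OF free_partD(1)[OF v, of l] False] by simp
        qed simp
        finally show "Poly_Mapping.lookup (v l) y =
          Poly_Mapping.lookup ((\<Sum>x\<in>?I. ?sc (Poly_Mapping.lookup (v (fst x)) (snd x)) (?e x)) l) y" by simp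
      qed
    qed
    moreover have "(\<Sum>x\<in>?I. ?sc (Poly_Mapping.lookup (v (fst x)) (snd x)) (?e x)) \<in> VS.span (?e ` ?I)"
      by (intro VS.span_sum VS.span_scale VS.span_base imageI)
    ultimately show "v \<in> VS.span (?e ` ?I)" by simp
  qed
  obtain B where B: "B \<subseteq> K" "VS.independent B" "K \<subseteq> VS.span B"
    using VS.maximal_independent_subset[of K] by blast
  have "finite B" using VS.independent_span_bound[OF finT B(2)] B(1) KT by blast
  moreover have "hgen n G d v" if G: "\<forall>g\<in>B. (d, g) \<in> G" and v: "v \<in> K" for G v
  proof -
    have "VS.subspace {v. hgen n G d v}"
      unfolding VS.subspace_def
      by (auto simp: zero_fun_def plus_fun_def hgen.zero hgen_add hgen_scale)
    moreover have "B \<subseteq> {v. hgen n G d v}" using G hgen_mem by blast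
    ultimately show ?thesis using VS.span_minimal[of B "{v. hgen n G d v}"] B(3) v by blast
  qed
  ultimately show ?thesis using B(1) by blast
qed

text \<open>\<open>H\<^sub>0\<close> is \<open>K/\<mm>K\<close>; its vanishing above
  \<open>b\<close> means that elements of degree beyond \<open>b\<close> are combinations of
  variables times elements one degree lower. Below the bound \<open>lo\<close> of the shifts
  everything is zero, so finitely many finite-dimensional degrees generate.\<close>

lemma finite_generation:
  fixes K :: "int \<Rightarrow> 'k::field fvec set"
  assumes K: "graded_submodule n K" and KF: "\<And>j. K j \<subseteq> free_part n ds j"
    and van: "\<And>j. b < j \<Longrightarrow> koszul_zero n fmult K (\<lambda>_. {0}) 0 j"
  shows "\<exists>G. finite G \<and> (\<forall>(d, g)\<in>G. g \<in> K d) \<and> (\<forall>j. \<forall>v\<in>K j. hgen n G j v)"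
proof -
  obtain lo where lo: "\<And>k. k < length ds \<Longrightarrow> lo \<le> ds ! k"
    by (metis Min_le List.finite_set nth_mem)
  have "\<exists>B. finite B \<and> B \<subseteq> K d \<and> (\<forall>G. (\<forall>g\<in>B. (d, g) \<in> G) \<longrightarrow> (\<forall>v\<in>K d. hgen n G d v))" for d
    by (rule finite_spanning_part[OF KF])
  then obtain B where B: "\<And>d. finite (B d)" "\<And>d. B d \<subseteq> K d"
      "\<And>d G v. (\<forall>g\<in>B d. (d, g) \<in> G) \<Longrightarrow> v \<in> K d \<Longrightarrow> hgen n G d v" by metis
  define G where "G = (SIGMA d:{lo..b}. B d)"
  have "hgen n G j v" if "v \<in> K j" for j v
    using that
  proof (induction "nat (j - b)" arbitrary: j v)
    case 0
    show ?case
    proof (cases "lo \<le> j")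
      case True
      then show ?thesis using 0 by (intro B(3)) (auto simp: G_def)
    next
      case False
      have "v k = 0" for k
      proof (cases "k < length ds")
        case True
        then show ?thesis
          using homog_negative[OF free_partD(1)[of v n ds j k]] KF 0 lo[OF True] False by fastforce
      next
        case f: False
        then show ?thesis using free_partD(2)[of v n ds j k] KF 0 by blast
      qed
      then have "v = (\<lambda>_. 0)" by (simp add: fun_eq_iff)
      then show ?thesis by (simp add: hgen.zero)
    qed
  next
    case (Suc m)
    then have jb: "b < j" by linarith
    let ?c = "\<lambda>S :: nat set. if S = {} then v else 0"
    have c: "?c \<in> kchain n K 0 j"
    proof (rule Fm.kchainI)
      fix S :: "nat set" assume "S \<subseteq> {1..n}" "card S = 0"
      then have "S = {}" using finite_subset[of S "{1..n}"] by simp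
      then show "?c S \<in> K (j - int 0)" using Suc.prems by simp
    qed auto
    have "kdiff n fmult ?c S \<in> {0}" for S using Fm.kdiff_zero_chain[OF c] by simp
    then obtain E where E: "E \<in> kchain n K (Suc 0) j" "\<forall>S. ?c S - kdiff n fmult E S \<in> {0}"
      using van[OF jb] c unfolding koszul_zero_def by blast
    have "v = kdiff n fmult E {}" using spec[OF E(2), of "{}"] by simp
    also have "\<dots> = (\<lambda>k. \<Sum>i\<in>{1..n}. var i * E {i} k)"
      by (rule ext) (simp add: kdiff_def fun_sum_apply ksign_def)
    finally have v: "v = (\<lambda>k. \<Sum>i\<in>{1..n}. var i * E {i} k)" .
    have "hgen n G j (\<lambda>k. var i * E {i} k)" if i: "i \<in> {1..n}" for i
    proof -
      have "E {i} \<in> K (j - 1)"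
        using Fm.kchain_in[OF graded_submodule_graded_sub[OF K] E(1), of "{i}"] by simp
      then have "hgen n G (j - 1) (E {i})" using Suc.hyps by (intro Suc.hyps(1)) auto
      from hgen_mult[OF this homog_var_one[OF i]] show ?thesis by simp
    qed
    then show ?case unfolding v by (rule hgen_sum)
  qed
  moreover have "finite G" unfolding G_def using B(1) by (intro finite_SigmaI) auto
  moreover have "\<forall>(d, g)\<in>G. g \<in> K d" using B(2) by (auto simp: G_def)
  ultimately show ?thesis by blast
qed

section \<open>Covers built from generating sets\<close>

definition lincomb :: "(int \<times> 'k::field fvec) list \<Rightarrow> 'k fvec \<Rightarrow> 'k fvec" where
  "lincomb L v = (\<lambda>l. \<Sum>k<length L. v k * snd (L ! k) l)"

lemma lincomb_add: "lincomb L (v + w) = lincomb L v + lincomb L w"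
  by (auto simp: lincomb_def fun_eq_iff distrib_right sum.distrib)

lemma lincomb_scale: "lincomb L (\<lambda>k. a * v k) = (\<lambda>l. a * lincomb L v l)"
  by (auto simp: lincomb_def fun_eq_iff sum_distrib_left mult.assoc)

lemma lincomb_unit: "k < length L \<Longrightarrow> lincomb L (\<lambda>l. if l = k then p else 0) = (\<lambda>l. p * snd (L ! k) l)"
  by (auto simp: lincomb_def fun_eq_iff if_distrib[of "\<lambda>x. x * _"] cong: if_cong)

lemma hgen_lincomb:
  assumes "hgen n (set L) j a"
  shows "\<exists>v\<in>free_part n (map fst L) j. lincomb L v = a"
  using assms
proof induction
  case zero
  show ?case
    by (rule bexI[of _ "\<lambda>_. 0"]) (auto simp: lincomb_def homog_zero intro: free_partI)
next
  case (step a d g p)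
  then obtain v where v: "v \<in> free_part n (map fst L) j" "lincomb L v = a" by blast
  obtain k where k: "k < length L" "L ! k = (d, g)" using step.hyps(2) by (auto simp: in_set_conv_nth)
  let ?e = "\<lambda>l. if l = k then p else 0"
  have e: "?e \<in> free_part n (map fst L) j"
    by (rule free_partI) (use step.hyps(3) k in \<open>auto simp: homog_zero\<close>)
  have "v + ?e \<in> free_part n (map fst L) j"
    by (rule Fm.graded_subD(4)[OF graded_sub_free_part v(1) e])
  moreover have "lincomb L (v + ?e) = (\<lambda>l. a l + p * g l)"
    unfolding lincomb_add lincomb_unit[OF k(1)] v(2) k(2) by (simp add: plus_fun_def)
  ultimately show ?case by blast
qed

lemma lincomb_in:
  assumes K: "graded_submodule n K" and L: "\<And>k. k < length L \<Longrightarrow> snd (L ! k) \<in> K (fst (L ! k))"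
    and v: "v \<in> free_part n (map fst L) j"
  shows "lincomb L v \<in> K j"
  unfolding lincomb_def
proof (rule graded_submodule_sum[OF K])
  fix k assume k: "k \<in> {..<length L}"
  then have "v k \<in> homog n (j - fst (L ! k))" using free_partD(1)[OF v, of k] by simp
  from graded_submoduleD(3)[OF K L[of k] this] k
  show "(\<lambda>l. v k * snd (L ! k) l) \<in> K j" by simp
qed

text \<open>A generating set of least cardinality has no relation with a nonzero constant coefficient,
  since such a relation makes a generator redundant.\<close>

lemma minimal_cover_exists:
  fixes K :: "int \<Rightarrow> 'k::field fvec set"
  assumes K: "graded_submodule n K" and KF: "\<And>j. K j \<subseteq> free_part n ds j"
    and van: "\<And>j. b < j \<Longrightarrow> koszul_zero n fmult K (\<lambda>_. {0}) 0 j"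
  shows "\<exists>L. minimal_cover n fmult (map fst L) K (\<lambda>_. {0}) (lincomb L)"
proof -
  define P where "P = (\<lambda>G. finite G \<and> (\<forall>(d, g)\<in>G. g \<in> K d) \<and> (\<forall>j. \<forall>v\<in>K j. hgen n G j v))"
  have "\<exists>G. P G" unfolding P_def
    by (rule finite_generation[where ds = ds and b = b]) (fact K, fact KF, fact van)
  then have "\<exists>G. P G \<and> (\<forall>H. P H \<longrightarrow> card G \<le> card H)"
    by (elim exE) (rule ex_has_least_nat)
  then obtain G where PG: "P G" and least: "\<And>H. P H \<Longrightarrow> card G \<le> card H" by blast
  have G: "finite G" "\<And>d g. (d, g) \<in> G \<Longrightarrow> g \<in> K d" "\<And>j v. v \<in> K j \<Longrightarrow> hgen n G j v"
    using PG unfolding P_def by blast+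
  obtain L where L: "set L = G" "distinct L" using finite_distinct_list[OF G(1)] by blast
  have LK: "snd (L ! k) \<in> K (fst (L ! k))" if "k < length L" for k
    using G(2)[of "fst (L ! k)" "snd (L ! k)"] L(1) nth_mem[OF that] by simp
  have cover: "koszul_cover n fmult fmult (free_part n (map fst L)) K (\<lambda>_. {0}) (lincomb L)"
  proof (unfold_locales)
    show "Fm.graded_sub n (free_part n (map fst L))" by (rule graded_sub_free_part)
    show "Fm.graded_sub n K" by (rule graded_submodule_graded_sub[OF K])
    show "Fm.graded_sub n (\<lambda>_. {0})" by (rule Fm.graded_sub_zero)
    show "{0} \<subseteq> K j" for j using graded_submoduleD(1)[OF K] by (simp add: zero_fun_def)
    show "lincomb L v \<in> K j" if "v \<in> free_part n (map fst L) j" for v j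
      by (rule lincomb_in[OF K LK that])
    show "lincomb L (v + w) = lincomb L v + lincomb L w" for v w by (rule lincomb_add)
    show "lincomb L (fmult i v) = fmult i (lincomb L v)" for i v by (rule lincomb_scale)
    show "\<exists>v\<in>free_part n (map fst L) j. a - lincomb L v \<in> {0}" if "a \<in> K j" for a j
    proof -
      have "hgen n (set L) j a" using G(3)[OF that] L(1) by simp
      from hgen_lincomb[OF this] show ?thesis by force
    qed
  qed
  interpret koszul_cover n fmult fmult "free_part n (map fst L)" K "\<lambda>_. {0}" "lincomb L" by (rule cover)
  have "minimal_cover n fmult (map fst L) K (\<lambda>_. {0}) (lincomb L)"
  proof (intro minimal_cover.intro cover minimal_cover_axioms.intro)
    fix v j k assume v: "v \<in> koszul_cover.K (free_part n (map fst L)) (\<lambda>_. {0}) (lincomb L) j"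
      and k': "k < length (map fst L)"
    have k: "k < length L" using k' by simp
    have vF: "v \<in> free_part n (map fst L) j" and v0: "lincomb L v = 0" using v by (auto simp: K_def)
    show "Poly_Mapping.lookup (v k) 0 = 0"
    proof (rule ccontr)
      assume nz: "Poly_Mapping.lookup (v k) 0 \<noteq> 0"
      define a where "a = Poly_Mapping.lookup (v k) 0"
      define d g where "d = fst (L ! k)" and "g = snd (L ! k)"
      have vk: "v k \<in> homog n (j - d)" using free_partD(1)[OF vF, of k] k by (simp add: d_def)
      \<comment> \<open>A nonzero constant coefficient forces the relation into the degree of
        \<open>g\<close>, so this coordinate is a nonzero scalar and the relation can be solved for
        \<open>g\<close>.\<close>
      then have j: "j = d" using homog_const_coeff[OF vk] nz by auto
      then have vk1: "v k = Poly_Mapping.single 0 a" using vk homog_zero_degree[of "v k" n] by (simp add: a_def)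
      let ?H = "G - {(d, g)}"
      have mem: "(d, g) \<in> G" using L(1) nth_mem[OF k] by (simp add: d_def g_def)
      have rest: "hgen n ?H d (\<lambda>l. \<Sum>i\<in>{..<length L} - {k}. v i * snd (L ! i) l)"
      proof (rule hgen_sum)
        fix i assume i: "i \<in> {..<length L} - {k}"
        then have "L ! i \<in> ?H"
          using L nth_mem[of i L] nth_eq_iff_index_eq[OF L(2), of i k] k by (auto simp: d_def g_def)
        then have "hgen n ?H (fst (L ! i)) (snd (L ! i))" by (intro hgen_mem) simp
        moreover have "v i \<in> homog n (d - fst (L ! i))" using free_partD(1)[OF vF, of i] i j by simp
        ultimately have "hgen n ?H (d - fst (L ! i) + fst (L ! i)) (\<lambda>l. v i * snd (L ! i) l)" by (rule hgen_mult)
        then show "hgen n ?H d (\<lambda>l. v i * snd (L ! i) l)" by simp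
      qed
      have "Poly_Mapping.single 0 a * g l = - (\<Sum>i\<in>{..<length L} - {k}. v i * snd (L ! i) l)" for l
      proof -
        have "(\<Sum>i<length L. v i * snd (L ! i) l) = 0" using fun_cong[OF v0, of l] by (simp add: lincomb_def)
        then show ?thesis
          using k by (simp add: sum.remove[of "{..<length L}" k] vk1 g_def eq_neg_iff_add_eq_0)
      qed
      then have "Poly_Mapping.single 0 (- inverse a) * (\<Sum>i\<in>{..<length L} - {k}. v i * snd (L ! i) l) =
          (Poly_Mapping.single 0 (inverse a) * Poly_Mapping.single 0 a) * g l" for l
        by (simp add: single_uminus mult.assoc)
      then have "(\<lambda>l. Poly_Mapping.single 0 (- inverse a) * (\<Sum>i\<in>{..<length L} - {k}. v i * snd (L ! i) l)) = g"
        using nz by (auto simp: mult_single a_def fun_eq_iff)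
      then have gH: "hgen n ?H d g" using hgen_scale[OF rest, of "- inverse a"] by simp
      have "hgen n ?H j' w" if "w \<in> K j'" for j' w
      proof (rule hgen_trans)
        show "hgen n G j' w" by (rule G(3)[OF that])
        show "hgen n ?H d' g'" if "(d', g') \<in> G" for d' g'
          using that gH hgen_mem[of d' g' ?H n] by (cases "(d', g') = (d, g)") auto
      qed
      then have "P ?H" unfolding P_def using G(1,2) by blast
      then have "card G \<le> card ?H" by (rule least)
      then show False using card_Diff1_less[OF G(1) mem] by linarith
    qed
  qed
  then show ?thesis by blast
qed

lemma graded_submodule_kernel:
  fixes A :: "int \<Rightarrow> 'k::field fvec set"
  assumes "minimal_cover n fmult (map fst L) A (\<lambda>_. {0}) (lincomb L)"
  shows "graded_submodule n (koszul_cover.K (free_part n (map fst L)) (\<lambda>_. {0}) (lincomb L))"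
proof -
  interpret minimal_cover n fmult "map fst L" A "\<lambda>_. {0}" "lincomb L" by (rule assms)
  show ?thesis
    unfolding graded_submodule_def
  proof (intro allI conjI ballI)
    fix j
    have z: "(\<lambda>_. 0) = (0 :: 'k fvec)" by (simp add: zero_fun_def)
    show "(\<lambda>_. 0) \<in> K j" unfolding z by (rule Fm.graded_subD(1)[OF graded_sub_K])
    fix v assume v: "v \<in> K j"
    show "(\<lambda>k. v k + w k) \<in> K j" if "w \<in> K j" for w
      using Fm.graded_subD(4)[OF graded_sub_K v that] unfolding plus_fun_def .
    fix i and a :: "'k mpoly" assume a: "a \<in> homog n i"
    have vF: "v \<in> free_part n (map fst L) j" and v0: "lincomb L v = 0" using v by (auto simp: K_def)
    have "(\<lambda>k. a * v k) \<in> free_part n (map fst L) (i + j)"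
    proof (rule free_partI)
      fix k assume "k < length (map fst L)"
      from homog_mult[OF a free_partD(1)[OF vF this]]
      show "a * v k \<in> homog n (i + j - map fst L ! k)" by (simp add: algebra_simps)
    qed (use free_partD(2)[OF vF] in simp)
    moreover have "lincomb L (\<lambda>k. a * v k) = 0" by (simp add: lincomb_scale v0 zero_fun_def)
    ultimately show "(\<lambda>k. a * v k) \<in> K (i + j)" unfolding K_def by blast
  qed
qed

lemma resolution_exists:
  fixes K0 :: "int \<Rightarrow> 'k::field fvec set"
  assumes K0: "graded_submodule n K0" "\<And>j. K0 j \<subseteq> free_part n ds0 j"
    and van: "\<And>p j. b < j - int p \<Longrightarrow> koszul_zero n fmult K0 (\<lambda>_. {0}) p j"
  shows "\<exists>ds \<K> L. ds 0 = ds0 \<and> \<K> 0 = K0 \<and>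
    (\<forall>i. graded_submodule n (\<K> i) \<and> (\<forall>j. \<K> i j \<subseteq> free_part n (ds i) j) \<and>
      ds (Suc i) = map fst (L i) \<and> minimal_cover n fmult (ds (Suc i)) (\<K> i) (\<lambda>_. {0}) (lincomb (L i)) \<and>
      \<K> (Suc i) = koszul_cover.K (free_part n (ds (Suc i))) (\<lambda>_. {0}) (lincomb (L i)))"
proof -
  \<comment> \<open>The bound on \<open>j - p\<close> grows by 1 with each syzygy module: homology
    of the kernel at \<open>p\<close> is homology of the covered module at \<open>p + 1\<close>, in
    the same internal degree. Boundedness therefore persists and the next cover exists.\<close>
  define P where "P = (\<lambda>i :: nat. \<lambda>(ds, K :: int \<Rightarrow> 'k fvec set). (i = 0 \<longrightarrow> ds = ds0 \<and> K = K0) \<and>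
    graded_submodule n K \<and> (\<forall>j. K j \<subseteq> free_part n ds j) \<and>
    (\<forall>p j. b + int i < j - int p \<longrightarrow> koszul_zero n fmult K (\<lambda>_. {0}) p j))"
  define Q where "Q = (\<lambda>(ds :: int list, K) (ds', K'). \<exists>L. ds' = map fst L \<and>
    minimal_cover n fmult ds' K (\<lambda>_. {0 :: 'k fvec}) (lincomb L) \<and>
    K' = koszul_cover.K (free_part n ds') (\<lambda>_. {0}) (lincomb L))"
  have "\<exists>f. \<forall>i. P i (f i) \<and> Q (f i) (f (Suc i))"
  proof (rule dependent_nat_choice)
    show "\<exists>x. P 0 x" using K0 van by (intro exI[of _ "(ds0, K0)"]) (simp add: P_def)
    fix x i assume x: "P i x"
    obtain ds K where xe: "x = (ds, K)" by fastforce
    have K: "graded_submodule n K" "\<And>j. K j \<subseteq> free_part n ds j"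
      "\<And>p j. b + int i < j - int p \<Longrightarrow> koszul_zero n fmult K (\<lambda>_. {0}) p j"
      using x by (auto simp: P_def xe)
    have "koszul_zero n fmult K (\<lambda>_. {0}) 0 j" if "b + int i < j" for j using K(3)[of j 0] that by simp
    from minimal_cover_exists[OF K(1,2) this]
    obtain L where L: "minimal_cover n fmult (map fst L) K (\<lambda>_. {0}) (lincomb L)" by blast
    interpret M: minimal_cover n fmult "map fst L" K "\<lambda>_. {0}" "lincomb L" by (rule L)
    have "P (Suc i) (map fst L, M.K)"
      using graded_submodule_kernel[OF L] M.koszul_zero_K K(3) by (auto simp: P_def M.K_def)
    moreover have "Q x (map fst L, M.K)" using L by (auto simp: Q_def xe)
    ultimately show "\<exists>y. P (Suc i) y \<and> Q x y" by blast
  qed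
  then obtain f where f: "\<And>i. P i (f i)" "\<And>i. Q (f i) (f (Suc i))" by blast
  have "\<forall>i. \<exists>L. fst (f (Suc i)) = map fst L \<and>
      minimal_cover n fmult (fst (f (Suc i))) (snd (f i)) (\<lambda>_. {0}) (lincomb L) \<and>
      snd (f (Suc i)) = koszul_cover.K (free_part n (fst (f (Suc i)))) (\<lambda>_. {0}) (lincomb L)"
    using f(2) by (simp add: Q_def case_prod_unfold)
  then obtain L where L: "\<And>i. fst (f (Suc i)) = map fst (L i) \<and>
      minimal_cover n fmult (fst (f (Suc i))) (snd (f i)) (\<lambda>_. {0}) (lincomb (L i)) \<and>
      snd (f (Suc i)) = koszul_cover.K (free_part n (fst (f (Suc i)))) (\<lambda>_. {0}) (lincomb (L i))"
    by metis
  have "fst (f 0) = ds0 \<and> snd (f 0) = K0" using f(1)[of 0] by (simp add: P_def case_prod_unfold)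
  moreover have "graded_submodule n (snd (f i)) \<and> (\<forall>j. snd (f i) j \<subseteq> free_part n (fst (f i)) j)" for i
    using f(1)[of i] by (simp add: P_def case_prod_unfold)
  ultimately show ?thesis
    using L by (intro exI[of _ "\<lambda>i. fst (f i)"] exI[of _ "\<lambda>i. snd (f i)"] exI[of _ L]) blast
qed

section \<open>Monomial ideals and powers of the path ideal\<close>

lemma poly_carrier_iff:
  "p \<in> carrier (poly_ring n) \<longleftrightarrow> (\<forall>m. Poly_Mapping.lookup p m \<noteq> 0 \<longrightarrow> Poly_Mapping.lookup m \<in> exps n)"
  unfolding poly_ring_def
  by (simp add: keys_subset_iff_exps del: One_nat_def) (metis in_keys_iff)

lemma poly_ring_simps [simp]:
  "zero (poly_ring n) = 0" "one (poly_ring n) = 1" "add (poly_ring n) = (+)" "mult (poly_ring n) = (*)"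
  by (simp_all add: poly_ring_def)

definition monomial_ideal :: "nat \<Rightarrow> (nat \<Rightarrow> nat) set \<Rightarrow> 'k::field mpoly set" where
  "monomial_ideal n U = {p. \<forall>m. Poly_Mapping.lookup p m \<noteq> 0 \<longrightarrow>
     Poly_Mapping.lookup m \<in> exps n \<and> Poly_Mapping.lookup m \<in> U}"

lemma monomial_ideal_exps: "monomial_ideal n (exps n) = carrier (poly_ring n)"
  by (auto simp: monomial_ideal_def poly_carrier_iff)

lemma monomial_ideal_carrier: "monomial_ideal n U \<subseteq> carrier (poly_ring n)"
  by (auto simp: monomial_ideal_def poly_carrier_iff)

lemma monomial_ideal_zero: "0 \<in> monomial_ideal n U"
  by (simp add: monomial_ideal_def)

lemma monomial_ideal_add: "p \<in> monomial_ideal n U \<Longrightarrow> q \<in> monomial_ideal n U \<Longrightarrow> p + q \<in> monomial_ideal n U"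
  unfolding monomial_ideal_def by (auto simp: lookup_add) (metis add_0)+

lemma monomial_ideal_minus: "p \<in> monomial_ideal n U \<Longrightarrow> - p \<in> monomial_ideal n U"
  by (simp add: monomial_ideal_def)

lemma monomial_ideal_diff: "p \<in> monomial_ideal n U \<Longrightarrow> q \<in> monomial_ideal n U \<Longrightarrow> p - q \<in> monomial_ideal n U"
  using monomial_ideal_add[of p n U "- q"] monomial_ideal_minus[of q n U] by simp

lemma monomial_ideal_sum: "(\<And>i. i \<in> I \<Longrightarrow> f i \<in> monomial_ideal n U) \<Longrightarrow> sum f I \<in> monomial_ideal n U"
  by (induction I rule: infinite_finite_induct) (auto simp: monomial_ideal_zero monomial_ideal_add)

lemma monomial_ideal_mult_gen:
  assumes p: "p \<in> monomial_ideal n U" and q: "q \<in> monomial_ideal n V"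
    and UV: "\<And>a b. a \<in> U \<Longrightarrow> b \<in> V \<Longrightarrow> a \<in> exps n \<Longrightarrow> b \<in> exps n \<Longrightarrow> (\<lambda>i. a i + b i) \<in> W"
  shows "p * q \<in> monomial_ideal n W"
  unfolding monomial_ideal_def
proof (intro CollectI allI impI)
  fix m assume "Poly_Mapping.lookup (p * q) m \<noteq> 0"
  then have "m \<in> Poly_Mapping.keys (p * q)" by (simp add: in_keys_iff)
  then obtain a b where ab: "m = a + b" "a \<in> Poly_Mapping.keys p" "b \<in> Poly_Mapping.keys q"
    using keys_mult[of p q] by blast
  then have *: "Poly_Mapping.lookup a \<in> exps n" "Poly_Mapping.lookup a \<in> U"
      "Poly_Mapping.lookup b \<in> exps n" "Poly_Mapping.lookup b \<in> V"
    using p q by (auto simp: monomial_ideal_def in_keys_iff)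
  have "Poly_Mapping.lookup m = (\<lambda>i. Poly_Mapping.lookup a i + Poly_Mapping.lookup b i)"
    by (simp add: ab(1) lookup_add fun_eq_iff)
  then show "Poly_Mapping.lookup m \<in> exps n \<and> Poly_Mapping.lookup m \<in> W"
    using UV[OF *(2,4,1,3)] * by (auto simp: exps_def)
qed

lemma monomial_ideal_mult:
  assumes "upset n U" "p \<in> carrier (poly_ring n)" "q \<in> monomial_ideal n U"
  shows "p * q \<in> monomial_ideal n U"
proof (rule monomial_ideal_mult_gen[OF _ assms(3)])
  show "p \<in> monomial_ideal n (exps n)" using assms(2) by (simp add: monomial_ideal_exps)
  show "(\<lambda>i. a i + b i) \<in> U" if "b \<in> U" "a \<in> exps n" "b \<in> exps n" for a b
    by (rule upsetD[OF assms(1) that(1)]) (use that in \<open>auto simp: exps_def le_fun_def\<close>)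
qed

lemma poly_ring_mult_closed:
  "p \<in> carrier (poly_ring n) \<Longrightarrow> q \<in> carrier (poly_ring n) \<Longrightarrow> p * q \<in> carrier (poly_ring n)"
  using monomial_ideal_mult[OF upset_exps] by (simp add: monomial_ideal_exps)

lemma poly_ring_one_closed: "1 \<in> carrier (poly_ring n)"
  by (auto simp: poly_carrier_iff lookup_one when_def exps_def)

lemma cring_poly_ring: "cring (poly_ring n)"
proof (rule cringI)
  show "abelian_group (poly_ring n)"
  proof (rule abelian_groupI)
    fix x assume x: "x \<in> carrier (poly_ring n)"
    show "\<exists>y\<in>carrier (poly_ring n). y \<oplus>\<^bsub>poly_ring n\<^esub> x = \<zero>\<^bsub>poly_ring n\<^esub>"
      using x monomial_ideal_minus[of x n "exps n"] by (intro bexI[of _ "- x"]) (auto simp: monomial_ideal_exps)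
  qed (auto simp: monomial_ideal_exps[symmetric] monomial_ideal_add monomial_ideal_zero add.assoc add.commute)
  show "comm_monoid (poly_ring n)"
    by (rule comm_monoidI)
      (auto simp: poly_ring_mult_closed mult.assoc mult.commute poly_ring_one_closed)
qed (auto simp: distrib_right)

lemma ideal_monomial_ideal:
  assumes "upset n U"
  shows "ideal (monomial_ideal n U :: 'k::field mpoly set) (poly_ring n)"
proof -
  interpret cring "poly_ring n :: 'k mpoly ring" by (rule cring_poly_ring)
  show ?thesis
  proof (rule idealI[OF ring_axioms])
    show "subgroup (monomial_ideal n U :: 'k mpoly set) (add_monoid (poly_ring n))"
    proof (rule add.subgroupI)
      show "monomial_ideal n U \<subseteq> carrier (poly_ring n :: 'k mpoly ring)" by (rule monomial_ideal_carrier)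
      show "(monomial_ideal n U :: 'k mpoly set) \<noteq> {}" using monomial_ideal_zero by blast
      fix a :: "'k mpoly" assume a: "a \<in> monomial_ideal n U"
      have "a \<in> carrier (poly_ring n)" "- a \<in> carrier (poly_ring n)"
        using a monomial_ideal_minus[OF a] monomial_ideal_carrier by blast+
      then have "\<ominus>\<^bsub>poly_ring n\<^esub> a = - a" by (intro minus_equality) auto
      then show "\<ominus>\<^bsub>poly_ring n\<^esub> a \<in> monomial_ideal n U" using monomial_ideal_minus[OF a] by simp
    qed (auto simp: monomial_ideal_add)
  next
    fix a x :: "'k mpoly" assume "a \<in> monomial_ideal n U" "x \<in> carrier (poly_ring n)"
    then show "x \<otimes>\<^bsub>poly_ring n\<^esub> a \<in> monomial_ideal n U" "a \<otimes>\<^bsub>poly_ring n\<^esub> x \<in> monomial_ideal n U"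
      using monomial_ideal_mult[OF assms, of x a] by (simp_all add: mult.commute)
  qed
qed

lemma poly_eq_sum_monomials:
  "p = (\<Sum>m\<in>Poly_Mapping.keys p. Poly_Mapping.single m (Poly_Mapping.lookup p m))"
proof (rule poly_mapping_eqI)
  fix x
  have "Poly_Mapping.lookup (\<Sum>m\<in>Poly_Mapping.keys p. Poly_Mapping.single m (Poly_Mapping.lookup p m)) x =
      (\<Sum>m\<in>Poly_Mapping.keys p. if m = x then Poly_Mapping.lookup p m else 0)"
    unfolding lookup_sum by (rule sum.cong) (auto simp: lookup_single when_def)
  then show "Poly_Mapping.lookup p x =
      Poly_Mapping.lookup (\<Sum>m\<in>Poly_Mapping.keys p. Poly_Mapping.single m (Poly_Mapping.lookup p m)) x"
    by (simp add: in_keys_iff)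
qed

lemma diff_add_le:
  fixes m m0 :: "nat \<Rightarrow>\<^sub>0 nat"
  assumes "Poly_Mapping.lookup m0 \<le> Poly_Mapping.lookup m"
  shows "(m - m0) + m0 = m"
  by (rule poly_mapping_eqI) (use assms in \<open>auto simp: le_fun_def lookup_add lookup_minus\<close>)

lemma single_carrier: "Poly_Mapping.lookup m \<in> exps n \<Longrightarrow> Poly_Mapping.single m c \<in> carrier (poly_ring n)"
  by (auto simp: poly_carrier_iff lookup_single when_def)

lemma exps_diff: "Poly_Mapping.lookup m \<in> exps n \<Longrightarrow> Poly_Mapping.lookup (m - m0) \<in> exps n"
  by (auto simp: exps_def lookup_minus)

text \<open>Each monomial with exponent in \<open>U\<close> is a multiple of a monomial in
  \<open>G\<close>, and a polynomial is the sum of its terms.\<close>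

lemma genideal_monomials:
  assumes U: "upset n U" and G: "G \<subseteq> monomial_ideal n U"
    and gen: "\<And>m. Poly_Mapping.lookup m \<in> U \<Longrightarrow>
      \<exists>m0. Poly_Mapping.single m0 1 \<in> G \<and> Poly_Mapping.lookup m0 \<le> Poly_Mapping.lookup m"
  shows "genideal (poly_ring n) G = (monomial_ideal n U :: 'k::field mpoly set)"
proof
  show "genideal (poly_ring n) G \<subseteq> monomial_ideal n U"
    unfolding genideal_def using ideal_monomial_ideal[OF U] G by blast
  show "monomial_ideal n U \<subseteq> genideal (poly_ring n) G"
    unfolding genideal_def
  proof (intro subsetI InterI, elim CollectE conjE)
    fix p :: "'k mpoly" and J
    assume p: "p \<in> monomial_ideal n U" and J: "ideal J (poly_ring n)" and GJ: "G \<subseteq> J"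
    interpret J: ideal J "poly_ring n" by (rule J)
    have mono: "Poly_Mapping.single m c \<in> J" if "m \<in> Poly_Mapping.keys p" for m c
    proof -
      have m: "Poly_Mapping.lookup m \<in> exps n" "Poly_Mapping.lookup m \<in> U"
        using p that by (auto simp: monomial_ideal_def in_keys_iff)
      then obtain m0 where m0: "Poly_Mapping.single m0 1 \<in> G" "Poly_Mapping.lookup m0 \<le> Poly_Mapping.lookup m"
        using gen by blast
      have "Poly_Mapping.single m c = Poly_Mapping.single (m - m0) c * Poly_Mapping.single m0 1"
        using diff_add_le[OF m0(2)] by (simp add: mult_single)
      moreover have "Poly_Mapping.single (m - m0) c \<in> carrier (poly_ring n)"
        by (rule single_carrier[OF exps_diff[OF m(1)]])
      moreover have "Poly_Mapping.single m0 1 \<in> J" using m0(1) GJ by blast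
      ultimately show ?thesis using J.I_l_closed by fastforce
    qed
    have "(\<Sum>m\<in>M. Poly_Mapping.single m (Poly_Mapping.lookup p m)) \<in> J"
      if "finite M" "M \<subseteq> Poly_Mapping.keys p" for M
      using that
    proof induction
      case empty
      then show ?case using additive_subgroup.zero_closed[OF ideal.axioms(1)[OF J]] by simp
    next
      case (insert x M)
      then show ?case using additive_subgroup.a_closed[OF ideal.axioms(1)[OF J] mono[of x]] by simp
    qed
    from this[of "Poly_Mapping.keys p"] show "p \<in> J" using poly_eq_sum_monomials[of p] by simp
  qed
qed

text \<open>Turns the minimality of a resolution into the vanishing of constant coefficients, the
  form in which \<open>minimal_cover\<close> states it.\<close>

lemma irrelevant_ideal_iff:
  "p \<in> irrelevant_ideal n \<longleftrightarrow> p \<in> carrier (poly_ring n) \<and> Poly_Mapping.lookup p 0 = 0"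
proof -
  let ?U = "exps n - {\<lambda>_. 0}"
  have up: "upset n ?U" by (auto simp: upset_def le_fun_def fun_eq_iff)
  have "irrelevant_ideal n = (monomial_ideal n ?U :: 'a mpoly set)"
    unfolding irrelevant_ideal_def
  proof (rule genideal_monomials[OF up])
    show "var ` {1..n} \<subseteq> (monomial_ideal n ?U :: 'a mpoly set)"
    proof
      fix p :: "'a mpoly" assume "p \<in> var ` {1..n}"
      then obtain i where i: "p = var i" "i \<in> {1..n}" by blast
      have "Poly_Mapping.lookup (Poly_Mapping.single i (1::nat)) \<in> exps n"
        using i(2) by (auto simp: exps_def lookup_single when_def)
      moreover have "Poly_Mapping.lookup (Poly_Mapping.single i (1::nat)) i \<noteq> (\<lambda>_. 0) i" by simp
      then have "Poly_Mapping.lookup (Poly_Mapping.single i (1::nat)) \<noteq> (\<lambda>_. 0)" by metis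
      ultimately show "p \<in> monomial_ideal n ?U"
        by (simp add: i(1) monomial_ideal_def var_def lookup_single when_def)
    qed
    fix m :: "nat \<Rightarrow>\<^sub>0 nat" assume m: "Poly_Mapping.lookup m \<in> ?U"
    then obtain i where i: "Poly_Mapping.lookup m i \<noteq> 0" by (auto simp: fun_eq_iff)
    then have "i \<in> {1..n}" using m expsD by blast
    then have "Poly_Mapping.single (Poly_Mapping.single i 1) 1 \<in> var ` {1..n}" by (auto simp: var_def)
    moreover have "Poly_Mapping.lookup (Poly_Mapping.single i 1) \<le> Poly_Mapping.lookup m"
      using i by (auto simp: le_fun_def lookup_single when_def)
    ultimately show "\<exists>m0. Poly_Mapping.single m0 1 \<in> var ` {1..n} \<and> Poly_Mapping.lookup m0 \<le> Poly_Mapping.lookup m"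
      by blast
  qed
  moreover have "Poly_Mapping.lookup m = (\<lambda>_. 0) \<longleftrightarrow> m = 0" for m :: "nat \<Rightarrow>\<^sub>0 nat"
    by (metis lookup_zero poly_mapping_eqI)
  ultimately show ?thesis by (auto simp: monomial_ideal_def poly_carrier_iff)
qed

lemma upset_power_exps: "upset n (power_exps n t s)"
  unfolding upset_def power_exps_def by (auto intro: order_trans)

section \<open>Powers of the path ideal\<close>

definition window :: "nat \<Rightarrow> nat \<Rightarrow> (nat \<Rightarrow>\<^sub>0 nat)" where
  "window t i = (\<Sum>l=i..<i + t. Poly_Mapping.single l 1)"

lemma lookup_window: "Poly_Mapping.lookup (window t i) l = (if i \<le> l \<and> l < i + t then 1 else 0)"
  by (simp add: window_def lookup_sum lookup_single when_def)

lemma path_monomial_eq: "path_monomial t i = Poly_Mapping.single (window t i) 1"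
proof -
  have "(\<Prod>l\<in>I. var l) = (Poly_Mapping.single (\<Sum>l\<in>I. Poly_Mapping.single l 1) 1 :: 'a mpoly)" for I
    by (induction I rule: infinite_finite_induct) (auto simp: var_def mult_single)
  then show ?thesis by (simp add: path_monomial_def window_def)
qed

lemma path_exp_delta:
  assumes "1 \<le> i"
  shows "path_exp t ((\<lambda>_. 0)(i := 1)) = Poly_Mapping.lookup (window t i)"
proof
  fix l
  have "path_exp t (\<lambda>_. 0) l = 0" by (simp add: path_exp_def)
  then show "path_exp t ((\<lambda>_. 0)(i := 1)) l = Poly_Mapping.lookup (window t i) l"
    by (simp only: path_exp_upd[of "\<lambda>_. 0" i, OF refl assms] lookup_window)
qed

lemma path_exp_add: "path_exp t (\<lambda>i. g i + h i) l = path_exp t g l + path_exp t h l"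
  by (simp add: path_exp_def sum.distrib)

lemma delta_exps: "i \<in> {1..N} \<Longrightarrow> (\<lambda>_. 0)(i := 1) \<in> exps N \<and> (\<Sum>k=1..N. ((\<lambda>_. 0)(i := 1::nat)) k) = 1"
  by (auto simp: exps_def fun_upd_def)

text \<open>Splitting off any path that the packing uses factors a monomial of the next power into a
  generator and a monomial of \<open>I\<^sup>s\<close>.\<close>

lemma power_exps_Suc_split:
  assumes "Poly_Mapping.lookup m \<in> power_exps n t (Suc s)"
  shows "\<exists>i. i \<in> {1..n + 1 - t} \<and> Poly_Mapping.lookup (window t i) \<le> Poly_Mapping.lookup m \<and>
    Poly_Mapping.lookup (m - window t i) \<in> power_exps n t s"
proof -
  obtain h where h: "h \<in> exps (n + 1 - t)" "(\<Sum>i=1..n + 1 - t. h i) = Suc s"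
      "path_exp t h \<le> Poly_Mapping.lookup m" and m: "Poly_Mapping.lookup m \<in> exps n"
    using assms by (auto simp: power_exps_def)
  obtain i where i: "i \<in> {1..n + 1 - t}" "h i \<noteq> 0" using h(2) by (metis Zero_not_Suc sum.neutral)
  define g where "g = h(i := h i - 1)"
  have hg: "h = (\<lambda>k. g k + ((\<lambda>_. 0)(i := 1)) k)" using i by (auto simp: g_def)
  have pe: "path_exp t h l = path_exp t g l + Poly_Mapping.lookup (window t i) l" for l
    using path_exp_add[of t g "(\<lambda>_. 0)(i := 1)" l] path_exp_delta[of i t] i hg by simp
  have "(\<Sum>i=1..n + 1 - t. h i) = (\<Sum>i=1..n + 1 - t. g i) + 1"
    using delta_exps[OF i(1)] by (subst hg) (simp add: sum.distrib)
  then have "(\<Sum>i=1..n + 1 - t. g i) = s" using h(2) by simp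
  moreover have "g \<in> exps (n + 1 - t)" using h(1) by (auto simp: g_def exps_def)
  moreover have "path_exp t g l + Poly_Mapping.lookup (window t i) l \<le> Poly_Mapping.lookup m l" for l
    using le_funD[OF h(3), of l] pe by simp
  then have "path_exp t g l \<le> Poly_Mapping.lookup m l - Poly_Mapping.lookup (window t i) l \<and>
      Poly_Mapping.lookup (window t i) l \<le> Poly_Mapping.lookup m l" for l
    by (meson add_leD2 add_le_imp_le_diff)
  then have "path_exp t g \<le> Poly_Mapping.lookup (m - window t i)"
      "Poly_Mapping.lookup (window t i) \<le> Poly_Mapping.lookup m"
    by (simp_all add: le_fun_def lookup_minus)
  ultimately show ?thesis
    using i(1) exps_diff[OF m] by (auto simp: power_exps_def)
qed

lemma window_power_exps:
  assumes "i \<in> {1..n + 1 - t}"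
  shows "Poly_Mapping.lookup (window t i) \<in> power_exps n t 1"
proof -
  have "Poly_Mapping.lookup (window t i) \<in> exps n"
    using assms by (auto simp: exps_def lookup_window)
  then show ?thesis
    using delta_exps[OF assms] path_exp_delta[of i t] assms unfolding power_exps_def
    by (intro CollectI conjI bexI[of _ "(\<lambda>_. 0)(i := 1)"]) auto
qed

lemma path_ideal_eq: "(path_ideal n t :: 'k::field mpoly set) = monomial_ideal n (power_exps n t 1)"
  unfolding path_ideal_def
proof (rule genideal_monomials[OF upset_power_exps])
  show "{path_monomial t i |i. 1 \<le> i \<and> i + t \<le> n + 1} \<subseteq> (monomial_ideal n (power_exps n t 1) :: 'k mpoly set)"
  proof
    fix p :: "'k mpoly" assume "p \<in> {path_monomial t i |i. 1 \<le> i \<and> i + t \<le> n + 1}"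
    then obtain i where i: "p = path_monomial t i" "i \<in> {1..n + 1 - t}" by auto
    then show "p \<in> monomial_ideal n (power_exps n t 1)"
      using window_power_exps[OF i(2)]
      by (auto simp: path_monomial_eq monomial_ideal_def lookup_single when_def power_exps_def)
  qed
  fix m assume "Poly_Mapping.lookup m \<in> power_exps n t 1"
  then obtain i where i: "i \<in> {1..n + 1 - t}" "Poly_Mapping.lookup (window t i) \<le> Poly_Mapping.lookup m"
    using power_exps_Suc_split[of m n t 0] by auto
  then have "Poly_Mapping.single (window t i) (1::'k) \<in> {path_monomial t i |i. 1 \<le> i \<and> i + t \<le> n + 1}"
    by (auto simp: path_monomial_eq intro!: exI[of _ i])
  then show "\<exists>m0. Poly_Mapping.single m0 (1::'k) \<in> {path_monomial t i |i. 1 \<le> i \<and> i + t \<le> n + 1} \<and>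
      Poly_Mapping.lookup m0 \<le> Poly_Mapping.lookup m"
    using i(2) by blast
qed

lemma power_exps_add:
  assumes "a \<in> power_exps n t s" "b \<in> power_exps n t r"
  shows "(\<lambda>i. a i + b i) \<in> power_exps n t (s + r)"
proof -
  obtain g h where g: "g \<in> exps (n + 1 - t)" "(\<Sum>i=1..n + 1 - t. g i) = s" "path_exp t g \<le> a"
    and h: "h \<in> exps (n + 1 - t)" "(\<Sum>i=1..n + 1 - t. h i) = r" "path_exp t h \<le> b"
    using assms by (auto simp: power_exps_def)
  have "path_exp t (\<lambda>i. g i + h i) l \<le> a l + b l" for l
    using le_funD[OF g(3), of l] le_funD[OF h(3), of l] by (simp add: path_exp_add)
  moreover have "(\<lambda>i. g i + h i) \<in> exps (n + 1 - t)" using g(1) h(1) by (auto simp: exps_def)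
  moreover have "(\<Sum>i=1..n + 1 - t. g i + h i) = s + r" using g(2) h(2) by (simp add: sum.distrib)
  moreover have "(\<lambda>i. a i + b i) \<in> exps n" using assms by (auto simp: power_exps_def exps_def)
  ultimately show ?thesis unfolding power_exps_def le_fun_def by blast
qed

lemma ideal_prod_power_exps:
  "ideal_prod (poly_ring n) (monomial_ideal n (power_exps n t s)) (monomial_ideal n (power_exps n t 1)) =
    (monomial_ideal n (power_exps n t (Suc s)) :: 'k::field mpoly set)" (is "ideal_prod _ ?I ?J = ?K")
proof
  show "ideal_prod (poly_ring n) ?I ?J \<subseteq> ?K"
  proof
    fix p assume "p \<in> ideal_prod (poly_ring n) ?I ?J"
    then show "p \<in> ?K"
    proof induction
      case (prod i j)
      then have "i * j \<in> ?K"
        by (rule monomial_ideal_mult_gen) (use power_exps_add[of _ n t s _ 1] in simp)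
      then show ?case by simp
    qed (auto simp: monomial_ideal_add)
  qed
  show "?K \<subseteq> ideal_prod (poly_ring n) ?I ?J"
  proof
    fix p :: "'k mpoly" assume p: "p \<in> ?K"
    let ?P = "ideal_prod (poly_ring n) ?I ?J"
    have mono: "Poly_Mapping.single m c \<in> ?P" if "m \<in> Poly_Mapping.keys p" for m c
    proof -
      have m: "Poly_Mapping.lookup m \<in> exps n" "Poly_Mapping.lookup m \<in> power_exps n t (Suc s)"
        using p that by (auto simp: monomial_ideal_def in_keys_iff)
      obtain i where i: "i \<in> {1..n + 1 - t}" "Poly_Mapping.lookup (window t i) \<le> Poly_Mapping.lookup m"
          "Poly_Mapping.lookup (m - window t i) \<in> power_exps n t s"
        using power_exps_Suc_split[OF m(2)] by blast
      have "Poly_Mapping.single (m - window t i) c \<in> ?I"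
        using i(3) exps_diff[OF m(1)] by (auto simp: monomial_ideal_def lookup_single when_def)
      moreover have "Poly_Mapping.single (window t i) 1 \<in> ?J"
        using window_power_exps[OF i(1)] by (auto simp: monomial_ideal_def lookup_single when_def power_exps_def)
      ultimately have "Poly_Mapping.single (m - window t i) c * Poly_Mapping.single (window t i) 1 \<in> ?P"
        using ideal_prod.prod[of _ ?I _ ?J "poly_ring n"] by simp
      then show ?thesis using diff_add_le[OF i(2)] by (simp add: mult_single)
    qed
    have zero: "0 \<in> ?P"
    proof -
      have "0 \<otimes>\<^bsub>poly_ring n\<^esub> 0 \<in> ?P"
        by (rule ideal_prod.prod[OF monomial_ideal_zero monomial_ideal_zero])
      then show ?thesis by (simp only: poly_ring_simps mult_zero_left)
    qed
    have "(\<Sum>m\<in>M. Poly_Mapping.single m (Poly_Mapping.lookup p m)) \<in> ?P"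
      if "finite M" "M \<subseteq> Poly_Mapping.keys p" for M
      using that
    proof induction
      case empty
      show ?case unfolding sum.empty by (rule zero)
    next
      case (insert x M)
      then have "Poly_Mapping.single x (Poly_Mapping.lookup p x) \<oplus>\<^bsub>poly_ring n\<^esub>
          (\<Sum>m\<in>M. Poly_Mapping.single m (Poly_Mapping.lookup p m)) \<in> ?P"
        by (intro ideal_prod.sum mono) auto
      then show ?case by (simp only: poly_ring_simps sum.insert[OF insert.hyps])
    qed
    from this[of "Poly_Mapping.keys p"] show "p \<in> ?P" using poly_eq_sum_monomials[of p] by simp
  qed
qed

lemma ideal_power_eq: "ideal_power n (path_ideal n t) s = monomial_ideal n (power_exps n t s)"
proof (induction s)
  case 0
  \<comment> \<open>The zeroth power is the unit of the monoid of ideals, the whole ring;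
    correspondingly the empty packing fits into every monomial.\<close>
  have "power_exps n t 0 = exps n"
    by (auto simp: power_exps_def path_exp_def le_fun_def exps_def intro!: bexI[of _ "\<lambda>_. 0"])
  then show ?case by (simp add: ideal_power_def ideals_set_def nat_pow_def monomial_ideal_exps)
next
  case (Suc s)
  then show ?case
    using ideal_prod_power_exps[of n t s]
    by (simp add: ideal_power_def ideals_set_def nat_pow_def path_ideal_eq)
qed

section \<open>Minimal resolutions and Koszul homology\<close>

lemma free_module_simps:
  "carrier (free_module n ds) =
    {v. (\<forall>k<length ds. v k \<in> carrier (poly_ring n)) \<and> (\<forall>k\<ge>length ds. v k = 0)}"
  "add (free_module n ds) = (\<lambda>v w. v + w)"
  "zero (free_module n ds) = 0"
  "smult (free_module n ds) = (\<lambda>r v k. r * v k)"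
  by (simp_all add: free_module_def Let_def plus_fun_def zero_fun_def)

lemma homog_carrier: "p \<in> homog n j \<Longrightarrow> p \<in> carrier (poly_ring n)"
  by (simp add: homog_def)

lemma hcomp_free_module: "hcomp (free_module n ds) j = free_part n ds j"
  by (auto simp: free_module_def Let_def free_part_def homog_carrier not_less)

lemma carrier_add: "p \<in> carrier (poly_ring n) \<Longrightarrow> q \<in> carrier (poly_ring n) \<Longrightarrow> p + q \<in> carrier (poly_ring n)"
  using monomial_ideal_add[of p n "exps n" q] by (simp add: monomial_ideal_exps)

lemma carrier_zero: "0 \<in> carrier (poly_ring n)"
  using monomial_ideal_zero[of n "exps n"] by (simp add: monomial_ideal_exps)

lemma free_carrierD:
  assumes "v \<in> carrier (free_module n ds)"
  shows "k < length ds \<Longrightarrow> v k \<in> carrier (poly_ring n)" "\<not> k < length ds \<Longrightarrow> v k = 0"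
    "v k \<in> carrier (poly_ring n)"
  using assms by (auto simp: free_module_simps not_less) (metis carrier_zero not_less)

lemma free_carrierI:
  assumes "\<And>k. k < length ds \<Longrightarrow> v k \<in> carrier (poly_ring n)" "\<And>k. \<not> k < length ds \<Longrightarrow> v k = 0"
  shows "v \<in> carrier (free_module n ds)"
  using assms by (simp add: free_module_simps)

lemma free_part_carrier: "v \<in> free_part n ds j \<Longrightarrow> v \<in> carrier (free_module n ds)"
  by (rule free_carrierI) (use free_partD homog_carrier in blast)+

lemma free_carrier_add:
  "v \<in> carrier (free_module n ds) \<Longrightarrow> w \<in> carrier (free_module n ds) \<Longrightarrow> v + w \<in> carrier (free_module n ds)"
  by (auto simp: free_module_simps carrier_add)

lemma free_carrier_zero: "0 \<in> carrier (free_module n ds)"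
  by (rule free_carrierI) (auto simp: carrier_zero)

lemma free_carrier_sum:
  "(\<And>i. i \<in> I \<Longrightarrow> f i \<in> carrier (free_module n ds)) \<Longrightarrow> sum f I \<in> carrier (free_module n ds)"
  by (induction I rule: infinite_finite_induct) (auto simp: free_carrier_zero free_carrier_add)

section \<open>Homogeneous components of polynomials and vectors\<close>

definition hom_part :: "int \<Rightarrow> 'k::field mpoly \<Rightarrow> 'k mpoly" where
  "hom_part j p = Abs_poly_mapping (\<lambda>m. if int (monom_deg m) = j then Poly_Mapping.lookup p m else 0)"

lemma lookup_hom_part:
  "Poly_Mapping.lookup (hom_part j p) m = (if int (monom_deg m) = j then Poly_Mapping.lookup p m else 0)"
proof -
  have "finite {m. (if int (monom_deg m) = j then Poly_Mapping.lookup p m else 0) \<noteq> 0}"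
    by (rule finite_subset[of _ "Poly_Mapping.keys p"]) (auto simp: in_keys_iff)
  then show ?thesis by (simp add: hom_part_def)
qed

lemma hom_part_add: "hom_part j (p + q) = hom_part j p + hom_part j q"
  by (rule poly_mapping_eqI) (simp add: lookup_hom_part lookup_add)

lemma hom_part_homog: "p \<in> carrier (poly_ring n) \<Longrightarrow> hom_part j p \<in> homog n j"
  by (auto simp: homog_iff lookup_hom_part poly_carrier_iff split: if_splits)

lemma hom_part_same: "p \<in> homog n j \<Longrightarrow> hom_part i p = (if i = j then p else 0)"
  by (rule poly_mapping_eqI) (use homogD(2) in \<open>fastforce simp: lookup_hom_part\<close>)

lemma hom_part_monomial_ideal: "p \<in> monomial_ideal n U \<Longrightarrow> hom_part j p \<in> mon_part n U j"
  by (auto simp: monomial_ideal_def mon_part_iff lookup_hom_part split: if_splits)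

lemma mon_part_eq: "mon_part n U j = monomial_ideal n U \<inter> homog n j"
  unfolding mon_part_def monomial_ideal_def homog_iff by (auto simp: homog_iff in_keys_iff)

definition vec_part :: "int list \<Rightarrow> int \<Rightarrow> 'k::field fvec \<Rightarrow> 'k fvec" where
  "vec_part ds j v = (\<lambda>k. if k < length ds then hom_part (j - ds ! k) (v k) else 0)"

lemma vec_part_free: "v \<in> carrier (free_module n ds) \<Longrightarrow> vec_part ds j v \<in> free_part n ds j"
  by (rule free_partI) (auto simp: vec_part_def hom_part_homog free_carrierD(3))

lemma vec_part_add: "vec_part ds j (v + w) = vec_part ds j v + vec_part ds j w"
  by (auto simp: vec_part_def hom_part_add fun_eq_iff)

lemma vec_part_same:
  assumes "v \<in> free_part n ds j"
  shows "vec_part ds i v = (if i = j then v else 0)"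
proof
  fix k
  show "vec_part ds i v k = (if i = j then v else 0) k"
    using hom_part_same[OF free_partD(1)[OF assms, of k], of "i - ds ! k"] free_partD(2)[OF assms, of k]
    by (cases "k < length ds") (auto simp: vec_part_def)
qed

lemma vec_part_decomposition:
  assumes "v \<in> carrier (free_module n ds)"
  obtains D where "finite D" "\<And>j. j \<notin> D \<Longrightarrow> vec_part ds j v = 0" "v = (\<Sum>j\<in>D. vec_part ds j v)"
proof -
  define D where "D = (\<Union>k<length ds. (\<lambda>m. int (monom_deg m) + ds ! k) ` Poly_Mapping.keys (v k))"
  have fin: "finite D" by (auto simp: D_def)
  have inD: "int (monom_deg m) + ds ! k \<in> D" if "k < length ds" "Poly_Mapping.lookup (v k) m \<noteq> 0" for k m
    using that by (auto simp: D_def in_keys_iff intro!: bexI[of _ k])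
  show thesis
  proof (rule that[OF fin])
    fix j assume j: "j \<notin> D"
    show "vec_part ds j v = 0"
    proof
      fix k
      have "hom_part (j - ds ! k) (v k) = 0" if k: "k < length ds"
      proof (rule poly_mapping_eqI)
        fix m
        have "Poly_Mapping.lookup (v k) m = 0" if "int (monom_deg m) = j - ds ! k"
        proof (rule ccontr)
          assume "Poly_Mapping.lookup (v k) m \<noteq> 0"
          from inD[OF k this] show False using j that by simp
        qed
        then show "Poly_Mapping.lookup (hom_part (j - ds ! k) (v k)) m = Poly_Mapping.lookup 0 m"
          by (simp add: lookup_hom_part)
      qed
      then show "vec_part ds j v k = 0 k" by (simp add: vec_part_def)
    qed
  next
    show "v = (\<Sum>j\<in>D. vec_part ds j v)"
    proof
      fix k
      show "v k = (\<Sum>j\<in>D. vec_part ds j v) k"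
      proof (cases "k < length ds")
        case True
        show ?thesis
        proof (rule poly_mapping_eqI)
          fix m
          have "Poly_Mapping.lookup ((\<Sum>j\<in>D. vec_part ds j v) k) m =
              (\<Sum>j\<in>D. if j = int (monom_deg m) + ds ! k then Poly_Mapping.lookup (v k) m else 0)"
            unfolding fun_sum_apply lookup_sum
            by (rule sum.cong) (use True in \<open>auto simp: vec_part_def lookup_hom_part\<close>)
          also have "\<dots> = Poly_Mapping.lookup (v k) m" using inD[OF True, of m] fin by auto
          finally show "Poly_Mapping.lookup (v k) m = Poly_Mapping.lookup ((\<Sum>j\<in>D. vec_part ds j v) k) m" by simp
        qed
      next
        case False
        then show ?thesis using free_carrierD(2)[OF assms False] by (simp add: fun_sum_apply vec_part_def)
      qed
    qed
  qed
qed

lemma additive_sum: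
  fixes g :: "'k::field fvec \<Rightarrow> 'w::ab_group_add"
  assumes add: "\<And>v w. v \<in> carrier (free_module n ds) \<Longrightarrow> w \<in> carrier (free_module n ds) \<Longrightarrow> g (v + w) = g v + g w"
    and f: "\<And>i. i \<in> I \<Longrightarrow> f i \<in> carrier (free_module n ds)"
  shows "g (sum f I) = (\<Sum>i\<in>I. g (f i))"
proof -
  have g0: "g 0 = 0" using add[OF free_carrier_zero free_carrier_zero] by simp
  show ?thesis using f
  proof (induction I rule: infinite_finite_induct)
    case (insert i I)
    have "g (f i + sum f I) = g (f i) + g (sum f I)"
      by (intro add free_carrier_sum insert.prems) auto
    moreover have "g (sum f I) = (\<Sum>i\<in>I. g (f i))" using insert.prems by (intro insert.IH) auto
    ultimately show ?case by (simp only: sum.insert[OF insert.hyps])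
  qed (simp_all add: g0)
qed

text \<open>A resolution is exact on whole carriers, while Koszul homology is computed degree by
  degree; this commutation passes between the two. The projection \<open>\<pi>\<close> is abstract
  so that targets may be polynomials or vectors.\<close>

lemma graded_map_vec_part:
  fixes g :: "'k::field fvec \<Rightarrow> 'w::ab_group_add"
  assumes add: "\<And>v w. v \<in> carrier (free_module n ds) \<Longrightarrow> w \<in> carrier (free_module n ds) \<Longrightarrow> g (v + w) = g v + g w"
    and g: "\<And>v i. v \<in> free_part n ds i \<Longrightarrow> \<pi> j (g v) = (if j = i then g v else 0)"
    and \<pi>: "\<And>a b. \<pi> j (a + b) = \<pi> j a + \<pi> j b"
    and v: "v \<in> carrier (free_module n ds)"
  shows "g (vec_part ds j v) = \<pi> j (g v)"
proof -
  obtain D where D: "finite D" "\<And>j. j \<notin> D \<Longrightarrow> vec_part ds j v = 0" "v = (\<Sum>j\<in>D. vec_part ds j v)"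
    using vec_part_decomposition[OF v] by blast
  have g0: "g 0 = 0" using add[OF free_carrier_zero free_carrier_zero] by simp
  have \<pi>0: "\<pi> j 0 = 0" using \<pi>[of 0 0] by simp
  have \<pi>sum: "\<pi> j (sum f I) = (\<Sum>i\<in>I. \<pi> j (f i))" for f :: "int \<Rightarrow> 'w" and I
    by (induction I rule: infinite_finite_induct) (auto simp: \<pi> \<pi>0)
  have "\<pi> j (g v) = \<pi> j (\<Sum>i\<in>D. g (vec_part ds i v))"
    by (subst D(3), subst additive_sum[OF add]) (auto intro: free_part_carrier vec_part_free[OF v])
  also have "\<dots> = (\<Sum>i\<in>D. if j = i then g (vec_part ds i v) else 0)"
    unfolding \<pi>sum by (rule sum.cong) (auto simp: g[OF vec_part_free[OF v]])
  also have "\<dots> = g (vec_part ds j v)" using D(1,2) g0 by simp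
  finally show ?thesis by simp
qed

section \<open>The quotient module and its resolutions\<close>

locale monomial_quotient =
  fixes n :: nat and U :: "(nat \<Rightarrow> nat) set" and I :: "'k::field mpoly set"
  assumes U: "upset n U" and I_eq: "I = monomial_ideal n U"
begin

abbreviation coset :: "'k mpoly \<Rightarrow> 'k mpoly set" where
  "coset p \<equiv> I +>\<^bsub>poly_ring n\<^esub> p"

lemma ideal_I: "ideal I (poly_ring n)"
  unfolding I_eq by (rule ideal_monomial_ideal[OF U])

lemma mon_part_I: "mon_part n U j = I \<inter> homog n j"
  by (simp add: I_eq mon_part_eq)

lemma coset_eq_iff: "coset p = coset q \<longleftrightarrow> p - q \<in> I"
proof
  have c: "coset p = (\<lambda>h. h + p) ` I" for p by (auto simp: a_r_coset_def')
  show "p - q \<in> I" if "coset p = coset q"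
  proof -
    have "p \<in> coset p" unfolding c using monomial_ideal_zero by (force simp: I_eq)
    then show ?thesis using that unfolding c by auto
  qed
  show "coset p = coset q" if pq: "p - q \<in> I"
    unfolding c
  proof (intro equalityI image_subsetI)
    fix h assume h: "h \<in> I"
    show "h + p \<in> (\<lambda>h. h + q) ` I"
      by (rule image_eqI[of _ _ "h + (p - q)"]) (use h pq monomial_ideal_add in \<open>auto simp: I_eq\<close>)
    show "h + q \<in> (\<lambda>h. h + p) ` I"
      by (rule image_eqI[of _ _ "h - (p - q)"]) (use h pq monomial_ideal_diff in \<open>auto simp: I_eq\<close>)
  qed
qed

lemma coset_zero: "coset 0 = I"
  by (auto simp: a_r_coset_def')

lemma coset_zero_iff: "coset p = I \<longleftrightarrow> p \<in> I"
  using coset_eq_iff[of p 0] by (simp add: coset_zero)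

lemma quot_module_simps:
  "carrier (quot_module n I) = coset ` carrier (poly_ring n)"
  "zero (quot_module n I) = I"
  "hcomp (quot_module n I) j = coset ` homog n j"
  by (auto simp: quot_module_def FactRing_def A_RCOSETS_def')

lemma quot_module_add:
  "p \<in> carrier (poly_ring n) \<Longrightarrow> q \<in> carrier (poly_ring n) \<Longrightarrow>
    coset p \<oplus>\<^bsub>quot_module n I\<^esub> coset q = coset (p + q)"
  using ideal.a_rcos_sum[OF ideal_I, of p q] by (simp add: quot_module_def FactRing_def)

lemma quot_module_smult:
  "p \<in> carrier (poly_ring n) \<Longrightarrow> q \<in> carrier (poly_ring n) \<Longrightarrow>
    p \<odot>\<^bsub>quot_module n I\<^esub> coset q = coset (p * q)"
  using ideal.rcoset_mult_add[OF ideal_I, of p q] by (simp add: quot_module_def FactRing_def)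

end

locale quotient_resolution = monomial_quotient n U I
  for n :: nat and U :: "(nat \<Rightarrow> nat) set" and I :: "'k::field mpoly set" +
  fixes ds :: "nat \<Rightarrow> int list" and \<epsilon> :: "'k fvec \<Rightarrow> 'k mpoly set" and \<delta> :: "nat \<Rightarrow> 'k fvec \<Rightarrow> 'k fvec"
  assumes res: "minimal_free_resolution n (quot_module n I) ds \<epsilon> \<delta>"
begin

lemma eps_hom: "\<epsilon> \<in> graded_hom n (free_module n (ds 0)) (quot_module n I)"
  and delta_hom: "\<delta> i \<in> graded_hom n (free_module n (ds (Suc i))) (free_module n (ds i))"
  and eps_onto: "\<epsilon> ` carrier (free_module n (ds 0)) = carrier (quot_module n I)"
  and exact0: "\<delta> 0 ` carrier (free_module n (ds 1)) = a_kernel (free_module n (ds 0)) (quot_module n I) \<epsilon>"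
  and exactS: "\<delta> (Suc i) ` carrier (free_module n (ds (Suc (Suc i)))) =
    a_kernel (free_module n (ds (Suc i))) (free_module n (ds i)) (\<delta> i)"
  and min: "v \<in> carrier (free_module n (ds (Suc i))) \<Longrightarrow> k < length (ds i) \<Longrightarrow> \<delta> i v k \<in> irrelevant_ideal n"
proof -
  note r = res[unfolded minimal_free_resolution_def Let_def]
  note c2 = conjunct2[OF r] note c3 = conjunct2[OF c2] note c4 = conjunct2[OF c3]
  note c5 = conjunct2[OF c4] note c6 = conjunct2[OF c5]
  show "\<epsilon> \<in> graded_hom n (free_module n (ds 0)) (quot_module n I)" by (rule conjunct1[OF r])
  show "\<delta> i \<in> graded_hom n (free_module n (ds (Suc i))) (free_module n (ds i))"
    by (rule conjunct1[OF c2, rule_format])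
  show "\<epsilon> ` carrier (free_module n (ds 0)) = carrier (quot_module n I)" by (rule conjunct1[OF c3])
  show "\<delta> 0 ` carrier (free_module n (ds 1)) = a_kernel (free_module n (ds 0)) (quot_module n I) \<epsilon>"
    by (rule conjunct1[OF c4])
  show "\<delta> (Suc i) ` carrier (free_module n (ds (Suc (Suc i)))) =
      a_kernel (free_module n (ds (Suc i))) (free_module n (ds i)) (\<delta> i)"
    by (rule conjunct1[OF c5, rule_format])
  show "v \<in> carrier (free_module n (ds (Suc i))) \<Longrightarrow> k < length (ds i) \<Longrightarrow> \<delta> i v k \<in> irrelevant_ideal n"
    by (rule c6[rule_format])
qed

lemma eps_add: "v \<in> carrier (free_module n (ds 0)) \<Longrightarrow> w \<in> carrier (free_module n (ds 0)) \<Longrightarrow>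
    \<epsilon> (v + w) = \<epsilon> v \<oplus>\<^bsub>quot_module n I\<^esub> \<epsilon> w"
  and eps_smult: "r \<in> carrier (poly_ring n) \<Longrightarrow> v \<in> carrier (free_module n (ds 0)) \<Longrightarrow>
    \<epsilon> (\<lambda>k. r * v k) = r \<odot>\<^bsub>quot_module n I\<^esub> \<epsilon> v"
  and eps_deg: "v \<in> free_part n (ds 0) j \<Longrightarrow> \<epsilon> v \<in> coset ` homog n j"
  using eps_hom unfolding graded_hom_def hom_def
  by (simp_all add: free_module_simps(2,4) hcomp_free_module quot_module_simps(3)) blast

lemma delta_add: "v \<in> carrier (free_module n (ds (Suc i))) \<Longrightarrow> w \<in> carrier (free_module n (ds (Suc i))) \<Longrightarrow>
    \<delta> i (v + w) = \<delta> i v + \<delta> i w"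
  and delta_smult: "r \<in> carrier (poly_ring n) \<Longrightarrow> v \<in> carrier (free_module n (ds (Suc i))) \<Longrightarrow>
    \<delta> i (\<lambda>k. r * v k) = (\<lambda>k. r * \<delta> i v k)"
  and delta_deg: "v \<in> free_part n (ds (Suc i)) j \<Longrightarrow> \<delta> i v \<in> free_part n (ds i) j"
  using delta_hom[of i] unfolding graded_hom_def hom_def
  by (simp_all add: free_module_simps(2,4) hcomp_free_module) blast

text \<open>The augmentation lifts to a graded map \<open>lift0\<close> from \<open>F\<^sub>0\<close> to the polynomial ring, which spares
  Koszul complexes with entries in the type of cosets.\<close>

definition base :: "nat \<Rightarrow> 'k mpoly" where
  "base k = (SOME p. p \<in> homog n (ds 0 ! k) \<and> \<epsilon> (unit_vec k) = coset p)"

lemma base: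
  assumes "k < length (ds 0)"
  shows "base k \<in> homog n (ds 0 ! k) \<and> \<epsilon> (unit_vec k) = coset (base k)"
proof -
  have "\<epsilon> (unit_vec k) \<in> coset ` homog n (ds 0 ! k)" by (rule eps_deg[OF unit_vec_free[OF assms]])
  then have "\<exists>p. p \<in> homog n (ds 0 ! k) \<and> \<epsilon> (unit_vec k) = coset p" by (elim imageE) (intro exI conjI)
  then show ?thesis unfolding base_def by (rule someI_ex)
qed

lemma base_carrier: "k < length (ds 0) \<Longrightarrow> base k \<in> carrier (poly_ring n)"
  using base homog_carrier by blast

definition lift0 :: "'k fvec \<Rightarrow> 'k mpoly" where
  "lift0 v = (\<Sum>k<length (ds 0). v k * base k)"

lemma eps_lift0:
  assumes v: "v \<in> carrier (free_module n (ds 0))"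
  shows "\<epsilon> v = coset (lift0 v)"
proof -
  \<comment> \<open>Additivity of \<epsilon> is given for two summands, so \<open>v\<close> is
    assembled coordinate by coordinate from its truncations.\<close>
  define tr where "tr = (\<lambda>m k. if k < m then v k else 0)"
  have trc: "tr m \<in> carrier (free_module n (ds 0))" for m
    by (rule free_carrierI) (use free_carrierD[OF v] in \<open>auto simp: tr_def carrier_zero\<close>)
  have "\<epsilon> (tr m) = coset (\<Sum>k<m. v k * base k) \<and> (\<Sum>k<m. v k * base k) \<in> carrier (poly_ring n)"
    if "m \<le> length (ds 0)" for m
    using that
  proof (induction m)
    case 0
    have "\<epsilon> (tr 0) \<in> carrier (quot_module n I)" using eps_onto trc by blast
    then obtain p where p: "p \<in> carrier (poly_ring n)" "\<epsilon> (tr 0) = coset p" by (auto simp: quot_module_simps)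
    \<comment> \<open>That \<epsilon> maps the zero vector to the zero coset follows from
      compatibility with the scalar 0.\<close>
    have t: "(\<lambda>k. 0 * tr 0 k) = tr 0" by (simp add: tr_def)
    have "\<epsilon> (tr 0) = coset 0"
      using eps_smult[OF carrier_zero trc[of 0]] quot_module_smult[OF carrier_zero p(1)] p(2) unfolding t by simp
    then show ?case by (simp add: carrier_zero)
  next
    case (Suc m)
    have m: "m < length (ds 0)" using Suc.prems by simp
    have u: "unit_vec m \<in> carrier (free_module n (ds 0))" by (rule free_part_carrier[OF unit_vec_free[OF m]])
    have vm: "v m \<in> carrier (poly_ring n)" by (rule free_carrierD(3)[OF v])
    have b: "base m \<in> carrier (poly_ring n)" by (rule base_carrier[OF m])
    let ?w = "\<lambda>k. v m * unit_vec m k"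
    have w: "?w \<in> carrier (free_module n (ds 0))"
      by (rule free_carrierI) (use m vm in \<open>auto simp: unit_vec_def carrier_zero\<close>)
    have "tr (Suc m) = tr m + ?w" by (auto simp: tr_def unit_vec_def fun_eq_iff less_Suc_eq)
    then have "\<epsilon> (tr (Suc m)) = \<epsilon> (tr m) \<oplus>\<^bsub>quot_module n I\<^esub> coset (v m * base m)"
      using eps_add[OF trc w] eps_smult[OF vm u] base[OF m] quot_module_smult[OF vm b] by simp
    then show ?case
      using Suc.IH m poly_ring_mult_closed[OF vm b] by (simp add: quot_module_add carrier_add)
  qed
  from this[OF le_refl] have "\<epsilon> (tr (length (ds 0))) = coset (lift0 v)" by (simp add: lift0_def)
  moreover have "tr (length (ds 0)) = v" using free_carrierD(2)[OF v] by (auto simp: tr_def)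
  ultimately show ?thesis by simp
qed

lemma lift0_add: "lift0 (v + w) = lift0 v + lift0 w"
  by (simp add: lift0_def distrib_right sum.distrib)

lemma lift0_homog:
  assumes v: "v \<in> free_part n (ds 0) j"
  shows "lift0 v \<in> homog n j"
  unfolding lift0_def
proof (rule homog_sum)
  fix k assume "k \<in> {..<length (ds 0)}"
  then have "v k \<in> homog n (j - ds 0 ! k)" "base k \<in> homog n (ds 0 ! k)"
    using free_partD(1)[OF v] base by auto
  then show "v k * base k \<in> homog n j" using homog_mult by fastforce
qed

lemma lift0_vec_part:
  assumes "v \<in> carrier (free_module n (ds 0))"
  shows "lift0 (vec_part (ds 0) j v) = hom_part j (lift0 v)"
proof (rule graded_map_vec_part[where g = lift0 and \<pi> = hom_part, OF _ _ _ assms])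
  show "hom_part j (lift0 v) = (if j = i then lift0 v else 0)" if "v \<in> free_part n (ds 0) i" for v i
    by (rule hom_part_same[OF lift0_homog[OF that]])
qed (rule lift0_add hom_part_add)+

lemma delta_vec_part:
  assumes "v \<in> carrier (free_module n (ds (Suc i)))"
  shows "\<delta> i (vec_part (ds (Suc i)) j v) = vec_part (ds i) j (\<delta> i v)"
proof (rule graded_map_vec_part[where g = "\<delta> i" and \<pi> = "vec_part (ds i)", OF _ _ _ assms])
  show "vec_part (ds i) j (\<delta> i v) = (if j = l then \<delta> i v else 0)" if "v \<in> free_part n (ds (Suc i)) l" for v l
    by (rule vec_part_same[OF delta_deg[OF that]])
qed (erule (1) delta_add, rule vec_part_add)

text \<open>Kernels, degree by degree. At index 0 the kernel of \<epsilon> is expressed as the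
  preimage of the ideal under \<open>lift0\<close>.\<close>

definition syz :: "nat \<Rightarrow> int \<Rightarrow> 'k fvec set" where
  "syz i j = (case i of 0 \<Rightarrow> {v \<in> free_part n (ds 0) j. lift0 v \<in> mon_part n U j}
     | Suc i' \<Rightarrow> {v \<in> free_part n (ds (Suc i')) j. \<delta> i' v \<in> {0}})"

text \<open>Exactness restricted to homogeneous vectors. It makes each differential a cover of the
  preceding syzygies, and makes them inherit minimality from the images.\<close>

lemma syz_iff:
  "w \<in> syz i j \<longleftrightarrow> w \<in> free_part n (ds i) j \<and> w \<in> \<delta> i ` carrier (free_module n (ds (Suc i)))"
proof (cases i)
  case 0
  have "lift0 w \<in> mon_part n U j \<longleftrightarrow> w \<in> a_kernel (free_module n (ds 0)) (quot_module n I) \<epsilon>"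
    if w: "w \<in> free_part n (ds 0) j"
    using free_part_carrier[OF w] lift0_homog[OF w] eps_lift0[OF free_part_carrier[OF w]] coset_zero_iff
    by (simp add: a_kernel_def' quot_module_simps mon_part_I)
  then show ?thesis using exact0 by (auto simp: 0 syz_def)
next
  case (Suc i')
  have "\<delta> i' w = 0 \<longleftrightarrow> w \<in> a_kernel (free_module n (ds (Suc i'))) (free_module n (ds i')) (\<delta> i')"
    if w: "w \<in> free_part n (ds (Suc i')) j"
    using free_part_carrier[OF w] by (simp add: a_kernel_def' free_module_simps(3))
  then show ?thesis using exactS[of i'] by (auto simp: Suc syz_def)
qed

lemma syz_minimal:
  assumes "w \<in> syz i j" "k < length (ds i)"
  shows "Poly_Mapping.lookup (w k) 0 = 0"
  using assms min irrelevant_ideal_iff unfolding syz_iff by blast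

lemma syz0: "koszul_cover.K (free_part n (ds 0)) (mon_part n U) lift0 = syz 0"
  if "koszul_cover n fmult vmult (free_part n (ds 0)) (homog n) (mon_part n U) lift0"
  unfolding koszul_cover.K_def[OF that] syz_def by (simp add: fun_eq_iff)

lemma syzS: "koszul_cover.K (free_part n (ds (Suc i))) (\<lambda>_. {0}) (\<delta> i) = syz (Suc i)"
  if "koszul_cover n fmult fmult (free_part n (ds (Suc i))) A (\<lambda>_. {0}) (\<delta> i)"
  unfolding koszul_cover.K_def[OF that] syz_def by (simp add: fun_eq_iff)

lemma cover0: "minimal_cover n vmult (ds 0) (homog n) (mon_part n U) lift0"
proof -
  have cov: "koszul_cover n fmult vmult (free_part n (ds 0)) (homog n) (mon_part n U) lift0"
  proof (unfold_locales)
    show "Fm.graded_sub n (free_part n (ds 0) :: int \<Rightarrow> 'k fvec set)" by (rule graded_sub_free_part)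
    show "R.graded_sub n (homog n :: int \<Rightarrow> 'k mpoly set)" by (rule graded_sub_homog)
    show "R.graded_sub n (mon_part n U :: int \<Rightarrow> 'k mpoly set)" by (rule graded_sub_mon_part[OF U])
    show "mon_part n U j \<subseteq> (homog n j :: 'k mpoly set)" for j by (auto simp: mon_part_def)
    show "lift0 v \<in> homog n j" if "v \<in> free_part n (ds 0) j" for v j by (rule lift0_homog[OF that])
    show "lift0 (v + w) = lift0 v + lift0 w" for v w by (rule lift0_add)
    show "lift0 (fmult i v) = var i * lift0 v" for i v
      by (simp add: lift0_def sum_distrib_left mult.assoc)
    fix a :: "'k mpoly" and j assume a: "a \<in> homog n j"
    then have "coset a \<in> \<epsilon> ` carrier (free_module n (ds 0))"
      unfolding eps_onto using homog_carrier by (auto simp: quot_module_simps)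
    then obtain v where v: "v \<in> carrier (free_module n (ds 0))" "coset a = \<epsilon> v" by blast
    then have "a - lift0 v \<in> I" using eps_lift0[OF v(1)] coset_eq_iff by simp
    then have "hom_part j (a - lift0 v) \<in> mon_part n U j" unfolding I_eq by (rule hom_part_monomial_ideal)
    \<comment> \<open>The preimage \<open>v\<close> need not be homogeneous; its component of degree
      \<open>j\<close> serves instead, since \<open>lift0\<close> commutes with taking
      components.\<close>
    moreover have "hom_part j (a - lift0 v) = a - lift0 (vec_part (ds 0) j v)"
    proof -
      have "hom_part j (a - lift0 v + lift0 v) = hom_part j (a - lift0 v) + hom_part j (lift0 v)"
        by (rule hom_part_add)
      then show ?thesis using hom_part_same[OF a, of j] lift0_vec_part[OF v(1), of j] by (simp add: eq_diff_eq)
    qed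
    ultimately show "\<exists>v\<in>free_part n (ds 0) j. a - lift0 v \<in> mon_part n U j"
      using vec_part_free[OF v(1), of j] by auto
  qed
  show ?thesis
    by (intro minimal_cover.intro cov minimal_cover_axioms.intro) (unfold syz0[OF cov], rule syz_minimal)
qed

lemma graded_sub_syz: "Fm.graded_sub n (syz i)"
proof (induction i)
  case 0
  interpret minimal_cover n vmult "ds 0" "homog n" "mon_part n U" lift0 by (rule cover0)
  show ?case using graded_sub_K syz0[OF koszul_cover_axioms] by simp
next
  case (Suc i)
  show ?case
    unfolding Fm.graded_sub_def
  proof (intro allI conjI ballI)
    fix j
    have d0: "\<delta> i 0 = 0" using delta_add[OF free_carrier_zero free_carrier_zero, of i] by simp
    show "0 \<in> syz (Suc i) j"
      using Fm.graded_subD(1)[OF graded_sub_free_part] d0 by (simp add: syz_def)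
    fix a assume "a \<in> syz (Suc i) j"
    then have a: "a \<in> free_part n (ds (Suc i)) j" "\<delta> i a = 0" by (auto simp: syz_def)
    show "a - b \<in> syz (Suc i) j" if "b \<in> syz (Suc i) j" for b
    proof -
      have b: "b \<in> free_part n (ds (Suc i)) j" "\<delta> i b = 0" using that by (auto simp: syz_def)
      have ab: "a - b \<in> free_part n (ds (Suc i)) j" by (rule Fm.graded_subD(2)[OF graded_sub_free_part a(1) b(1)])
      have "\<delta> i (a - b + b) = \<delta> i (a - b) + \<delta> i b"
        by (rule delta_add[OF free_part_carrier[OF ab] free_part_carrier[OF b(1)]])
      then have "\<delta> i (a - b) = 0" using a b by simp
      then show ?thesis using ab by (simp add: syz_def)
    qed
    show "fmult l a \<in> syz (Suc i) (j + 1)" if l: "l \<in> {1..n}" for l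
    proof -
      have "var l \<in> carrier (poly_ring n)" by (rule homog_carrier[OF homog_var_one[OF l]])
      from delta_smult[OF this free_part_carrier[OF a(1)]]
      have "\<delta> i (fmult l a) = 0" using a(2) by (simp add: fun_eq_iff)
      then show ?thesis using Fm.graded_subD(5)[OF graded_sub_free_part a(1) l] by (simp add: syz_def)
    qed
  qed
qed

lemma coverS: "minimal_cover n fmult (ds (Suc i)) (syz i) (\<lambda>_. {0}) (\<delta> i)"
proof -
  have cov: "koszul_cover n fmult fmult (free_part n (ds (Suc i))) (syz i) (\<lambda>_. {0}) (\<delta> i)"
  proof (unfold_locales)
    show "Fm.graded_sub n (free_part n (ds (Suc i)) :: int \<Rightarrow> 'k fvec set)" by (rule graded_sub_free_part)
    show "Fm.graded_sub n (syz i)" by (rule graded_sub_syz)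
    show "Fm.graded_sub n (\<lambda>_. {0 :: 'k fvec})" by (rule Fm.graded_sub_zero)
    show "{0} \<subseteq> syz i j" for j using Fm.graded_subD(1)[OF graded_sub_syz] by simp
    fix v :: "'k fvec" and j assume v: "v \<in> free_part n (ds (Suc i)) j"
    show "\<delta> i v \<in> syz i j" unfolding syz_iff using delta_deg[OF v] free_part_carrier[OF v] by blast
    show "\<delta> i (v + w) = \<delta> i v + \<delta> i w" if "w \<in> free_part n (ds (Suc i)) j" for w
      by (rule delta_add[OF free_part_carrier[OF v] free_part_carrier[OF that]])
    show "\<delta> i (fmult l v) = fmult l (\<delta> i v)" if l: "l \<in> {1..n}" for l
      by (rule delta_smult[OF homog_carrier[OF homog_var_one[OF l]] free_part_carrier[OF v]])
  next
    fix a j assume "a \<in> syz i j"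
    then obtain v where v: "v \<in> carrier (free_module n (ds (Suc i)))" "a = \<delta> i v" and a: "a \<in> free_part n (ds i) j"
      unfolding syz_iff by blast
    have "\<delta> i (vec_part (ds (Suc i)) j v) = a"
      unfolding delta_vec_part[OF v(1)] v(2)[symmetric] vec_part_same[OF a] by simp
    then show "\<exists>v\<in>free_part n (ds (Suc i)) j. a - \<delta> i v \<in> {0}"
      using vec_part_free[OF v(1), of j] by auto
  qed
  show ?thesis
    by (intro minimal_cover.intro cov minimal_cover_axioms.intro) (unfold syzS[OF cov], rule syz_minimal)
qed

text \<open>The right-hand side does not mention the resolution, so all minimal resolutions agree in
  the degrees of their generators; for the regularity this takes the place of uniqueness up to
  isomorphism.\<close>

theorem betti_degree_iff:
  "j \<in> set (ds i) \<longleftrightarrow> \<not> koszul_zero n vmult (homog n :: int \<Rightarrow> 'k mpoly set) (mon_part n U) i j"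
proof (rule resolution_degrees[where \<K> = syz and \<delta> = \<delta>, OF cover0 _ coverS])
  show "syz 0 = koszul_cover.K (free_part n (ds 0)) (mon_part n U) lift0"
    using syz0[OF minimal_cover.axioms(1)[OF cover0]] by simp
  show "syz (Suc i) = koszul_cover.K (free_part n (ds (Suc i))) (\<lambda>_. {0}) (\<delta> i)" for i
    using syzS[OF minimal_cover.axioms(1)[OF coverS]] by simp
qed

end

section \<open>Existence of the resolution and regularity\<close>

lemma lincomb_vec_part:
  fixes A :: "int \<Rightarrow> 'k::field fvec set"
  assumes cov: "minimal_cover n fmult (map fst L) A (\<lambda>_. {0}) (lincomb L)"
    and sub: "\<And>j. A j \<subseteq> free_part n ds j" and v: "v \<in> carrier (free_module n (map fst L))"
  shows "lincomb L (vec_part (map fst L) j v) = vec_part ds j (lincomb L v)"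
proof -
  interpret minimal_cover n fmult "map fst L" A "\<lambda>_. {0}" "lincomb L" by (rule cov)
  show ?thesis
  proof (rule graded_map_vec_part[where g = "lincomb L" and \<pi> = "vec_part ds", OF _ _ _ v])
    show "vec_part ds j (lincomb L w) = (if j = i then lincomb L w else 0)"
      if "w \<in> free_part n (map fst L) i" for w i
      by (rule vec_part_same[where n = n]) (use f_in[OF that] sub in blast)
  qed (rule lincomb_add vec_part_add)+
qed

text \<open>The cover is onto in each degree. A vector with all components in \<open>A\<close> has
  finitely many nonzero ones, and the sum of their preimages is a preimage of the vector.\<close>

lemma lincomb_image:
  fixes A :: "int \<Rightarrow> 'k::field fvec set"
  assumes cov: "minimal_cover n fmult (map fst L) A (\<lambda>_. {0}) (lincomb L)"
    and sub: "\<And>j. A j \<subseteq> free_part n ds j"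
  shows "lincomb L ` carrier (free_module n (map fst L)) =
    {w \<in> carrier (free_module n ds). \<forall>j. vec_part ds j w \<in> A j}"
proof -
  interpret minimal_cover n fmult "map fst L" A "\<lambda>_. {0}" "lincomb L" by (rule cov)
  have sum: "lincomb L (sum f I) = (\<Sum>i\<in>I. lincomb L (f i))"
    if "\<And>i. i \<in> I \<Longrightarrow> f i \<in> carrier (free_module n (map fst L))" for f and I :: "int set"
    by (rule additive_sum[where g = "lincomb L", OF lincomb_add that])
  show ?thesis
  proof (intro equalityI subsetI)
    fix w assume "w \<in> lincomb L ` carrier (free_module n (map fst L))"
    then obtain v where v: "v \<in> carrier (free_module n (map fst L))" "w = lincomb L v" by blast
    obtain D where D: "finite D" "v = (\<Sum>j\<in>D. vec_part (map fst L) j v)"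
      using vec_part_decomposition[OF v(1)] by metis
    have p: "vec_part (map fst L) j v \<in> free_part n (map fst L) j" for j by (rule vec_part_free[OF v(1)])
    have q: "lincomb L (vec_part (map fst L) j v) \<in> free_part n ds j" for j using f_in[OF p] sub by blast
    have "w = (\<Sum>j\<in>D. lincomb L (vec_part (map fst L) j v))"
      unfolding v(2) by (subst D(2), rule sum, rule free_part_carrier[OF p])
    also have "\<dots> \<in> carrier (free_module n ds)"
      by (intro free_carrier_sum free_part_carrier[OF q])
    finally have "w \<in> carrier (free_module n ds)" .
    moreover have "vec_part ds j w \<in> A j" for j
      using lincomb_vec_part[OF cov sub v(1), of j] f_in[OF p, of j] unfolding v(2) by simp
    ultimately show "w \<in> {w \<in> carrier (free_module n ds). \<forall>j. vec_part ds j w \<in> A j}" by blast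
  next
    fix w assume "w \<in> {w \<in> carrier (free_module n ds). \<forall>j. vec_part ds j w \<in> A j}"
    then have w: "w \<in> carrier (free_module n ds)" "\<And>j. vec_part ds j w \<in> A j" by auto
    obtain D where D: "finite D" "w = (\<Sum>j\<in>D. vec_part ds j w)"
      using vec_part_decomposition[OF w(1)] by metis
    have "\<exists>v. v \<in> free_part n (map fst L) j \<and> vec_part ds j w = lincomb L v" for j
      using f_onto[OF w(2)[of j]] by auto
    then obtain v where v: "\<And>j. v j \<in> free_part n (map fst L) j" "\<And>j. vec_part ds j w = lincomb L (v j)"
      by metis
    have "lincomb L (\<Sum>j\<in>D. v j) = (\<Sum>j\<in>D. lincomb L (v j))"
      by (rule sum) (rule free_part_carrier[OF v(1)])
    also have "\<dots> = (\<Sum>j\<in>D. vec_part ds j w)" by (rule sum.cong[OF refl]) (simp only: v(2))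
    also have "\<dots> = w" by (rule D(2)[symmetric])
    finally have "w = lincomb L (\<Sum>j\<in>D. v j)" by (rule sym)
    moreover have "(\<Sum>j\<in>D. v j) \<in> carrier (free_module n (map fst L))"
      by (rule free_carrier_sum) (rule free_part_carrier[OF v(1)])
    ultimately show "w \<in> lincomb L ` carrier (free_module n (map fst L))" by (rule image_eqI)
  qed
qed

text \<open>Kernel and image have the same shape, all components in a prescribed family, so
  exactness on carriers reduces to the families being equal.\<close>

lemma lincomb_kernel:
  fixes A :: "int \<Rightarrow> 'k::field fvec set"
  assumes cov: "minimal_cover n fmult (map fst L) A (\<lambda>_. {0}) (lincomb L)"
    and sub: "\<And>j. A j \<subseteq> free_part n ds j"
  shows "{v \<in> carrier (free_module n (map fst L)). lincomb L v = 0} =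
    {v \<in> carrier (free_module n (map fst L)).
      \<forall>j. vec_part (map fst L) j v \<in> koszul_cover.K (free_part n (map fst L)) (\<lambda>_. {0}) (lincomb L) j}"
proof -
  interpret minimal_cover n fmult "map fst L" A "\<lambda>_. {0}" "lincomb L" by (rule cov)
  have "lincomb L v = 0 \<longleftrightarrow> (\<forall>j. vec_part (map fst L) j v \<in> K j)"
    if v: "v \<in> carrier (free_module n (map fst L))" for v
  proof
    assume "lincomb L v = 0"
    moreover have "vec_part ds j 0 = (0 :: 'k fvec)" for j
      using vec_part_same[OF Fm.graded_subD(1)[OF graded_sub_free_part[of n ds], of j], where i = j] by simp
    ultimately have "lincomb L (vec_part (map fst L) j v) = 0" for j
      unfolding lincomb_vec_part[OF cov sub v] by (simp only:)
    then show "\<forall>j. vec_part (map fst L) j v \<in> K j" using vec_part_free[OF v] unfolding K_def by blast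
  next
    assume a: "\<forall>j. vec_part (map fst L) j v \<in> K j"
    obtain D where D: "finite D" "v = (\<Sum>j\<in>D. vec_part (map fst L) j v)"
      using vec_part_decomposition[OF v] by metis
    have "lincomb L v = (\<Sum>j\<in>D. lincomb L (vec_part (map fst L) j v))"
      by (subst D(2), rule additive_sum[where g = "lincomb L", OF lincomb_add])
        (rule free_part_carrier[OF vec_part_free[OF v]])
    also have "\<dots> = 0" by (rule sum.neutral) (use a in \<open>auto simp only: K_def mem_Collect_eq singleton_iff\<close>)
    finally show "lincomb L v = 0" .
  qed
  then show ?thesis by blast
qed

context monomial_quotient
begin

text \<open>The projection of \<open>R\<close> onto \<open>R/I\<close> is minimal because no
  polynomial in \<open>I\<close> has a constant term, 1 not being among its monomials.\<close>

lemma first_cover: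
  assumes nz: "(\<lambda>_. 0) \<notin> U"
  shows "minimal_cover n vmult [0] (homog n) (mon_part n U) (\<lambda>v :: 'k fvec. v 0)"
proof -
  have cov: "koszul_cover n fmult vmult (free_part n [0]) (homog n) (mon_part n U) (\<lambda>v :: 'k fvec. v 0)"
  proof (unfold_locales)
    show "Fm.graded_sub n (free_part n [0] :: int \<Rightarrow> 'k fvec set)" by (rule graded_sub_free_part)
    show "R.graded_sub n (homog n :: int \<Rightarrow> 'k mpoly set)" by (rule graded_sub_homog)
    show "R.graded_sub n (mon_part n U :: int \<Rightarrow> 'k mpoly set)" by (rule graded_sub_mon_part[OF U])
    show "mon_part n U j \<subseteq> (homog n j :: 'k mpoly set)" for j by (auto simp: mon_part_def)
    show "v 0 \<in> homog n j" if "v \<in> free_part n [0] j" for v :: "'k fvec" and j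
      using free_partD(1)[OF that, of 0] by simp
    show "\<exists>v\<in>free_part n [0] j. a - v 0 \<in> mon_part n U j" if "a \<in> homog n j" for a :: "'k mpoly" and j
    proof (rule bexI[of _ "\<lambda>k. if k = 0 then a else 0"])
      show "a - (if 0 = (0::nat) then a else 0) \<in> mon_part n U j" by (simp add: mon_part_iff)
      show "(\<lambda>k. if k = 0 then a else 0) \<in> free_part n [0] j" by (rule free_partI) (use that in auto)
    qed
  qed simp_all
  show ?thesis
  proof (intro minimal_cover.intro cov minimal_cover_axioms.intro)
    fix v j k assume "v \<in> koszul_cover.K (free_part n [0]) (mon_part n U) (\<lambda>v :: 'k fvec. v 0) j"
      and "k < length [0 :: int]"
    then have "v 0 \<in> mon_part n U j" "k = 0" by (auto simp: koszul_cover.K_def[OF cov])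
    then show "Poly_Mapping.lookup (v k) 0 = 0"
      using nz unfolding mon_part_iff by (metis lookup_zero ext)
  qed
qed

theorem minimal_free_resolution_exists:
  assumes nz: "(\<lambda>_. 0) \<notin> U"
    and van: "\<And>p j. r < j - int p \<Longrightarrow>
      koszul_zero n vmult (homog n :: int \<Rightarrow> 'k mpoly set) (mon_part n U) p j"
  shows "\<exists>ds \<epsilon> \<delta>. minimal_free_resolution n (quot_module n I) ds \<epsilon> \<delta>"
proof -
  interpret C: minimal_cover n vmult "[0]" "homog n" "mon_part n U" "\<lambda>v :: 'k fvec. v 0"
    by (rule first_cover[OF nz])
  have K_iff: "v \<in> C.K j \<longleftrightarrow> v \<in> free_part n [0] j \<and> v 0 \<in> mon_part n U j" for v j
    by (simp add: C.K_def)
  have gK: "graded_submodule n C.K"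
    unfolding graded_submodule_def
  proof (intro allI conjI ballI)
    fix j
    have z: "(\<lambda>_. 0) = (0 :: 'k fvec)" by (simp add: zero_fun_def)
    show "(\<lambda>_. 0) \<in> C.K j" unfolding z by (rule Fm.graded_subD(1)[OF C.graded_sub_K])
    fix v assume v: "v \<in> C.K j"
    show "(\<lambda>k. v k + w k) \<in> C.K j" if "w \<in> C.K j" for w
      using Fm.graded_subD(4)[OF C.graded_sub_K v that] unfolding plus_fun_def .
    fix i and a :: "'k mpoly" assume a: "a \<in> homog n i"
    have vF: "v \<in> free_part n [0] j" and v0: "v 0 \<in> mon_part n U j" using v by (auto simp: K_iff)
    have "(\<lambda>k. a * v k) \<in> free_part n [0] (i + j)"
      by (rule free_partI) (use homog_mult[OF a] free_partD[OF vF] in auto)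
    moreover have "a * v 0 \<in> mon_part n U (i + j)"
      using v0 a homog_mult[OF a, of "v 0" j] monomial_ideal_mult[OF U homog_carrier[OF a], of "v 0"]
      unfolding mon_part_eq by blast
    ultimately show "(\<lambda>k. a * v k) \<in> C.K (i + j)" by (simp add: K_iff)
  qed
  have KF: "C.K j \<subseteq> free_part n [0] j" for j by (auto simp: K_iff)
  \<comment> \<open>The first syzygy module is the ideal itself, embedded in the free module of rank
    1; its bound exceeds that of the quotient by 1.\<close>
  have vanK: "koszul_zero n fmult C.K (\<lambda>_. {0}) p j" if "r + 1 < j - int p" for p j
    unfolding C.koszul_zero_K by (rule van) (use that in simp)
  obtain ds \<K> L where ds0: "ds 0 = [0]" and K0: "\<K> 0 = C.K"
    and sub: "\<And>i j. \<K> i j \<subseteq> free_part n (ds i) j" and dsS: "\<And>i. ds (Suc i) = map fst (L i)"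
    and cov: "\<And>i. minimal_cover n fmult (ds (Suc i)) (\<K> i) (\<lambda>_. {0}) (lincomb (L i))"
    and KS: "\<And>i. \<K> (Suc i) = koszul_cover.K (free_part n (ds (Suc i))) (\<lambda>_. {0}) (lincomb (L i))"
    using resolution_exists[OF gK KF vanK] by metis
  note cov' = cov[unfolded dsS]
  define \<epsilon> where "\<epsilon> = (\<lambda>v :: 'k fvec. coset (v 0))"
  \<comment> \<open>The whole module whose homogeneous parts are the \<open>\<K> i j\<close>; both
    images and kernels will be identified with it.\<close>
  define tot where "tot = (\<lambda>i. {w \<in> carrier (free_module n (ds i)). \<forall>j. vec_part (ds i) j w \<in> \<K> i j})"
  have image: "lincomb (L i) ` carrier (free_module n (ds (Suc i))) = tot i" for i
    using lincomb_image[OF cov' sub] unfolding tot_def dsS .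
  have kernel: "a_kernel (free_module n (ds (Suc i))) (free_module n (ds i)) (lincomb (L i)) = tot (Suc i)" for i
    using lincomb_kernel[OF cov' sub] unfolding tot_def dsS KS a_kernel_def' free_module_simps(3) .
  have kernel0: "a_kernel (free_module n (ds 0)) (quot_module n I) \<epsilon> = tot 0"
  proof -
    have "v 0 \<in> I \<longleftrightarrow> (\<forall>j. vec_part [0] j v \<in> C.K j)" if v: "v \<in> carrier (free_module n [0])" for v
    proof
      assume "v 0 \<in> I"
      then have "hom_part j (v 0) \<in> mon_part n U j" for j unfolding I_eq by (rule hom_part_monomial_ideal)
      then show "\<forall>j. vec_part [0] j v \<in> C.K j"
        using vec_part_free[OF v] by (auto simp: K_iff vec_part_def)
    next
      assume a: "\<forall>j. vec_part [0] j v \<in> C.K j"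
      obtain D where D: "finite D" "v = (\<Sum>j\<in>D. vec_part [0] j v)"
        using vec_part_decomposition[OF v] by metis
      have "v 0 = (\<Sum>j\<in>D. vec_part [0] j v 0)" by (subst D(2)) (rule fun_sum_apply)
      also have "\<dots> \<in> I" unfolding I_eq
        by (rule monomial_ideal_sum) (use a in \<open>auto simp: K_iff mon_part_eq\<close>)
      finally show "v 0 \<in> I" .
    qed
    then show ?thesis
      unfolding a_kernel_def' tot_def ds0 K0 quot_module_simps(2) \<epsilon>_def coset_zero_iff by blast
  qed
  have minK: "Poly_Mapping.lookup (w k) 0 = 0" if "w \<in> \<K> i j" "k < length (ds i)" for w i j k
  proof (cases i)
    case 0
    then show ?thesis using C.minimal[of w j k] that by (simp add: K0 ds0)
  next
    case (Suc i')
    then show ?thesis using minimal_cover.minimal[OF cov[of i'], of w j k] that by (simp add: KS)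
  qed
  have "minimal_free_resolution n (quot_module n I) ds \<epsilon> (\<lambda>i. lincomb (L i))"
    unfolding minimal_free_resolution_def Let_def
  proof (intro conjI allI ballI impI)
    show "\<epsilon> \<in> graded_hom n (free_module n (ds 0)) (quot_module n I)"
      unfolding graded_hom_def hom_def
    proof (intro CollectI conjI ballI allI)
      show "\<epsilon> \<in> carrier (add_monoid (free_module n (ds 0))) \<rightarrow> carrier (add_monoid (quot_module n I))"
        by (auto simp: \<epsilon>_def quot_module_simps free_carrierD(3))
      fix v :: "'k fvec" assume v: "v \<in> carrier (add_monoid (free_module n (ds 0)))"
      then have v': "v \<in> carrier (free_module n (ds 0))" by simp
      show "\<epsilon> (v \<otimes>\<^bsub>add_monoid (free_module n (ds 0))\<^esub> w) =
          \<epsilon> v \<otimes>\<^bsub>add_monoid (quot_module n I)\<^esub> \<epsilon> w"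
        if w: "w \<in> carrier (add_monoid (free_module n (ds 0)))" for w :: "'k fvec"
      proof -
        have w': "w \<in> carrier (free_module n (ds 0))" using w by simp
        show ?thesis
          using quot_module_add[OF free_carrierD(3)[OF v'] free_carrierD(3)[OF w']]
          by (simp add: \<epsilon>_def free_module_simps(2))
      qed
    next
      fix r :: "'k mpoly" and v :: "'k fvec" assume r: "r \<in> carrier (poly_ring n)" and v: "v \<in> carrier (free_module n (ds 0))"
      show "\<epsilon> (r \<odot>\<^bsub>free_module n (ds 0)\<^esub> v) = r \<odot>\<^bsub>quot_module n I\<^esub> \<epsilon> v"
        using quot_module_smult[OF r free_carrierD(3)[OF v]] by (simp add: \<epsilon>_def free_module_simps(4))
    next
      fix j
      have "v 0 \<in> homog n j" if "v \<in> free_part n [0] j" for v :: "'k fvec"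
        using free_partD(1)[OF that, of 0] by simp
      then show "\<epsilon> ` hcomp (free_module n (ds 0)) j \<subseteq> hcomp (quot_module n I) j"
        by (auto simp: \<epsilon>_def hcomp_free_module quot_module_simps ds0)
    qed
  next
    fix i
    show "lincomb (L i) \<in> graded_hom n (free_module n (ds (Suc i))) (free_module n (ds i))"
      unfolding graded_hom_def hom_def
    proof (intro CollectI conjI ballI allI)
      show "lincomb (L i) \<in> carrier (add_monoid (free_module n (ds (Suc i)))) \<rightarrow>
          carrier (add_monoid (free_module n (ds i)))"
        using image[of i] by (auto simp: tot_def)
      show "lincomb (L i) (v \<otimes>\<^bsub>add_monoid (free_module n (ds (Suc i)))\<^esub> w) =
          lincomb (L i) v \<otimes>\<^bsub>add_monoid (free_module n (ds i))\<^esub> lincomb (L i) w" for v w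
        by (simp add: free_module_simps(2) lincomb_add)
      show "lincomb (L i) (r \<odot>\<^bsub>free_module n (ds (Suc i))\<^esub> v) =
          r \<odot>\<^bsub>free_module n (ds i)\<^esub> lincomb (L i) v" for r v
        by (simp add: free_module_simps(4) lincomb_scale)
      fix j
      interpret M: minimal_cover n fmult "ds (Suc i)" "\<K> i" "\<lambda>_. {0}" "lincomb (L i)" by (rule cov)
      show "lincomb (L i) ` hcomp (free_module n (ds (Suc i))) j \<subseteq> hcomp (free_module n (ds i)) j"
        unfolding hcomp_free_module using M.f_in[of _ j] sub[of i j] by blast
    qed
  next
    show "\<epsilon> ` carrier (free_module n (ds 0)) = carrier (quot_module n I)"
    proof (intro equalityI subsetI)
      fix x assume "x \<in> \<epsilon> ` carrier (free_module n (ds 0))"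
      then show "x \<in> carrier (quot_module n I)" by (auto simp: \<epsilon>_def quot_module_simps free_carrierD(3))
    next
      fix x assume "x \<in> carrier (quot_module n I)"
      then obtain p where p: "p \<in> carrier (poly_ring n)" "x = coset p" by (auto simp: quot_module_simps)
      have "(\<lambda>k. if k = 0 then p else 0) \<in> carrier (free_module n (ds 0))"
        unfolding ds0 by (rule free_carrierI) (use p in auto)
      then show "x \<in> \<epsilon> ` carrier (free_module n (ds 0))"
        by (rule rev_image_eqI) (simp add: \<epsilon>_def p(2))
    qed
  next
    show "lincomb (L 0) ` carrier (free_module n (ds 1)) = a_kernel (free_module n (ds 0)) (quot_module n I) \<epsilon>"
      using image[of 0] kernel0 by simp
  next
    fix i
    show "lincomb (L (Suc i)) ` carrier (free_module n (ds (Suc (Suc i)))) =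
        a_kernel (free_module n (ds (Suc i))) (free_module n (ds i)) (lincomb (L i))"
      unfolding image kernel ..
  next
    fix i and v :: "'k fvec" and k
    assume v: "v \<in> carrier (free_module n (ds (Suc i)))" and k: "k < length (ds i)"
    have "lincomb (L i) v \<in> tot i" using v image[of i] by blast
    then have w: "lincomb (L i) v \<in> carrier (free_module n (ds i))"
        "vec_part (ds i) (ds i ! k) (lincomb (L i) v) \<in> \<K> i (ds i ! k)"
      unfolding tot_def by blast+
    \<comment> \<open>The constant term of coordinate \<open>k\<close> sits in the component of
      degree \<open>ds i ! k\<close>, where minimality of the covers applies.\<close>
    have "Poly_Mapping.lookup (vec_part (ds i) (ds i ! k) (lincomb (L i) v) k) 0 = 0"
      by (rule minK[OF w(2) k])
    then have "Poly_Mapping.lookup (lincomb (L i) v k) 0 = 0"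
      using k by (simp add: vec_part_def lookup_hom_part monom_deg_def)
    then show "lincomb (L i) v k \<in> irrelevant_ideal n"
      using free_carrierD(3)[OF w(1)] by (simp add: irrelevant_ideal_iff)
  qed
  then show ?thesis by blast
qed

lemma reg_quot_module:
  assumes nz: "(\<lambda>_. 0) \<notin> U"
    and van: "\<And>p j. r < j - int p \<Longrightarrow>
      koszul_zero n vmult (homog n :: int \<Rightarrow> 'k mpoly set) (mon_part n U) p j"
    and nonzero: "\<not> koszul_zero n vmult (homog n :: int \<Rightarrow> 'k mpoly set) (mon_part n U) q (r + int q)"
  shows "reg n (quot_module n I) = r"
proof -
  \<comment> \<open>The family of degrees picked by the choice operator inside \<open>betti\<close>;
    existence of a resolution makes it a genuine one.\<close>
  define D where "D = (SOME ds. \<exists>\<epsilon> \<delta>. minimal_free_resolution n (quot_module n I) ds \<epsilon> \<delta>)"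
  have "\<exists>\<epsilon> \<delta>. minimal_free_resolution n (quot_module n I) D \<epsilon> \<delta>"
    unfolding D_def
    by (rule someI_ex[where P = "\<lambda>ds. \<exists>\<epsilon> \<delta>. minimal_free_resolution n (quot_module n I) ds \<epsilon> \<delta>"])
      (rule minimal_free_resolution_exists[OF nz van])
  then obtain \<epsilon> \<delta> where "minimal_free_resolution n (quot_module n I) D \<epsilon> \<delta>" by blast
  then interpret quotient_resolution n U I D \<epsilon> \<delta> by unfold_locales
  have betti: "betti n (quot_module n I) i j \<noteq> 0 \<longleftrightarrow>
      \<not> koszul_zero n vmult (homog n :: int \<Rightarrow> 'k mpoly set) (mon_part n U) i j" for i j
    using betti_degree_iff[of j i] by (simp add: betti_def D_def[symmetric] count_list_0_iff)
  define S where "S = {j - int i | i j. betti n (quot_module n I) i j \<noteq> 0}"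
  \<comment> \<open>Chains with coefficients of negative degree are zero. This lower bound makes the
    set of differences finite, as \<open>Max\<close> requires.\<close>
  have nonneg: "koszul_zero n vmult (homog n :: int \<Rightarrow> 'k mpoly set) (mon_part n U) i j" if "j < int i" for i j
    unfolding koszul_zero_def
  proof (intro ballI impI)
    fix c :: "nat set \<Rightarrow> 'k mpoly" assume c: "c \<in> kchain n (homog n) i j"
    have "c S = 0" for S
      using homog_negative[OF R.kchain_in[OF graded_sub_homog c, of S]] that by simp
    then show "\<exists>e\<in>kchain n (homog n) (Suc i) j. \<forall>S. c S - kdiff n vmult e S \<in> mon_part n U (j - int i)"
      by (intro bexI[of _ "\<lambda>_. 0"]) (auto simp: R.kdiff_zero mon_part_iff homog_zero intro: R.kchainI)
  qed
  have sub: "S \<subseteq> {0..r}"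
  proof
    fix x assume "x \<in> S"
    then obtain i j where x: "x = j - int i" "betti n (quot_module n I) i j \<noteq> 0" unfolding S_def by blast
    then show "x \<in> {0..r}" using betti[of i j] nonneg[of j i] van[of j i] by force
  qed
  have "betti n (quot_module n I) q (r + int q) \<noteq> 0" using betti nonzero by blast
  moreover have "r = (r + int q) - int q" by simp
  ultimately have "r \<in> S" unfolding S_def by blast
  moreover have "finite S" using sub by (rule finite_subset) simp
  ultimately have "Max S = r" using sub by (intro Max_eqI) auto
  then show ?thesis by (simp only: reg_def S_def)
qed

end

lemma zero_notin_power_exps:
  assumes "1 \<le> s" "1 \<le> t"
  shows "(\<lambda>_. 0) \<notin> power_exps n t s"
proof
  assume "(\<lambda>_. 0) \<in> power_exps n t s"
  then obtain h where h: "(\<Sum>i=1..n + 1 - t. h i) = s" "path_exp t h \<le> (\<lambda>_. 0)"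
    by (auto simp: power_exps_def)
  obtain i where i: "i \<in> {1..n + 1 - t}" "h i \<noteq> 0" using h(1) assms by (metis not_one_le_zero sum.neutral)
  have "h i \<le> path_exp t h i" unfolding path_exp_def by (rule member_le_sum) (use i assms in auto)
  then show False using le_funD[OF h(2), of i] i by simp
qed

text \<open>Passing from \<open>n\<close> to \<open>n + 1\<close> raises the quotient by
  \<open>t + 1\<close> exactly when the remainder is \<open>t\<close>, which merges the two cases of
  \<Gamma>.\<close>

lemma Gamma_eq:
  assumes "1 \<le> t"
  shows "Gamma n t = int ((n + 1) div (t + 1)) * (int t - 1)"
proof (cases "n mod (t + 1) < t")
  case True
  then have "(n + 1) div (t + 1) = n div (t + 1)" using div_Suc[of n "t + 1"] mod_Suc[of n "t + 1"] by simp
  then show ?thesis using True by (simp add: Gamma_def Let_def)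
next
  case False
  then have "n mod (t + 1) = t" using mod_less_divisor[of "t + 1" n] by linarith
  then have "(n + 1) div (t + 1) = n div (t + 1) + 1"
    using div_Suc[of n "t + 1"] mod_Suc[of n "t + 1"] by simp
  then show ?thesis using False by (simp add: Gamma_def Let_def)
qed

theorem theorem3p6:
  fixes n t s :: nat
  assumes "n \<ge> t" and "t \<ge> 2" and "s \<ge> 1"
  shows "reg n (quot_module n (ideal_power n (path_ideal n t :: 'k::field mpoly set) s))
           = Gamma n t + int t * (int s - 1)"
proof -
  let ?U = "power_exps n t s"
  define q where "q = (n + 1) div (t + 1)"
  define r where "r = (t - 1) * q + t * (s - 1)"
  have t1: "1 \<le> t" using assms by simp
  interpret monomial_quotient n ?U "monomial_ideal n ?U :: 'k mpoly set"
    by unfold_locales (rule upset_power_exps refl)+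
  have UE: "?U \<union> (exps n - ?U) = exps n" by (auto simp: power_exps_def)
  have "reg n (quot_module n (monomial_ideal n ?U :: 'k mpoly set)) = int r"
  proof (rule reg_quot_module[where q = q])
    show "(\<lambda>_. 0) \<notin> ?U" using assms t1 by (intro zero_notin_power_exps)
    fix p and j :: int assume "int r < j - int p"
    then show "koszul_zero n vmult (homog n :: int \<Rightarrow> 'k mpoly set) (mon_part n ?U) p j"
      using koszul_zero_box_filt[OF box_filt_power[OF assms(1) t1 assms(3)], of ?U j p, where ?'k = 'k]
        upset_power_exps upset_exps unfolding UE mon_part_exps r_def q_def by blast
  next
    interpret disjoint_blocks n t s q by unfold_locales (use assms t1 in \<open>auto simp: q_def\<close>)
    \<comment> \<open>The point where the bounds meet:
      \<open>t (s + q - 1) - q = (t - 1) q + t (s - 1)\<close>.\<close>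
    have "int (t * (s + q - 1)) = int r + int q"
    proof -
      obtain t' s' where ts: "t = Suc t'" "s = Suc s'" using t1 assms(3) by (metis Suc_le_D One_nat_def)
      show ?thesis by (simp add: r_def ts algebra_simps)
    qed
    then show "\<not> koszul_zero n vmult (homog n :: int \<Rightarrow> 'k mpoly set) (mon_part n ?U) q (int r + int q)"
      using koszul_nonzero by simp
  qed
  moreover have "int r = Gamma n t + int t * (int s - 1)"
    using t1 assms(3) by (simp add: r_def q_def Gamma_eq of_nat_diff)
  ultimately show ?thesis by (simp add: ideal_power_eq)
qed

end
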